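(* Let $K\in\mathcal K(\Delta^o)$ be an irreducible transition kernel and define $G:\mathcal P(\Delta^o)\to\mathcal K(\Delta^o)$ by $$G(m)(x,y)=\sum_{z\in\Delta^o}m(z)K(z,y)=(mK)(y),\qquad x,y\in\Delta^o.$$ Let $\{L^{n+1}\}_{n\in\mathbb N_0}$ be the empirical measures of the associated self-interacting chain, and let $A$ be the $d\times d$ matrix with all entries equal to $1$. Then $\{L^{n+1}\}$ satisfies a large deviation principle on $\mathcal P(\Delta^o)$ with rate function $I_A$: $I_A$ has compact sublevel sets, for each closed $F\subseteq\mathcal P(\Delta^o)$, $\limsup_{n\to\infty}n^{-1}\log P(L^{n+1}\in F)\le-\inf_{m\in F}I_A(m)$, and for each open $U\subseteq\mathcal P(\Delta^o)$, $\liminf_{n\to\infty}n^{-1}\log P(L^{n+1}\in U)\ge-\inf_{m\in U}I_A(m)$.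
   Context: Setting. Fix $d\in\mathbb N$, $\Delta^o=\{1,\dots,d\}$. For a finite set $S$, $\mathcal P(S)$ is the set of probability measures on $S$ with the weak topology; $m(x)=m_x$ denotes $m(\{x\})$, and $\|\cdot\|$ is the $\ell^1$ norm. $\mathcal K(\Delta^o)$ is the set of transition kernels on $\Delta^o$ ($d\times d$ stochastic matrices). $R(\nu\|\mu)=\int\log\frac{d\nu}{d\mu}\,d\nu$ if $\nu\ll\mu$ and $+\infty$ otherwise. For $\lambda\in\mathcal P(\Delta^o\times\Delta^o)$, $\lambda_{(1)},\lambda_{(2)}$ denote its marginals. Process. Fix $x_0\in\Delta^o$. $\{X_n\}_{n\in\mathbb N_0}$ is a sequence of $\Delta^o$-valued random variables with $X_0=x_0$ and $P(X_{n+1}=y\mid X_0,\dots,X_n)=G(L^{n+1})_{X_n,y}$, where $L^{n+1}=\frac1{n+1}\sum_{i=0}^n\delta_{X_i}$. Adjacency matrices. $A_+=\{(x,y)\in\Delta^o\times\Delta^o:A_{x,y}=1\}$ and $(A_+)^c$ is its complement in $\Delta^o\times\Delta^o$ (empty for the all-ones matrix). Function $I_A$. Let $\mathcal U$ be the set of measurable maps $\eta:\mathbb R_+\to\mathcal P(\Delta^o\times\Delta^o)$, written $\eta(s)=\eta(\cdot\mid s)$, with disintegration $\eta(x,y\mid s)=\eta_{(1)}(x\mid s)\,\eta_{2|1}(y\mid s,x)$. For $m\in\mathcal P(\Delta^o)$ and $\eta\in\mathcal U$ let $M\in C([0,\infty):\mathbb R^d)$ be the unique solution of $$M(t)=m-\int_0^t\eta_{(1)}(s)\,ds+\int_0^tM(s)\,ds,\quad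 t\ge0.$$ $\mathcal U(m)$ is the set of $\eta\in\mathcal U$ such that: (a) $\eta(x,y\mid t)=0$ for all $(x,y)\in(A_+)^c$ and a.e. $t$; (b) $\eta_{(1)}(\cdot\mid s)=\eta_{(2)}(\cdot\mid s)$ for a.e. $s$; (c) $M(t)\in\mathcal P(\Delta^o)$ for all $t$, and there is $M_{\rm pair}\in C(\mathbb R_+:\mathcal P(\Delta^o\times\Delta^o))$ with $\|M_{\rm pair}(t)-M_{\rm pair}(s)\|\le2|t-s|$, $(M_{\rm pair}(t))_{(1)}=(M_{\rm pair}(t))_{(2)}=M(t)$, and $M_{\rm pair}(t)(x,y)=0$ for all $(x,y)\in(A_+)^c$, for all $s,t\in\mathbb R_+$. For $\eta\in\mathcal U(m)$, the function $M$ is said to solve $\mathcal U(m,\eta)$. Define $$I_A(m)=\inf_{\eta\in\mathcal U(m)}\int_0^\infty e^{-s}\sum_{x\in\Delta^o}\eta_{(1)}(x\mid s)\,R\big(\eta_{2|1}(\cdot\mid s,x)\,\|\,G(M(s))(x,\cdot)\big)\,ds,$$ where $M$ solves $\mathcal U(m,\eta)$ (infimum over the empty set is $+\infty$; terms with $\eta_{(1)}(x\mid s)=0$ are $0$). *)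

theory Defs
  imports "HOL-Probability.Probability"
begin

text \<open>
  A probability measure on a finite set \<open>S = UNIV :: 'a set\<close> is identified with its vector of point
  masses in \<open>real ^ 'a\<close>. On this simplex the weak topology is the Euclidean subspace topology, and
  the Borel structure is the Euclidean one. The set \<open>{1, ..., d}\<close> becomes a finite type \<open>'d\<close>, a
  kernel is a matrix of type \<open>real ^ 'd ^ 'd\<close>, with row \<open>K $ x\<close> equal to \<open>K(x, \<cdot>)\<close>.
\<close>

definition prob_vectors :: "(real ^ 'a::finite) set" where
  "prob_vectors = {p. (\<forall>x. 0 \<le> p $ x) \<and> (\<Sum>x\<in>UNIV. p $ x) = 1}"

definition l1_norm :: "real ^ 'a::finite \<Rightarrow> real" where
  "l1_norm v = (\<Sum>x\<in>UNIV. \<bar>v $ x\<bar>)"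

definition marginal1 :: "real ^ ('a::finite \<times> 'a) \<Rightarrow> real ^ 'a" where
  "marginal1 l = (\<chi> x. \<Sum>y\<in>UNIV. l $ (x, y))"

definition marginal2 :: "real ^ ('a::finite \<times> 'a) \<Rightarrow> real ^ 'a" where
  "marginal2 l = (\<chi> y. \<Sum>x\<in>UNIV. l $ (x, y))"

text \<open>The conditional law \<open>l(\<cdot> | x)\<close>; it is the zero vector if the first marginal vanishes at \<open>x\<close>.\<close>

definition cond21 :: "real ^ ('a::finite \<times> 'a) \<Rightarrow> 'a \<Rightarrow> real ^ 'a" where
  "cond21 l x = (\<chi> y. l $ (x, y) / marginal1 l $ x)"

definition transition_kernels :: "(real ^ 'd::finite ^ 'd) set" where
  "transition_kernels = {K. \<forall>x. K $ x \<in> prob_vectors}"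

definition irreducible_kernel :: "real ^ 'd::finite ^ 'd \<Rightarrow> bool" where
  "irreducible_kernel K \<longleftrightarrow> (\<forall>x y. \<exists>n. 0 < ((\<lambda>B. B ** K) ^^ n) (mat 1) $ x $ y)"


subsection \<open>Relative entropy\<close>

definition vec_measure :: "real ^ 'a::finite \<Rightarrow> 'a measure" where
  "vec_measure p = point_measure UNIV (\<lambda>x. ennreal (p $ x))"

text \<open>The library's \<open>KL_divergence b M N\<close> integrates \<open>log\<close> of \<open>dN/dM\<close> with respect to \<open>N\<close>, so the
  arguments are swapped relative to the usual notation \<open>R(\<nu> || \<mu>)\<close>.\<close>

definition rel_entropy :: "real ^ 'a::finite \<Rightarrow> real ^ 'a \<Rightarrow> ereal" where
  "rel_entropy \<nu> \<mu> =
     (if absolutely_continuous (vec_measure \<mu>) (vec_measure \<nu>)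
      then ereal (KL_divergence (exp 1) (vec_measure \<mu>) (vec_measure \<nu>)) else \<infinity>)"

lemma rel_entropy_eq_sum:
  fixes \<nu> \<mu> :: "real ^ 'a::finite"
  assumes "\<nu> \<in> prob_vectors" "\<mu> \<in> prob_vectors"
  shows "rel_entropy \<nu> \<mu> =
     (if \<forall>y. \<mu> $ y = 0 \<longrightarrow> \<nu> $ y = 0 then ereal (\<Sum>y\<in>UNIV. \<nu> $ y * ln (\<nu> $ y / \<mu> $ y)) else \<infinity>)"
proof -
  have nn: "0 \<le> \<nu> $ y" "0 \<le> \<mu> $ y" for y
    using assms by (auto simp: prob_vectors_def)
  have ac: "absolutely_continuous (vec_measure \<mu>) (vec_measure \<nu>) \<longleftrightarrow>
      (\<forall>y. \<mu> $ y = 0 \<longrightarrow> \<nu> $ y = 0)"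
    using nn unfolding absolutely_continuous_def vec_measure_def
    by (simp add: null_sets_point_measure_iff subset_iff ennreal_eq_0_iff)
       (metis order.antisym order.refl singletonD singletonI)
  interpret sigma_finite_measure "count_space (UNIV :: 'a set)"
    by (rule sigma_finite_measure_count_space_finite) simp
  have "KL_divergence (exp 1) (vec_measure \<mu>) (vec_measure \<nu>) =
      (\<Sum>y\<in>UNIV. \<nu> $ y * ln (\<nu> $ y / \<mu> $ y))" if "\<forall>y. \<mu> $ y = 0 \<longrightarrow> \<nu> $ y = 0"
    using KL_density_density[of "exp 1" "\<lambda>y. \<mu> $ y" "\<lambda>y. \<nu> $ y"] nn that
    by (simp add: vec_measure_def point_measure_def lebesgue_integral_count_space_finite
        AE_count_space log_def)
  with ac show ?thesis
    by (simp add: rel_entropy_def)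
qed


subsection \<open>Self-interacting chains\<close>

text \<open>\<open>empirical_measure x n\<close> averages the Dirac masses at \<open>x 0, ..., x (n - 1)\<close>.\<close>

definition empirical_measure :: "(nat \<Rightarrow> 'd::finite) \<Rightarrow> nat \<Rightarrow> real ^ 'd" where
  "empirical_measure x n = (1 / real n) *\<^sub>R (\<Sum>i<n. axis (x i) 1)"

text \<open>As the state space is finite, conditioning on \<open>X 0, ..., X n\<close> is elementary conditioning on
  each path of positive probability.\<close>

definition self_interacting_chain ::
    "'w measure \<Rightarrow> (real ^ 'd::finite \<Rightarrow> real ^ 'd ^ 'd) \<Rightarrow> 'd \<Rightarrow> (nat \<Rightarrow> 'w \<Rightarrow> 'd) \<Rightarrow> bool" where
  "self_interacting_chain P G x0 X \<longleftrightarrow>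
     prob_space P \<and>
     (\<forall>n. X n \<in> measurable P (count_space UNIV)) \<and>
     (AE \<omega> in P. X 0 \<omega> = x0) \<and>
     (\<forall>n x y. \<P>(\<omega> in P. \<forall>i\<le>n. X i \<omega> = x i) > 0 \<longrightarrow>
        \<P>(\<omega> in P. X (Suc n) \<omega> = y \<bar> \<forall>i\<le>n. X i \<omega> = x i) =
          G (empirical_measure x (Suc n)) $ x n $ y)"


subsection \<open>The function \<open>I_A\<close>\<close>

definition adj_set :: "real ^ 'd::finite ^ 'd \<Rightarrow> ('d \<times> 'd) set" where
  "adj_set A = {(x, y). A $ x $ y = 1}"

text \<open>Functions on the half line are functions on \<open>real\<close>, of which only the values on \<open>{0..}\<close> are
  used below.\<close>

definition controls :: "(real \<Rightarrow> real ^ ('d::finite \<times> 'd)) set" where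
  "controls = {\<eta>. \<eta> \<in> borel_measurable (restrict_space borel {0..}) \<and> (\<forall>s\<ge>0. \<eta> s \<in> prob_vectors)}"

definition solves_ode ::
    "real ^ 'd::finite \<Rightarrow> (real \<Rightarrow> real ^ ('d \<times> 'd)) \<Rightarrow> (real \<Rightarrow> real ^ 'd) \<Rightarrow> bool" where
  "solves_ode m \<eta> M \<longleftrightarrow>
     continuous_on {0..} M \<and>
     (\<forall>t\<ge>0. M t = m - integral {0..t} (\<lambda>s. marginal1 (\<eta> s)) + integral {0..t} M)"

definition pair_path ::
    "real ^ 'd::finite ^ 'd \<Rightarrow> (real \<Rightarrow> real ^ 'd) \<Rightarrow> (real \<Rightarrow> real ^ ('d \<times> 'd)) \<Rightarrow> bool" where
  "pair_path A M Mpair \<longleftrightarrow>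
     continuous_on {0..} Mpair \<and>
     (\<forall>t\<ge>0. Mpair t \<in> prob_vectors) \<and>
     (\<forall>s\<ge>0. \<forall>t\<ge>0. l1_norm (Mpair t - Mpair s) \<le> 2 * \<bar>t - s\<bar>) \<and>
     (\<forall>t\<ge>0. marginal1 (Mpair t) = M t \<and> marginal2 (Mpair t) = M t) \<and>
     (\<forall>t\<ge>0. \<forall>z\<in>- adj_set A. Mpair t $ z = 0)"

text \<open>The pairs \<open>(\<eta>, M)\<close> with \<open>\<eta> \<in> U(m)\<close> and \<open>M\<close> the solution associated with \<open>m\<close> and \<open>\<eta>\<close>, which is
  unique on \<open>{0..}\<close>.\<close>

definition admissible_pairs ::
    "real ^ 'd::finite ^ 'd \<Rightarrow> real ^ 'd \<Rightarrow>
     ((real \<Rightarrow> real ^ ('d \<times> 'd)) \<times> (real \<Rightarrow> real ^ 'd)) set" where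
  "admissible_pairs A m = {(\<eta>, M).
     \<eta> \<in> controls \<and> solves_ode m \<eta> M \<and>
     (AE t in lborel. 0 \<le> t \<longrightarrow> (\<forall>z\<in>- adj_set A. \<eta> t $ z = 0)) \<and>
     (AE s in lborel. 0 \<le> s \<longrightarrow> marginal1 (\<eta> s) = marginal2 (\<eta> s)) \<and>
     (\<forall>t\<ge>0. M t \<in> prob_vectors) \<and>
     (\<exists>Mpair. pair_path A M Mpair)}"

text \<open>In \<open>ereal\<close>, \<open>0 * \<infinity> = 0\<close>, so terms with vanishing first marginal are \<open>0\<close>. All other terms are
  relative entropies of probability vectors when \<open>(\<eta>, M)\<close> is admissible and \<open>G\<close> is kernel-valued,
  hence nonnegative, and \<open>e2ennreal\<close> truncates nothing.\<close>

definition control_cost ::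
    "(real ^ 'd::finite \<Rightarrow> real ^ 'd ^ 'd) \<Rightarrow> (real \<Rightarrow> real ^ ('d \<times> 'd)) \<Rightarrow> (real \<Rightarrow> real ^ 'd) \<Rightarrow> ennreal"
  where
  "control_cost G \<eta> M =
     (\<integral>\<^sup>+s\<in>{0..}. e2ennreal (ereal (exp (- s)) *
        (\<Sum>x\<in>UNIV. ereal (marginal1 (\<eta> s) $ x) * rel_entropy (cond21 (\<eta> s) x) (G (M s) $ x))) \<partial>lborel)"

definition rate_I ::
    "(real ^ 'd::finite \<Rightarrow> real ^ 'd ^ 'd) \<Rightarrow> real ^ 'd ^ 'd \<Rightarrow> real ^ 'd \<Rightarrow> ereal" where
  "rate_I G A m = (INF (\<eta>, M)\<in>admissible_pairs A m. enn2ereal (control_cost G \<eta> M))"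


subsection \<open>Large deviation principle\<close>

definition ext_ln :: "real \<Rightarrow> ereal" where
  "ext_ln p = (if p = 0 then - \<infinity> else ereal (ln p))"

definition satisfies_LDP ::
    "'w measure \<Rightarrow> (nat \<Rightarrow> 'w \<Rightarrow> 'e::topological_space) \<Rightarrow> 'e set \<Rightarrow> ('e \<Rightarrow> ereal) \<Rightarrow> bool" where
  "satisfies_LDP P Z S I \<longleftrightarrow>
     (\<forall>m\<in>S. 0 \<le> I m) \<and>
     (\<forall>c::real. compact {m \<in> S. I m \<le> ereal c}) \<and>
     (\<forall>F. closedin (top_of_set S) F \<longrightarrow>
        limsup (\<lambda>n. ereal (1 / real n) * ext_ln \<P>(\<omega> in P. Z n \<omega> \<in> F)) \<le> - (INF m\<in>F. I m)) \<and>
     (\<forall>U. openin (top_of_set S) U \<longrightarrow>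
        - (INF m\<in>U. I m) \<le> liminf (\<lambda>n. ereal (1 / real n) * ext_ln \<P>(\<omega> in P. Z n \<omega> \<in> U)))"

end

theory Submission
  imports Defs "HOL-Real_Asymp.Real_Asymp"
begin

text \<open>
  As \<open>G m\<close> has identical rows, the next state has law \<open>mK\<close> when the empirical measure is \<open>m\<close>, so the counts
  of the visited states form a Markov chain. For the same reason a control may be replaced by its
  marginal \<open>\<sigma>\<close>, and the integrand of the cost by \<open>R(\<sigma> || M K)\<close>. Since \<open>M\<close> is linear in \<open>\<sigma>\<close> and relative entropy
  is jointly convex, the pairs \<open>(m, c)\<close> such that some control reaches \<open>m\<close> at cost at most \<open>c\<close> form a
  convex set; it is closed because minimising sequences in \<open>L\<^sup>2\<close> converge.

  Upper bound: by induction on \<open>n\<close>, the logarithm of the probability of a count vector is compared with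
  the cost of a control. Gibbs' variational formula for the last step produces an average over
  predecessors, to which convexity applies, and an entropy, which is the cost of prolonging the control.
  No discretisation of paths is needed, and there are only polynomially many count vectors.

  Lower bound: irreducibility yields a periodic walk through all states, whose probability decays at
  most exponentially. Starting with a short piece of it keeps all transition probabilities away
  from \<open>0\<close>, and the remaining path is followed in finitely many blocks, in each of which
  the number of words with prescribed counts is a multinomial coefficient.
\<close>

subsection \<open>Relative entropy as a supremum of affine functions\<close>

text \<open>Control time runs backwards: \<open>s\<close> stands for the moment at which a fraction
  \<open>exp (- s)\<close> of the samples has been drawn. Hence the discount is the uniform law on
  these fractions, the newest sample acts at the beginning of the control, and \<open>M\<close> at
  time \<open>s\<close> depends on the control after \<open>s\<close>, that is, on the past of the
  chain. The equation \<open>M' = M - \<sigma>\<close> is unstable, so that staying in the simplex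
  determines the starting point \<open>m\<close> from \<sigma>. The obstacle is \<open>M K\<close>
  having small entries: there \<open>R(\<sigma> || M K)\<close> is unbounded, and laws that are
  close cannot be compared in ratio. Both bounds therefore mix in a weight \<epsilon> of a measure
  \<rho> for which \<open>\<rho> v* K\<close> is at least \<kappa>; joint convexity bounds the
  price, which vanishes with \<epsilon>. Relative entropy is handled through the functions
  \<open>aff s\<close>, linear in the pair of measures, and convexity, semicontinuity and Jensen's
  inequality follow from that linearity. Both bounds and the sublevel sets are phrased through
  \<open>achievable\<close>, which turns out to be the epigraph of the rate function.\<close>

definition aff :: "real ^ 'a::finite \<Rightarrow> real ^ 'a \<Rightarrow> real ^ 'a \<Rightarrow> real" where
  "aff s a b = (\<Sum>y\<in>UNIV. a $ y * s $ y - b $ y * (exp (s $ y) - 1))"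

text \<open>With values in \<open>ennreal\<close>, costs are nonnegative integrals that exist
  without integrability conditions. Between probability vectors the entropy is nonnegative, so
  nothing is truncated.\<close>

definition rent :: "real ^ 'a::finite \<Rightarrow> real ^ 'a \<Rightarrow> ennreal" where
  "rent a b = e2ennreal (rel_entropy a b)"

lemma prob_vectorsD:
  assumes "p \<in> prob_vectors"
  shows "0 \<le> p $ x" "p $ x \<le> 1" "(\<Sum>x\<in>UNIV. p $ x) = 1"
proof -
  show nn: "0 \<le> p $ x" and s: "(\<Sum>x\<in>UNIV. p $ x) = 1" using assms by (auto simp: prob_vectors_def)
  have "p $ x \<le> (\<Sum>x\<in>UNIV. p $ x)"
    using assms by (intro member_le_sum) (auto simp: prob_vectors_def)
  with s show "p $ x \<le> 1" by simp
qed

lemma aff_term_le: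
  fixes a b s :: real
  assumes "0 < a" "0 < b"
  shows "a * s - b * (exp s - 1) \<le> a * ln (a / b) - a + b"
proof -
  have "s - ln (a / b) = ln (exp s * b / a)"
    using assms by (simp add: ln_mult ln_div)
  also have "\<dots> \<le> exp s * b / a - 1"
    using assms by (intro ln_le_minus_one) auto
  finally have "a * (s - ln (a / b)) \<le> a * (exp s * b / a - 1)"
    using assms by (intro mult_left_mono) auto
  then show ?thesis using assms by (simp add: algebra_simps)
qed

text \<open>Convex duality: \<open>exp s - 1\<close> is conjugate to
  \<open>a * ln a - a + 1\<close>, and the extra terms \<open>- a + b\<close> cancel in the sum
  because both vectors have mass 1.\<close>

lemma aff_le_rel_entropy:
  assumes a: "a \<in> prob_vectors" and b: "b \<in> prob_vectors"
  shows "ereal (aff s a b) \<le> rel_entropy a b"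
proof (cases "\<forall>y. b $ y = 0 \<longrightarrow> a $ y = 0")
  case True
  have "a $ y * s $ y - b $ y * (exp (s $ y) - 1) \<le> a $ y * ln (a $ y / b $ y) - a $ y + b $ y" for y
  proof (cases "a $ y = 0")
    case True
    have "- (b $ y * (exp (s $ y) - 1)) = b $ y - b $ y * exp (s $ y)" by (simp add: algebra_simps)
    then show ?thesis using True prob_vectorsD(1)[OF b, of y] by simp
  next
    case False
    with True have "b $ y \<noteq> 0" by auto
    with False show ?thesis using prob_vectorsD(1)[OF b, of y] prob_vectorsD(1)[OF a, of y]
      by (intro aff_term_le) auto
  qed
  then have "aff s a b \<le> (\<Sum>y\<in>UNIV. a $ y * ln (a $ y / b $ y) - a $ y + b $ y)"
    unfolding aff_def by (intro sum_mono)
  also have "\<dots> = (\<Sum>y\<in>UNIV. a $ y * ln (a $ y / b $ y))"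
    using prob_vectorsD(3)[OF a] prob_vectorsD(3)[OF b] by (simp add: sum.distrib sum_subtractf)
  finally show ?thesis using True by (simp add: rel_entropy_eq_sum[OF a b])
next
  case False
  then have "rel_entropy a b = \<infinity>" unfolding rel_entropy_eq_sum[OF a b] by (simp only: if_False)
  then show ?thesis by simp
qed

text \<open>The converse half of the duality: the entropy is the least upper bound of the
  \<open>aff s\<close>. Convexity, semicontinuity and Jensen's inequality below are proved by
  bounding \<open>aff s\<close> for arbitrary \<open>s\<close>.\<close>

lemma rel_entropy_leI:
  assumes a: "a \<in> prob_vectors" and b: "b \<in> prob_vectors" and le: "\<And>s. aff s a b \<le> c"
  shows "rel_entropy a b \<le> ereal c"
proof -
  have ac: "a $ y = 0" if by0: "b $ y = 0" for y
  proof (rule ccontr)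
    assume "a $ y \<noteq> 0"
    then have pos: "0 < a $ y" using prob_vectorsD(1)[OF a, of y] by simp
    \<comment> \<open>With \<open>b $ y = 0\<close> a test vector concentrated at \<open>y\<close>
      loses nothing through its exponential, and this height makes \<open>aff\<close> exceed
      \<open>c\<close>.\<close>
    define t where "t = (\<bar>c\<bar> + 1) / a $ y"
    have "aff (axis y t) a b = (\<Sum>z\<in>UNIV. if z = y then a $ y * t else 0)"
      unfolding aff_def by (intro sum.cong) (auto simp: axis_def by0)
    also have "\<dots> = \<bar>c\<bar> + 1" using pos by (simp add: t_def)
    finally show False using le[of "axis y t"] by simp
  qed
  have "(\<Sum>y\<in>UNIV. a $ y * ln (a $ y / b $ y)) \<le> c + e" if e: "0 < e" for e
  proof -
    \<comment> \<open>The optimiser is \<open>ln (a / b)\<close>. Where \<open>a\<close> vanishes it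
      would be minus infinity; \<open>ln e\<close> instead costs at most \<open>e\<close> in total,
      as \<open>b\<close> has mass 1.\<close>
    define s where "s = (\<chi> y. if a $ y = 0 then ln e else ln (a $ y / b $ y))"
    have "a $ y * ln (a $ y / b $ y) - a $ y + b $ y - b $ y * e
        \<le> a $ y * s $ y - b $ y * (exp (s $ y) - 1)" for y
    proof (cases "a $ y = 0")
      case True
      then show ?thesis using e by (simp add: s_def algebra_simps)
    next
      case False
      with ac have "b $ y \<noteq> 0" by auto
      with False have "0 < a $ y" "0 < b $ y"
        using prob_vectorsD(1)[OF b, of y] prob_vectorsD(1)[OF a, of y] by auto
      then show ?thesis using e by (simp add: s_def field_simps)
    qed
    then have "(\<Sum>y\<in>UNIV. a $ y * ln (a $ y / b $ y) - a $ y + b $ y - b $ y * e) \<le> aff s a b"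
      unfolding aff_def by (intro sum_mono)
    moreover have "(\<Sum>y\<in>UNIV. a $ y * ln (a $ y / b $ y) - a $ y + b $ y - b $ y * e) =
        (\<Sum>y\<in>UNIV. a $ y * ln (a $ y / b $ y)) - e"
      using prob_vectorsD(3)[OF a] prob_vectorsD(3)[OF b]
      by (simp add: sum.distrib sum_subtractf flip: sum_distrib_right)
    ultimately show ?thesis using le[of s] by simp
  qed
  then have "(\<Sum>y\<in>UNIV. a $ y * ln (a $ y / b $ y)) \<le> c" by (rule field_le_epsilon)
  then show ?thesis using ac by (simp add: rel_entropy_eq_sum[OF a b])
qed

lemma rel_entropy_nonneg:
  assumes "a \<in> prob_vectors" and "b \<in> prob_vectors"
  shows "0 \<le> rel_entropy a b"
  using aff_le_rel_entropy[OF assms, of 0] by (simp add: aff_def zero_ereal_def)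

lemma aff_le_rent:
  assumes "a \<in> prob_vectors" and "b \<in> prob_vectors"
  shows "ennreal (aff s a b) \<le> rent a b"
  unfolding rent_def using e2ennreal_mono[OF aff_le_rel_entropy[OF assms, of s]] by simp

lemma rent_leI:
  assumes a: "a \<in> prob_vectors" and b: "b \<in> prob_vectors" and le: "\<And>s. ennreal (aff s a b) \<le> c"
  shows "rent a b \<le> c"
proof (cases c)
  case (real r)
  then have "aff s a b \<le> r" for s using le[of s] by (auto simp: ennreal_le_iff)
  from rel_entropy_leI[OF a b this] have "rel_entropy a b \<le> ereal r" by blast
  from e2ennreal_mono[OF this] show ?thesis by (simp add: rent_def real)
qed simp

lemma aff_add: "aff s (u *\<^sub>R a + v *\<^sub>R a') (u *\<^sub>R b + v *\<^sub>R b') = u * aff s a b + v * aff s a' b'"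
  unfolding aff_def by (simp add: sum_distrib_left flip: sum.distrib)
    (simp add: algebra_simps)

lemma prob_vectors_convex: "convex prob_vectors"
  unfolding convex_def prob_vectors_def
  by (auto simp: sum.distrib simp flip: sum_distrib_left)

text \<open>Each \<open>aff s\<close> is linear in the pair of measures, and a supremum of linear
  functions is convex.\<close>

lemma rent_convex:
  assumes "a \<in> prob_vectors" "b \<in> prob_vectors" "a' \<in> prob_vectors" "b' \<in> prob_vectors"
    and uv: "0 \<le> u" "0 \<le> v" "u + v = 1"
  shows "rent (u *\<^sub>R a + v *\<^sub>R a') (u *\<^sub>R b + v *\<^sub>R b') \<le> ennreal u * rent a b + ennreal v * rent a' b'"
proof (rule rent_leI)
  show "u *\<^sub>R a + v *\<^sub>R a' \<in> prob_vectors" "u *\<^sub>R b + v *\<^sub>R b' \<in> prob_vectors"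
    using assms prob_vectors_convex by (auto simp: convex_def)
  fix s
  have "ennreal (aff s (u *\<^sub>R a + v *\<^sub>R a') (u *\<^sub>R b + v *\<^sub>R b')) =
      ennreal (u * aff s a b + v * aff s a' b')" by (simp add: aff_add)
  \<comment> \<open>\<open>ennreal\<close> sends negative numbers to 0, so positive parts have to be
    taken before the sum can be split.\<close>
  also have "\<dots> \<le> ennreal (u * max 0 (aff s a b) + v * max 0 (aff s a' b'))"
    using uv by (intro ennreal_leI add_mono mult_left_mono) auto
  also have "\<dots> = ennreal u * ennreal (aff s a b) + ennreal v * ennreal (aff s a' b')"
    using uv by (simp add: ennreal_plus ennreal_mult ennreal_max_0)
  also have "\<dots> \<le> ennreal u * rent a b + ennreal v * rent a' b'"
    using assms by (intro add_mono mult_left_mono aff_le_rent) auto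
  finally show "ennreal (aff s (u *\<^sub>R a + v *\<^sub>R a') (u *\<^sub>R b + v *\<^sub>R b'))
      \<le> ennreal u * rent a b + ennreal v * rent a' b'" .
qed

lemma closed_prob_vectors: "closed (prob_vectors :: (real ^ 'a::finite) set)"
proof -
  have eq: "prob_vectors = (\<Inter>x. {p. 0 \<le> p $ x}) \<inter> {p :: real ^ 'a. (\<Sum>x\<in>UNIV. p $ x) = 1}"
    by (auto simp: prob_vectors_def)
  show ?thesis unfolding eq
    by (intro closed_Int closed_INT ballI closed_Collect_le closed_Collect_eq continuous_intros)
qed

lemma compact_prob_vectors: "compact (prob_vectors :: (real ^ 'a::finite) set)"
proof -
  have "norm p \<le> real CARD('a)" if "p \<in> prob_vectors" for p :: "real ^ 'a"
  proof -
    have "norm p \<le> (\<Sum>x\<in>UNIV. \<bar>p $ x\<bar>)" by (rule norm_le_l1_cart)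
    also have "\<dots> \<le> (\<Sum>x\<in>(UNIV::'a set). 1)"
      using prob_vectorsD[OF that] by (intro sum_mono) auto
    finally show ?thesis by simp
  qed
  then have "bounded (prob_vectors :: (real ^ 'a) set)" unfolding bounded_iff by blast
  then show ?thesis using closed_prob_vectors compact_eq_bounded_closed by blast
qed

text \<open>A supremum of functions that are continuous in the pair.\<close>

lemma rent_lsc:
  assumes a: "\<And>k. a k \<in> prob_vectors" and b: "\<And>k. b k \<in> prob_vectors"
    and lim: "a \<longlonglongrightarrow> a'" "b \<longlonglongrightarrow> b'"
  shows "rent a' b' \<le> liminf (\<lambda>k. rent (a k) (b k))"
proof (rule rent_leI)
  show "a' \<in> prob_vectors" "b' \<in> prob_vectors"
    using closed_prob_vectors a b lim closed_sequentially by blast+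
  fix s
  have "(\<lambda>k. aff s (a k) (b k)) \<longlonglongrightarrow> aff s a' b'"
    unfolding aff_def by (intro tendsto_intros lim)
  then have "(\<lambda>k. ennreal (aff s (a k) (b k))) \<longlonglongrightarrow> ennreal (aff s a' b')"
    by (rule tendsto_ennrealI)
  then have "ennreal (aff s a' b') = liminf (\<lambda>k. ennreal (aff s (a k) (b k)))"
    by (simp add: lim_imp_Liminf)
  also have "\<dots> \<le> liminf (\<lambda>k. rent (a k) (b k))"
    by (intro Liminf_mono always_eventually allI aff_le_rent a b)
  finally show "ennreal (aff s a' b') \<le> liminf (\<lambda>k. rent (a k) (b k))" .
qed

lemma rent_eq_sum:
  assumes "a \<in> prob_vectors" "b \<in> prob_vectors" "\<And>y. 0 < b $ y"
  shows "rent a b = ennreal (\<Sum>y\<in>UNIV. a $ y * ln (a $ y / b $ y))"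
    and "0 \<le> (\<Sum>y\<in>UNIV. a $ y * ln (a $ y / b $ y))"
proof -
  have *: "rel_entropy a b = ereal (\<Sum>y\<in>UNIV. a $ y * ln (a $ y / b $ y))"
    using assms by (simp add: rel_entropy_eq_sum less_imp_neq[symmetric])
  show "rent a b = ennreal (\<Sum>y\<in>UNIV. a $ y * ln (a $ y / b $ y))"
    by (simp add: rent_def *)
  show "0 \<le> (\<Sum>y\<in>UNIV. a $ y * ln (a $ y / b $ y))"
    using rel_entropy_nonneg[OF assms(1,2)] unfolding * by simp
qed

lemma rent_le_ln:
  assumes a: "a \<in> prob_vectors" and b: "b \<in> prob_vectors" and k: "0 < k" "\<And>y. k \<le> b $ y"
  shows "rent a b \<le> ennreal (ln (1 / k))" "0 \<le> ln (1 / k)"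
proof -
  have pos: "0 < b $ y" for y using k(1) k(2)[of y] by linarith
  have "a $ y * ln (a $ y / b $ y) \<le> a $ y * ln (1 / k)" for y
  proof (cases "a $ y = 0")
    case False
    then have "0 < a $ y" using prob_vectorsD(1)[OF a, of y] by simp
    then show ?thesis using pos[of y] k(1) k(2)[of y] prob_vectorsD(2)[OF a, of y]
      by (intro mult_left_mono iffD2[OF ln_le_cancel_iff] frac_le) auto
  qed simp
  then have "(\<Sum>y\<in>UNIV. a $ y * ln (a $ y / b $ y)) \<le> (\<Sum>y\<in>UNIV. a $ y * ln (1 / k))"
    by (intro sum_mono)
  also have "\<dots> = ln (1 / k)" using prob_vectorsD(3)[OF a] by (simp flip: sum_distrib_right)
  finally have *: "(\<Sum>y\<in>UNIV. a $ y * ln (a $ y / b $ y)) \<le> ln (1 / k)" .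
  show "rent a b \<le> ennreal (ln (1 / k))"
    unfolding rent_eq_sum(1)[OF a b pos] by (intro ennreal_leI *)
  show "0 \<le> ln (1 / k)" using * rent_eq_sum(2)[OF a b pos] by linarith
qed

lemma measurable_vec_nth[measurable (raw)]:
  fixes f :: "_ \<Rightarrow> real ^ 'a::finite"
  assumes "f \<in> borel_measurable M"
  shows "(\<lambda>s. f s $ y) \<in> borel_measurable M"
  using assms borel_measurable_nth by (rule measurable_compose)

text \<open>Here the explicit formula is used: a supremum over uncountably many \<open>s\<close>
  would not give measurability directly.\<close>

lemma rent_measurable[measurable]:
  assumes [measurable]: "f \<in> borel_measurable M" "g \<in> borel_measurable M"
    and "\<And>s. f s \<in> prob_vectors" "\<And>s. g s \<in> prob_vectors"
  shows "(\<lambda>s. rent (f s) (g s)) \<in> borel_measurable M"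
proof -
  have "(\<lambda>s. rent (f s) (g s)) = (\<lambda>s. if \<forall>y. g s $ y = 0 \<longrightarrow> f s $ y = 0
      then ennreal (\<Sum>y\<in>UNIV. f s $ y * ln (f s $ y / g s $ y)) else top)"
    by (auto simp: rent_def rel_entropy_eq_sum assms fun_eq_iff)
  then show ?thesis by simp
qed

subsection \<open>The exponential law\<close>

text \<open>The discount as a probability measure, the exponential law of mean 1. Occupations and
  costs become expectations, and bounded measurable functions are integrable.\<close>

definition expd :: "real measure" where
  "expd = density lborel (\<lambda>s. ennreal (exp (- s)) * indicator {0..} s)"

lemma sets_expd[simp, measurable_cong]: "sets expd = sets borel"
  by (simp add: expd_def)

lemma space_expd[simp]: "space expd = UNIV"
  by (simp add: expd_def)

lemma expd_eq: "expd = density lborel (exponential_density 1)"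
  unfolding expd_def
  by (rule arg_cong[where f="density lborel"]) (auto simp: exponential_density_def fun_eq_iff indicator_def)

interpretation expd: prob_space expd
  unfolding expd_eq by (rule prob_space_exponential_density) simp

lemma AE_expd: "AE s in lborel. 0 \<le> s \<longrightarrow> P s \<Longrightarrow> AE s in expd. P s"
  unfolding expd_def by (subst AE_density) (auto simp: indicator_def elim!: eventually_mono)

lemma AE_expd_nonneg: "AE s in expd. 0 \<le> s"
  by (rule AE_expd) simp

lemma nn_integral_expd:
  assumes "f \<in> borel_measurable borel"
  shows "(\<integral>\<^sup>+s. f s \<partial>expd) = (\<integral>\<^sup>+s\<in>{0..}. ennreal (exp (- s)) * f s \<partial>lborel)"
  unfolding expd_def using assms by (simp add: nn_integral_density ac_simps)

text \<open>Memorylessness of the exponential law, which is behind every splitting of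
  \<open>occ\<close> and \<open>cost\<close> at a time \<open>h\<close>.\<close>

lemma nn_integral_expd_shift:
  assumes [measurable]: "f \<in> borel_measurable borel" and h: "0 \<le> h"
  shows "(\<integral>\<^sup>+s. f s * indicator {h..} s \<partial>expd) = ennreal (exp (- h)) * (\<integral>\<^sup>+s. f (s + h) \<partial>expd)"
proof -
  have "(\<integral>\<^sup>+s. f s * indicator {h..} s \<partial>expd) =
      (\<integral>\<^sup>+s\<in>{0..}. ennreal (exp (- s)) * (f s * indicator {h..} s) \<partial>lborel)"
    by (rule nn_integral_expd) measurable
  also have "\<dots> = (\<integral>\<^sup>+s. ennreal (exp (- (h + 1 * s))) * f (h + 1 * s) * indicator {h..} (h + 1 * s) *
      indicator {0..} (h + 1 * s) \<partial>lborel)"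
    by (subst nn_integral_real_affine[where c=1 and t=h]) (auto simp: ac_simps)
  also have "\<dots> = (\<integral>\<^sup>+s\<in>{0..}. ennreal (exp (- s)) * (ennreal (exp (- h)) * f (s + h)) \<partial>lborel)"
  proof (rule nn_integral_cong)
    fix s
    have "ennreal (exp (- (h + s))) = ennreal (exp (- s)) * ennreal (exp (- h))"
      by (simp add: mult_exp_exp flip: ennreal_mult)
    then show "ennreal (exp (- (h + 1 * s))) * f (h + 1 * s) * indicator {h..} (h + 1 * s) *
        indicator {0..} (h + 1 * s) = ennreal (exp (- s)) * (ennreal (exp (- h)) * f (s + h)) * indicator {0..} s"
      using h by (auto simp: indicator_def add.commute mult.assoc)
  qed
  also have "\<dots> = (\<integral>\<^sup>+s. ennreal (exp (- h)) * f (s + h) \<partial>expd)"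
    by (subst nn_integral_expd) auto
  also have "\<dots> = ennreal (exp (- h)) * (\<integral>\<^sup>+s. f (s + h) \<partial>expd)"
    by (intro nn_integral_cmult) auto
  finally show ?thesis .
qed

lemma expd_bounded_integrable:
  fixes f :: "real \<Rightarrow> 'b::{banach, second_countable_topology}"
  assumes "f \<in> borel_measurable borel" "\<And>s. norm (f s) \<le> B"
  shows "integrable expd f"
  using assms by (intro expd.integrable_const_bound[where B=B]) (auto simp: measurable_def)

lemma integral_expd_shift:
  fixes f :: "real \<Rightarrow> real"
  assumes [measurable]: "f \<in> borel_measurable borel" and h: "0 \<le> h" and nn: "\<And>s. 0 \<le> f s" "\<And>s. f s \<le> B"
  shows "(\<integral>s. f s * indicator {h..} s \<partial>expd) = exp (- h) * (\<integral>s. f (s + h) \<partial>expd)"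
proof -
  have "(\<integral>s. f s * indicator {h..} s \<partial>expd) = enn2real (\<integral>\<^sup>+s. ennreal (f s) * indicator {h..} s \<partial>expd)"
    using nn by (subst integral_eq_nn_integral) (auto simp: ennreal_mult ennreal_indicator intro!: arg_cong[where f=enn2real] nn_integral_cong)
  also have "\<dots> = enn2real (ennreal (exp (- h)) * (\<integral>\<^sup>+s. ennreal (f (s + h)) \<partial>expd))"
    by (subst nn_integral_expd_shift[OF _ h]) auto
  also have "\<dots> = exp (- h) * (\<integral>s. f (s + h) \<partial>expd)"
    using nn by (simp add: enn2real_mult integral_eq_nn_integral)
  finally show ?thesis .
qed

lemma measure_expd_atLeast: "0 \<le> h \<Longrightarrow> measure expd {h..} = exp (- h)"
  using integral_expd_shift[of "\<lambda>_. 1" h 1] expd.prob_space by simp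

subsection \<open>Controls, occupation paths and their cost\<close>

text \<open>Only the marginal \<sigma> of a control is kept. Values in the simplex are demanded at
  all real times, negative ones included, so that pointwise facts carry no side condition.\<close>

definition ctrl :: "(real \<Rightarrow> real ^ 'd::finite) set" where
  "ctrl = {\<sigma>. \<sigma> \<in> borel_measurable borel \<and> (\<forall>s. \<sigma> s \<in> prob_vectors)}"

text \<open>\<open>occ \<sigma> t\<close> is the integral of \<open>exp (- r) \<sigma> (t + r)\<close> over \<open>r \<ge> 0\<close>, the only bounded solution of
  \<open>M' = M - \<sigma>\<close>. In this form \<open>M\<close> is linear in the control.\<close>

definition occ :: "(real \<Rightarrow> real ^ 'd::finite) \<Rightarrow> real \<Rightarrow> real ^ 'd" where
  "occ \<sigma> t = (\<chi> x. \<integral>s. \<sigma> (t + s) $ x \<partial>expd)"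

definition cost :: "real ^ 'd ^ 'd \<Rightarrow> (real \<Rightarrow> real ^ 'd::finite) \<Rightarrow> ennreal" where
  "cost K \<sigma> = (\<integral>\<^sup>+s. rent (\<sigma> s) (occ \<sigma> s v* K) \<partial>expd)"

text \<open>Stated with real bounds, so that convexity and closedness concern a set of pairs
  \<open>(m, c)\<close> with finite \<open>c\<close>. As \<open>ennreal\<close> maps negative
  numbers to 0, the condition \<open>0 \<le> c\<close> is explicit.\<close>

definition achievable :: "real ^ 'd ^ 'd \<Rightarrow> real ^ 'd::finite \<Rightarrow> real \<Rightarrow> bool" where
  "achievable K m c \<longleftrightarrow> 0 \<le> c \<and> (\<exists>\<sigma>\<in>ctrl. occ \<sigma> 0 = m \<and> cost K \<sigma> \<le> ennreal c)"

lemma ctrlD: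
  assumes "\<sigma> \<in> ctrl"
  shows ctrl_measurable: "\<sigma> \<in> borel_measurable borel" and ctrl_prob: "\<sigma> s \<in> prob_vectors"
    and ctrl_nonneg: "0 \<le> \<sigma> s $ x" and ctrl_le1: "\<sigma> s $ x \<le> 1"
    and ctrl_sum: "(\<Sum>x\<in>UNIV. \<sigma> s $ x) = 1"
  using assms prob_vectorsD[of "\<sigma> s"] by (auto simp: ctrl_def)

lemma ctrl_integrable:
  assumes s: "\<sigma> \<in> ctrl" and [measurable]: "f \<in> borel_measurable borel" "A \<in> sets borel"
  shows "integrable expd (\<lambda>s. \<sigma> (f s) $ x * indicator A s)" "integrable expd (\<lambda>s. \<sigma> (f s) $ x)"
proof -
  note [measurable] = ctrl_measurable[OF s]
  show "integrable expd (\<lambda>s. \<sigma> (f s) $ x * indicator A s)"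
    by (rule expd_bounded_integrable[where B=1])
      (auto simp: indicator_def ctrl_nonneg[OF s] ctrl_le1[OF s])
  show "integrable expd (\<lambda>s. \<sigma> (f s) $ x)"
    by (rule expd_bounded_integrable[where B=1]) (auto simp: ctrl_nonneg[OF s] ctrl_le1[OF s])
qed

lemma ctrl_integrable_add: "\<sigma> \<in> ctrl \<Longrightarrow> integrable expd (\<lambda>s. \<sigma> (t + s) $ x)"
  by (rule ctrl_integrable(2)[where A=UNIV]) auto

lemma occ_prob:
  assumes s: "\<sigma> \<in> ctrl"
  shows "occ \<sigma> t \<in> prob_vectors"
proof -
  have "(\<Sum>x\<in>UNIV. occ \<sigma> t $ x) = (\<integral>s. (\<Sum>x\<in>UNIV. \<sigma> (t + s) $ x) \<partial>expd)"
    unfolding occ_def by (simp add: ctrl_integrable_add[OF s])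
  also have "\<dots> = 1" using expd.prob_space by (simp add: ctrl_sum[OF s])
  finally show ?thesis by (auto simp: prob_vectors_def occ_def ctrl_nonneg[OF s])
qed

text \<open>Variation of constants for \<open>M' = M - \<sigma>\<close>, read off from
  memorylessness.\<close>

lemma occ_split:
  assumes s: "\<sigma> \<in> ctrl" and h: "0 \<le> h"
  shows "occ \<sigma> t $ x = (\<integral>s. \<sigma> (t + s) $ x * indicator {..<h} s \<partial>expd) + exp (- h) * occ \<sigma> (t + h) $ x"
proof -
  note [measurable] = ctrl_measurable[OF s]
  have "occ \<sigma> t $ x = (\<integral>s. \<sigma> (t + s) $ x * indicator {..<h} s + \<sigma> (t + s) $ x * indicator {h..} s \<partial>expd)"
    unfolding occ_def vec_lambda_beta by (intro Bochner_Integration.integral_cong) (auto simp: indicator_def)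
  also have "\<dots> = (\<integral>s. \<sigma> (t + s) $ x * indicator {..<h} s \<partial>expd) + (\<integral>s. \<sigma> (t + s) $ x * indicator {h..} s \<partial>expd)"
    by (intro Bochner_Integration.integral_add ctrl_integrable s) auto
  also have "(\<integral>s. \<sigma> (t + s) $ x * indicator {h..} s \<partial>expd) = exp (- h) * occ \<sigma> (t + h) $ x"
    by (subst integral_expd_shift[where B=1])
      (auto simp: h occ_def ctrl_nonneg[OF s] ctrl_le1[OF s] ac_simps)
  finally show ?thesis .
qed

lemma exp_minus_ge: "1 - exp (- h) \<le> (h::real)"
  using exp_ge_add_one_self[of "- h"] by simp

text \<open>Between \<open>t\<close> and \<open>t + h\<close> a mass \<open>1 - exp (- h)\<close> is
  gained and the same mass is lost; hence the constant 2, which is also the one in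
  \<open>pair_path\<close>.\<close>

lemma occ_Lipschitz:
  assumes s: "\<sigma> \<in> ctrl"
  shows "l1_norm (occ \<sigma> t - occ \<sigma> u) \<le> 2 * \<bar>t - u\<bar>"
proof -
  have *: "l1_norm (occ \<sigma> t - occ \<sigma> (t + h)) \<le> 2 * h" if h: "0 \<le> h" for t h
  proof -
    define a where "a x = (\<integral>s. \<sigma> (t + s) $ x * indicator {..<h} s \<partial>expd)" for x
    note split = occ_split[OF s h, of t, folded a_def]
    have an: "0 \<le> a x" for x unfolding a_def by (simp add: ctrl_nonneg[OF s])
    have p: "occ \<sigma> t \<in> prob_vectors" "occ \<sigma> (t + h) \<in> prob_vectors" by (rule occ_prob[OF s])+
    have "(\<Sum>x\<in>UNIV. occ \<sigma> t $ x) = (\<Sum>x\<in>UNIV. a x) + exp (- h) * (\<Sum>x\<in>UNIV. occ \<sigma> (t + h) $ x)"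
      by (subst split) (simp add: sum.distrib sum_distrib_left)
    then have sa: "(\<Sum>x\<in>UNIV. a x) = 1 - exp (- h)" using p by (simp add: prob_vectorsD)
    have "\<bar>occ \<sigma> t $ x - occ \<sigma> (t + h) $ x\<bar> \<le> a x + (1 - exp (- h)) * occ \<sigma> (t + h) $ x" for x
    proof -
      have "occ \<sigma> t $ x - occ \<sigma> (t + h) $ x = a x - (1 - exp (- h)) * occ \<sigma> (t + h) $ x"
        by (subst split) (simp add: algebra_simps)
      moreover have "0 \<le> (1 - exp (- h)) * occ \<sigma> (t + h) $ x"
        using h prob_vectorsD(1)[OF p(2)] by (intro mult_nonneg_nonneg) auto
      ultimately show ?thesis using an[of x] by linarith
    qed
    then have "l1_norm (occ \<sigma> t - occ \<sigma> (t + h)) \<le> (\<Sum>x\<in>UNIV. a x + (1 - exp (- h)) * occ \<sigma> (t + h) $ x)"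
      unfolding l1_norm_def by (intro sum_mono) simp
    also have "\<dots> = 2 * (1 - exp (- h))"
      using p by (simp add: sum.distrib sa prob_vectorsD flip: sum_distrib_left)
    also have "\<dots> \<le> 2 * h" using exp_minus_ge[of h] by simp
    finally show ?thesis .
  qed
  show ?thesis
  proof (cases "t \<le> u")
    case True
    then show ?thesis using *[of "u - t" t] by simp
  next
    case False
    then show ?thesis using *[of "t - u" u] by (simp add: l1_norm_def abs_minus_commute)
  qed
qed

lemma occ_continuous:
  assumes s: "\<sigma> \<in> ctrl"
  shows "continuous_on A (occ \<sigma>)"
proof -
  have "dist (occ \<sigma> u) (occ \<sigma> t) \<le> 2 * dist u t" for t u
  proof -
    have "dist (occ \<sigma> u) (occ \<sigma> t) \<le> l1_norm (occ \<sigma> u - occ \<sigma> t)"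
      unfolding dist_norm l1_norm_def by (rule norm_le_l1_cart)
    also have "\<dots> \<le> 2 * dist u t" using occ_Lipschitz[OF s] by (simp add: dist_real_def)
    finally show ?thesis .
  qed
  then have "(2::real)-lipschitz_on A (occ \<sigma>)" by (intro lipschitz_onI) auto
  then show ?thesis by (rule lipschitz_on_continuous_on)
qed

lemma occ_measurable:
  assumes "\<sigma> \<in> ctrl"
  shows "occ \<sigma> \<in> borel_measurable borel"
  using occ_continuous[OF assms] by (rule borel_measurable_continuous_onI)

lemma vec_kernel_nth: "(m v* K) $ y = (\<Sum>z\<in>UNIV. m $ z * K $ z $ y)"
  by (simp add: vector_matrix_mult_def)

lemma kernelD:
  assumes "K \<in> transition_kernels"
  shows "0 \<le> K $ x $ y" "K $ x $ y \<le> 1" "(\<Sum>y\<in>UNIV. K $ x $ y) = 1"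
  using assms prob_vectorsD[of "K $ x"] by (auto simp: transition_kernels_def)

lemma vec_kernel_prob:
  assumes m: "m \<in> prob_vectors" and K: "K \<in> transition_kernels"
  shows "m v* K \<in> prob_vectors"
proof -
  have "(\<Sum>y\<in>UNIV. (m v* K) $ y) = (\<Sum>z\<in>UNIV. m $ z * (\<Sum>y\<in>UNIV. K $ z $ y))"
    unfolding vec_kernel_nth sum_distrib_left by (rule sum.swap)
  also have "\<dots> = 1" using kernelD(3)[OF K] prob_vectorsD(3)[OF m] by simp
  finally show ?thesis using prob_vectorsD(1)[OF m] kernelD(1)[OF K]
    by (auto simp: prob_vectors_def vec_kernel_nth intro!: sum_nonneg)
qed

lemma vec_kernel_linear: "(u *\<^sub>R a + v *\<^sub>R b) v* K = u *\<^sub>R (a v* K) + v *\<^sub>R (b v* (K :: real ^ 'd::finite ^ 'd))"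
  by (simp add: vec_eq_iff vec_kernel_nth sum_distrib_left algebra_simps sum.distrib)

lemma vec_kernel_measurable[measurable]:
  fixes f :: "_ \<Rightarrow> real ^ 'd::finite"
  assumes [measurable]: "f \<in> borel_measurable M"
  shows "(\<lambda>s. f s v* K) \<in> borel_measurable M"
proof -
  have "continuous_on UNIV (\<lambda>v :: real ^ 'd. v v* K)"
    unfolding vector_matrix_mult_def by (intro continuous_intros)
  from borel_measurable_continuous_onI[OF this] assms show ?thesis by (rule measurable_compose_rev)
qed

lemma cost_integrand_measurable[measurable]:
  assumes "\<sigma> \<in> ctrl" "K \<in> transition_kernels"
  shows "(\<lambda>s. rent (\<sigma> s) (occ \<sigma> s v* K)) \<in> borel_measurable borel"
  using assms by (intro rent_measurable vec_kernel_measurable occ_measurable ctrl_measurable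
      vec_kernel_prob occ_prob) (auto intro: ctrl_prob)

lemma occ_convex:
  assumes s: "\<sigma> \<in> ctrl" and t: "\<tau> \<in> ctrl"
  shows "occ (\<lambda>s. u *\<^sub>R \<sigma> s + v *\<^sub>R \<tau> s) r = u *\<^sub>R occ \<sigma> r + v *\<^sub>R occ \<tau> r"
  unfolding occ_def vec_eq_iff
  by (simp add: ctrl_integrable_add[OF s] ctrl_integrable_add[OF t])

lemma ctrl_convex:
  assumes "\<sigma> \<in> ctrl" and "\<tau> \<in> ctrl" and "0 \<le> u" "0 \<le> v" "u + v = 1"
  shows "(\<lambda>s. u *\<^sub>R \<sigma> s + v *\<^sub>R \<tau> s) \<in> ctrl"
  using assms prob_vectors_convex by (auto simp: ctrl_def convex_def)

lemma cost_convex: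
  assumes K: "K \<in> transition_kernels" and s: "\<sigma> \<in> ctrl" and t: "\<tau> \<in> ctrl"
    and uv: "0 \<le> u" "0 \<le> v" "u + v = 1"
  shows "cost K (\<lambda>s. u *\<^sub>R \<sigma> s + v *\<^sub>R \<tau> s) \<le> ennreal u * cost K \<sigma> + ennreal v * cost K \<tau>"
proof -
  note [measurable] = cost_integrand_measurable[OF s K] cost_integrand_measurable[OF t K]
  have "cost K (\<lambda>s. u *\<^sub>R \<sigma> s + v *\<^sub>R \<tau> s) \<le>
      (\<integral>\<^sup>+r. ennreal u * rent (\<sigma> r) (occ \<sigma> r v* K) + ennreal v * rent (\<tau> r) (occ \<tau> r v* K) \<partial>expd)"
    unfolding cost_def occ_convex[OF s t] vec_kernel_linear
    by (intro nn_integral_mono rent_convex uv vec_kernel_prob occ_prob K s t ctrl_prob)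
  also have "\<dots> = ennreal u * cost K \<sigma> + ennreal v * cost K \<tau>"
    unfolding cost_def by (simp add: nn_integral_add nn_integral_cmult)
  finally show ?thesis .
qed

lemma achievable_convex:
  fixes K :: "real ^ 'd::finite ^ 'd"
  assumes K: "K \<in> transition_kernels"
  shows "convex {(m, c). achievable K m c}"
proof (rule convexI)
  fix p q :: "(real ^ 'd) \<times> real" and u v :: real
  assume uv: "0 \<le> u" "0 \<le> v" "u + v = 1" and "p \<in> {(m, c). achievable K m c}" "q \<in> {(m, c). achievable K m c}"
  then obtain m c m' c' where pq: "p = (m, c)" "q = (m', c')" and "achievable K m c" "achievable K m' c'" by auto
  then obtain \<sigma> \<tau> where s: "\<sigma> \<in> ctrl" "occ \<sigma> 0 = m" "cost K \<sigma> \<le> ennreal c"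
    and t: "\<tau> \<in> ctrl" "occ \<tau> 0 = m'" "cost K \<tau> \<le> ennreal c'" and c: "0 \<le> c" "0 \<le> c'"
    by (auto simp: achievable_def)
  have "cost K (\<lambda>s. u *\<^sub>R \<sigma> s + v *\<^sub>R \<tau> s) \<le> ennreal u * cost K \<sigma> + ennreal v * cost K \<tau>"
    using K s t uv by (intro cost_convex)
  also have "\<dots> \<le> ennreal u * ennreal c + ennreal v * ennreal c'"
    by (intro add_mono mult_left_mono s t) auto
  also have "\<dots> = ennreal (u * c + v * c')" using uv c by (simp add: ennreal_mult)
  finally have "achievable K (u *\<^sub>R m + v *\<^sub>R m') (u * c + v * c')"
    using ctrl_convex[OF s(1) t(1) uv] occ_convex[OF s(1) t(1)] s t c uv unfolding achievable_def by auto
  then show "u *\<^sub>R p + v *\<^sub>R q \<in> {(m, c). achievable K m c}" by (simp add: pq)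
qed

lemma measure_expd_lessThan:
  assumes "0 \<le> h" shows "measure expd {..<h} = 1 - exp (- h)"
proof -
  have "{..<h} = space expd - {h..}" by auto
  then have "measure expd {..<h} = 1 - measure expd {h..}" by (simp only: expd.prob_compl sets_expd atLeast_borel)
  then show ?thesis using assms by (simp add: measure_expd_atLeast)
qed

lemma achievable_const:
  assumes m: "m \<in> prob_vectors" and "0 \<le> c" and le: "rent m (m v* K) \<le> ennreal c"
  shows "achievable K m c"
proof -
  have "occ (\<lambda>_. m) s = m" for s using expd.prob_space by (simp add: occ_def vec_eq_iff)
  then have "cost K (\<lambda>_. m) \<le> ennreal c"
    using expd.emeasure_space_1 le by (simp add: cost_def)
  then show ?thesis using assms \<open>\<And>s. occ (\<lambda>_. m) s = m\<close> unfolding achievable_def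
    by (intro conjI bexI[of _ "\<lambda>_. m"]) (auto simp: ctrl_def)
qed

text \<open>The law \<eta> is played for a time \<open>h\<close>, then the old control; in the chain
  this is one more stretch of samples at the end. At time \<open>t\<close> of this stretch the
  occupation is a mixture of \<eta> and \<open>m\<close> with weight \<theta> =
  \<open>exp (- (h - t))\<close> on \<open>m\<close>, which is why the entropy is bounded for all
  such \<theta>.\<close>

lemma achievable_append:
  assumes K: "K \<in> transition_kernels" and a: "achievable K m c" and e: "\<eta> \<in> prob_vectors"
    and h: "0 \<le> h" and B: "0 \<le> B"
    and le: "\<And>\<theta>. exp (- h) \<le> \<theta> \<Longrightarrow> \<theta> \<le> 1 \<Longrightarrow> rent \<eta> (((1 - \<theta>) *\<^sub>R \<eta> + \<theta> *\<^sub>R m) v* K) \<le> ennreal B"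
  shows "achievable K ((1 - exp (- h)) *\<^sub>R \<eta> + exp (- h) *\<^sub>R m) (exp (- h) * c + (1 - exp (- h)) * B)"
proof -
  from a obtain \<sigma> where s: "\<sigma> \<in> ctrl" "occ \<sigma> 0 = m" "cost K \<sigma> \<le> ennreal c" and c: "0 \<le> c"
    by (auto simp: achievable_def)
  note [measurable] = ctrl_measurable[OF s(1)]
  define \<tau> where "\<tau> s = (if s < h then \<eta> else \<sigma> (s - h))" for s
  have [measurable]: "\<tau> \<in> borel_measurable borel" unfolding \<tau>_def by measurable
  have t: "\<tau> \<in> ctrl" using e ctrl_prob[OF s(1)] by (auto simp: ctrl_def \<tau>_def)
  note [measurable] = cost_integrand_measurable[OF t K]
  have late: "occ \<tau> t = occ \<sigma> (t - h)" if "h \<le> t" for t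
  proof -
    have "(\<integral>s. \<tau> (t + s) $ x \<partial>expd) = (\<integral>s. \<sigma> (t - h + s) $ x \<partial>expd)" for x
      using AE_expd_nonneg that
      by (intro integral_cong_AE) (auto simp: \<tau>_def algebra_simps elim!: eventually_mono)
    then show ?thesis by (simp add: occ_def)
  qed
  have early: "occ \<tau> t = (1 - exp (- (h - t))) *\<^sub>R \<eta> + exp (- (h - t)) *\<^sub>R m" if "0 \<le> t" "t \<le> h" for t
  proof -
    have "(\<integral>s. \<tau> (t + s) $ x * indicator {..<h - t} s \<partial>expd) = (\<integral>s. \<eta> $ x * indicator {..<h - t} s \<partial>expd)" for x
      by (intro Bochner_Integration.integral_cong) (auto simp: \<tau>_def indicator_def)
    also have "\<dots> x = \<eta> $ x * (1 - exp (- (h - t)))" for x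
      using that by (simp add: measure_expd_lessThan)
    finally show ?thesis using that late[of h] s
      by (simp add: vec_eq_iff occ_split[OF t, of "h - t" t] algebra_simps)
  qed
  have "cost K \<tau> = (\<integral>\<^sup>+s. rent (\<tau> s) (occ \<tau> s v* K) * indicator {..<h} s
      + rent (\<tau> s) (occ \<tau> s v* K) * indicator {h..} s \<partial>expd)"
    unfolding cost_def by (intro nn_integral_cong) (auto simp: indicator_def)
  also have "\<dots> = (\<integral>\<^sup>+s. rent (\<tau> s) (occ \<tau> s v* K) * indicator {..<h} s \<partial>expd)
      + (\<integral>\<^sup>+s. rent (\<tau> s) (occ \<tau> s v* K) * indicator {h..} s \<partial>expd)"
    by (intro nn_integral_add) auto
  also have "(\<integral>\<^sup>+s. rent (\<tau> s) (occ \<tau> s v* K) * indicator {h..} s \<partial>expd) =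
      ennreal (exp (- h)) * (\<integral>\<^sup>+s. rent (\<tau> (s + h)) (occ \<tau> (s + h) v* K) \<partial>expd)"
    by (intro nn_integral_expd_shift h) auto
  also have "(\<integral>\<^sup>+s. rent (\<tau> (s + h)) (occ \<tau> (s + h) v* K) \<partial>expd) = cost K \<sigma>"
    unfolding cost_def using AE_expd_nonneg
    by (intro nn_integral_cong_AE) (auto simp: late \<tau>_def elim!: eventually_mono)
  also have "(\<integral>\<^sup>+s. rent (\<tau> s) (occ \<tau> s v* K) * indicator {..<h} s \<partial>expd) \<le>
      (\<integral>\<^sup>+s. ennreal B * indicator {..<h} s \<partial>expd)"
  proof (intro nn_integral_mono_AE, use AE_expd_nonneg in eventually_elim)
    case (elim s)
    show ?case
    proof (cases "s < h")
      case True
      then show ?thesis using elim le[of "exp (- (h - s))"] by (simp add: early \<tau>_def)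
    qed simp
  qed
  also have "\<dots> = ennreal B * ennreal (1 - exp (- h))"
    using h by (simp add: nn_integral_cmult_indicator expd.emeasure_eq_measure measure_expd_lessThan)
  finally have "cost K \<tau> \<le> ennreal B * ennreal (1 - exp (- h)) + ennreal (exp (- h)) * cost K \<sigma>"
    by simp
  also have "\<dots> \<le> ennreal B * ennreal (1 - exp (- h)) + ennreal (exp (- h)) * ennreal c"
    by (intro add_mono mult_left_mono s) auto
  also have "\<dots> = ennreal (exp (- h) * c + (1 - exp (- h)) * B)"
    using h B c by (simp add: ennreal_mult add.commute mult.commute)
  finally show ?thesis using t early[of 0] h c B unfolding achievable_def by auto
qed

subsection \<open>Closedness of the set of achievable pairs\<close>

lemma ennreal_lincomb:
  "0 \<le> u \<Longrightarrow> 0 \<le> v \<Longrightarrow> 0 \<le> a \<Longrightarrow> 0 \<le> b \<Longrightarrow> ennreal u * ennreal a + ennreal v * ennreal b = ennreal (u * a + v * b)"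
  by (simp add: ennreal_mult)

text \<open>The occupation at \<open>t\<close> looks at the control from \<open>t\<close> on. The
  shifted exponential law has a density of at most \<open>exp t\<close> with respect to the original
  one, so null sets stay null.\<close>

lemma AE_expd_shift:
  assumes N: "N \<in> null_sets expd" and t: "0 \<le> t"
  shows "AE s in expd. t + s \<notin> N"
proof -
  have [measurable]: "N \<in> sets borel" using N by auto
  have "(\<integral>\<^sup>+s. indicator N s * indicator {t..} s \<partial>expd) \<le> (\<integral>\<^sup>+s. indicator N s \<partial>expd)"
    by (intro nn_integral_mono) (auto simp: indicator_def)
  also have "\<dots> = 0" using N by (simp add: null_setsD1)
  finally have "ennreal (exp (- t)) * (\<integral>\<^sup>+s. indicator N (s + t) \<partial>expd) = 0"
    by (subst nn_integral_expd_shift[symmetric, OF _ t]) auto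
  then have "(\<integral>\<^sup>+s. indicator N (s + t) \<partial>expd) = 0" by simp
  then have "AE s in expd. (indicator N (s + t) :: ennreal) = 0"
    by (subst (asm) nn_integral_0_iff_AE) auto
  then show ?thesis by (auto simp: add.commute elim!: eventually_mono)
qed

lemma occ_tendsto:
  assumes g: "\<And>i. g i \<in> ctrl" and g': "g' \<in> ctrl" and N: "N \<in> null_sets expd"
    and lim: "\<And>s. s \<notin> N \<Longrightarrow> (\<lambda>i. g i s) \<longlonglongrightarrow> g' s" and t: "0 \<le> t"
  shows "(\<lambda>i. occ (g i) t) \<longlonglongrightarrow> occ g' t"
proof (rule vec_tendstoI)
  fix x
  note [measurable] = ctrl_measurable[OF g] ctrl_measurable[OF g']
  have "(\<lambda>i. \<integral>s. g i (t + s) $ x \<partial>expd) \<longlonglongrightarrow> (\<integral>s. g' (t + s) $ x \<partial>expd)"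
  proof (rule integral_dominated_convergence[where w="\<lambda>_. 1"])
    show "AE s in expd. (\<lambda>i. g i (t + s) $ x) \<longlonglongrightarrow> g' (t + s) $ x"
      using AE_expd_shift[OF N t] by eventually_elim (intro tendsto_vec_nth lim)
  qed (auto simp: ctrl_nonneg[OF g] ctrl_le1[OF g])
  then show "(\<lambda>i. occ (g i) t $ x) \<longlonglongrightarrow> occ g' t $ x" by (simp add: occ_def)
qed

text \<open>Fatou's lemma together with \<open>rent_lsc\<close>; the occupations in the second
  argument converge by dominated convergence.\<close>

lemma cost_lsc:
  assumes K: "K \<in> transition_kernels" and g: "\<And>i. g i \<in> ctrl" and g': "g' \<in> ctrl" and N: "N \<in> null_sets expd"
    and lim: "\<And>s. s \<notin> N \<Longrightarrow> (\<lambda>i. g i s) \<longlonglongrightarrow> g' s"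
  shows "cost K g' \<le> liminf (\<lambda>i. cost K (g i))"
proof -
  note [measurable] = cost_integrand_measurable[OF g K]
  have cont: "continuous_on UNIV (\<lambda>v :: real ^ 'a. v v* K)"
    unfolding vector_matrix_mult_def by (intro continuous_intros)
  have "cost K g' \<le> (\<integral>\<^sup>+s. liminf (\<lambda>i. rent (g i s) (occ (g i) s v* K)) \<partial>expd)"
    unfolding cost_def
  proof (rule nn_integral_mono_AE, use AE_expd_nonneg AE_not_in[OF N] in eventually_elim)
    case (elim s)
    then show ?case
      by (intro rent_lsc ctrl_prob vec_kernel_prob occ_prob g K lim
          continuous_on_tendsto_compose[OF cont occ_tendsto[OF g g' N lim]]) auto
  qed
  also have "\<dots> \<le> liminf (\<lambda>i. cost K (g i))"
    unfolding cost_def by (intro nn_integral_liminf) simp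
  finally show ?thesis .
qed

lemma norm_prob_le1: "p \<in> prob_vectors \<Longrightarrow> norm p \<le> 1"
  using norm_le_l1_cart[of p] prob_vectorsD[of p] by simp

text \<open>As in the Riesz-Fischer theorem: squared norms of order \<open>(1/8)^i\<close> make the
  first moments of the increments summable like \<open>(1/2)^i\<close>, so the increments are
  summable almost everywhere.\<close>

lemma ctrl_fast_Cauchy_limit:
  assumes g: "\<And>i. g i \<in> ctrl"
    and fast: "\<And>i. (\<integral>s. (norm (g (Suc i) s - g i s))\<^sup>2 \<partial>expd) \<le> C * (1/8)^i"
  obtains g' N where "g' \<in> ctrl" "N \<in> null_sets expd" "\<And>s. s \<notin> N \<Longrightarrow> (\<lambda>i. g i s) \<longlonglongrightarrow> g' s"
proof -
  note [measurable] = ctrl_measurable[OF g]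
  have nb: "norm (g (Suc i) s - g i s) \<le> 2" for i s
    using norm_triangle_ineq4[of "g (Suc i) s" "g i s"] norm_prob_le1[OF ctrl_prob[OF g]]
    by (smt (verit))
  have I2: "integrable expd (\<lambda>s. (norm (g (Suc i) s - g i s))\<^sup>2)" for i
    by (rule expd_bounded_integrable[where B="2\<^sup>2"]) (use power_mono[OF nb norm_ge_zero, of i _ 2] in auto)
  have bound: "(\<integral>\<^sup>+s. ennreal (norm (g (Suc i) s - g i s)) \<partial>expd) \<le> ennreal ((1 + \<bar>C\<bar>) * (1/2)^i)" for i
  proof -
    \<comment> \<open>An increment above \<open>(1/2)^i\<close> is below \<open>2^i\<close> times
      its own square.\<close>
    have "norm (g (Suc i) s - g i s) \<le> (1/2)^i + 2^i * (norm (g (Suc i) s - g i s))\<^sup>2" for s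
    proof (cases "norm (g (Suc i) s - g i s) \<le> (1/2)^i")
      case True
      then show ?thesis by (smt (verit) zero_le_mult_iff zero_le_power2 zero_le_power)
    next
      case False
      then have "1 \<le> 2^i * norm (g (Suc i) s - g i s)"
        by (simp add: power_one_over field_simps)
      then have "norm (g (Suc i) s - g i s) * 1 \<le> norm (g (Suc i) s - g i s) * (2^i * norm (g (Suc i) s - g i s))"
        by (intro mult_left_mono) auto
      then show ?thesis by (simp add: power2_eq_square algebra_simps add_increasing)
    qed
    then have "(\<integral>\<^sup>+s. ennreal (norm (g (Suc i) s - g i s)) \<partial>expd) \<le>
        (\<integral>\<^sup>+s. ennreal ((1/2)^i + 2^i * (norm (g (Suc i) s - g i s))\<^sup>2) \<partial>expd)"
      by (intro nn_integral_mono ennreal_leI)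
    also have "\<dots> = ennreal (\<integral>s. (1/2)^i + 2^i * (norm (g (Suc i) s - g i s))\<^sup>2 \<partial>expd)"
      using I2 by (intro nn_integral_eq_integral) auto
    also have "(\<integral>s. (1/2)^i + 2^i * (norm (g (Suc i) s - g i s))\<^sup>2 \<partial>expd) \<le> (1/2)^i + 2^i * (C * (1/8)^i)"
      using I2 fast[of i] expd.prob_space by simp
    also have "2^i * (C * (1/8)^i) = C * (1/4)^i"
      by (simp add: power_mult_distrib[symmetric] mult.left_commute)
    also have "\<dots> \<le> \<bar>C\<bar> * (1/2)^i"
      by (intro mult_mono power_mono) auto
    finally show ?thesis by (simp add: ennreal_leI algebra_simps)
  qed
  have "(\<integral>\<^sup>+s. (\<Sum>i. ennreal (norm (g (Suc i) s - g i s))) \<partial>expd) =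
      (\<Sum>i. \<integral>\<^sup>+s. ennreal (norm (g (Suc i) s - g i s)) \<partial>expd)"
    by (intro nn_integral_suminf) auto
  also have "\<dots> \<le> (\<Sum>i. ennreal ((1 + \<bar>C\<bar>) * (1/2)^i))"
    by (intro suminf_le bound summableI)
  also have "\<dots> = ennreal (\<Sum>i. (1 + \<bar>C\<bar>) * (1/2)^i)"
    by (intro suminf_ennreal2 summable_mult summable_geometric) auto
  also have "\<dots> < \<infinity>" by simp
  finally have "AE s in expd. (\<Sum>i. ennreal (norm (g (Suc i) s - g i s))) \<noteq> \<infinity>"
    by (intro nn_integral_noteq_infinite) auto
  then have "AE s in expd. convergent (\<lambda>i. g i s)"
  proof eventually_elim
    case (elim s)
    then have "summable (\<lambda>i. norm (g (Suc i) s - g i s))"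
      by (intro summable_suminf_not_top) auto
    then have "summable (\<lambda>i. g (Suc i) s - g i s)" by (rule summable_norm_cancel)
    then have "(\<lambda>n. \<Sum>i<n. g (Suc i) s - g i s) \<longlonglongrightarrow> (\<Sum>i. g (Suc i) s - g i s)"
      by (rule summable_LIMSEQ)
    then have "(\<lambda>n. g n s - g 0 s) \<longlonglongrightarrow> (\<Sum>i. g (Suc i) s - g i s)"
      by (simp only: sum_lessThan_telescope[of "\<lambda>i. g i s"])
    from tendsto_add[OF this tendsto_const[of "g 0 s"]] show ?case
      by (auto simp: convergent_def)
  qed
  then obtain N where "{s \<in> space expd. \<not> convergent (\<lambda>i. g i s)} \<subseteq> N" "emeasure expd N = 0" "N \<in> sets expd"
    by (rule AE_E)
  then have N: "N \<in> null_sets expd" and conv: "\<And>s. s \<notin> N \<Longrightarrow> convergent (\<lambda>i. g i s)" by auto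
  have [measurable]: "N \<in> sets borel" using N by auto
  \<comment> \<open>On the exceptional set any point of the simplex would do; \<open>ctrl\<close>
    demands one at every time.\<close>
  define g' where "g' s = (if s \<in> N then g 0 s else lim (\<lambda>i. g i s))" for s
  have lim: "(\<lambda>i. g i s) \<longlonglongrightarrow> g' s" if "s \<notin> N" for s
    using conv[OF that] that by (simp add: g'_def convergent_LIMSEQ_iff)
  have "g' s \<in> prob_vectors" for s
  proof (cases "s \<in> N")
    case True
    then show ?thesis by (simp add: g'_def ctrl_prob[OF g])
  next
    case False
    from closed_sequentially[OF closed_prob_vectors _ lim[OF this]] ctrl_prob[OF g] show ?thesis by blast
  qed
  moreover have "g' \<in> borel_measurable borel" unfolding g'_def
    by (intro measurable_If borel_measurable_lim_metric) auto
  ultimately have "g' \<in> ctrl" by (simp add: ctrl_def)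
  with N lim show ?thesis using that by blast
qed

lemma parallelogram_midpoint:
  fixes a b :: "'a::real_inner"
  shows "(norm (a - b))\<^sup>2 = 2 * (norm a)\<^sup>2 + 2 * (norm b)\<^sup>2 - 4 * (norm ((1/2) *\<^sub>R a + (1/2) *\<^sub>R b))\<^sup>2"
  by (simp add: power2_norm_eq_inner inner_add inner_diff inner_commute algebra_simps)

text \<open>Weak compactness of the controls is replaced by a minimisation: almost minimisers of the
  \<open>L\<^sup>2\<close>-norm over the shrinking midpoint-convex sets \<open>A e\<close> form a Cauchy sequence.\<close>

lemma achievable_closed:
  assumes K: "K \<in> transition_kernels" and c: "0 \<le> c"
    and approx: "\<And>e. 0 < e \<Longrightarrow> \<exists>m' c'. achievable K m' c' \<and> dist m' m \<le> e \<and> c' \<le> c + e"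
  shows "achievable K m c"
proof -
  define A where "A e = {\<sigma> \<in> ctrl. dist (occ \<sigma> 0) m \<le> e \<and> cost K \<sigma> \<le> ennreal (c + e)}" for e
  define q where "q \<sigma> = (\<integral>s. (norm (\<sigma> s))\<^sup>2 \<partial>expd)" for \<sigma> :: "real \<Rightarrow> real ^ 'a"
  have A_ctrl: "\<sigma> \<in> ctrl" if "\<sigma> \<in> A e" for \<sigma> e using that by (simp add: A_def)
  have A_ne: "A e \<noteq> {}" if "0 < e" for e
  proof -
    from approx[OF that] obtain \<sigma> c' where "\<sigma> \<in> ctrl" "dist (occ \<sigma> 0) m \<le> e" "cost K \<sigma> \<le> ennreal c'" "c' \<le> c + e"
      by (auto simp: achievable_def)
    then have "\<sigma> \<in> A e" by (auto simp: A_def intro: order_trans ennreal_leI)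
    then show ?thesis by auto
  qed
  have A_mono: "A e \<subseteq> A e'" if "e \<le> e'" for e e'
    using that by (auto simp: A_def elim!: order_trans intro!: ennreal_leI)
  have A_mid: "(\<lambda>s. (1/2) *\<^sub>R \<sigma> s + (1/2) *\<^sub>R \<tau> s) \<in> A e" if e: "0 < e" and s: "\<sigma> \<in> A e" and t: "\<tau> \<in> A e" for \<sigma> \<tau> e
  proof -
    note sc = A_ctrl[OF s] and tc = A_ctrl[OF t]
    have "dist ((1/2) *\<^sub>R occ \<sigma> 0 + (1/2) *\<^sub>R occ \<tau> 0) m \<le> e"
    proof -
      have "occ \<sigma> 0 \<in> cball m e" "occ \<tau> 0 \<in> cball m e" using s t by (auto simp: A_def dist_commute)
      then have "(1/2) *\<^sub>R occ \<sigma> 0 + (1/2) *\<^sub>R occ \<tau> 0 \<in> cball m e"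
        by (intro convexD[OF convex_cball]) auto
      then show ?thesis by (simp add: dist_commute)
    qed
    moreover have "cost K (\<lambda>s. (1/2) *\<^sub>R \<sigma> s + (1/2) *\<^sub>R \<tau> s) \<le> ennreal (c + e)"
    proof -
      have "cost K (\<lambda>s. (1/2) *\<^sub>R \<sigma> s + (1/2) *\<^sub>R \<tau> s) \<le> ennreal (1/2) * cost K \<sigma> + ennreal (1/2) * cost K \<tau>"
        by (rule cost_convex[OF K sc tc]) auto
      also have "\<dots> \<le> ennreal (1/2) * ennreal (c + e) + ennreal (1/2) * ennreal (c + e)"
        using s t by (intro add_mono mult_left_mono) (auto simp: A_def)
      also have "\<dots> = ennreal ((1/2) * (c + e) + (1/2) * (c + e))"
        using c e by (intro ennreal_lincomb) auto
      also have "(1/2) * (c + e) + (1/2) * (c + e) = c + e" by simp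
      finally show ?thesis .
    qed
    ultimately show ?thesis
      using ctrl_convex[OF sc tc, of "1/2" "1/2"] by (simp add: A_def occ_convex[OF sc tc])
  qed
  have n1: "(norm (\<sigma> s))\<^sup>2 \<le> 1" if "\<sigma> \<in> ctrl" for \<sigma> and s :: real
    using norm_prob_le1[OF ctrl_prob[OF that, of s]] by (simp add: power_le_one)
  have q_int: "integrable expd (\<lambda>s. (norm (\<sigma> s))\<^sup>2)" if "\<sigma> \<in> ctrl" for \<sigma> :: "real \<Rightarrow> real ^ 'a"
    using ctrl_measurable[OF that] n1[OF that] by (intro expd_bounded_integrable[where B=1]) auto
  have q_nn: "0 \<le> q \<sigma>" for \<sigma> unfolding q_def by simp
  have q_le: "q \<sigma> \<le> 1" if "\<sigma> \<in> ctrl" for \<sigma>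
    unfolding q_def using n1[OF that] q_int[OF that] by (intro expd.integral_le_const) auto
  \<comment> \<open>The infimum over \<open>A e\<close> grows as \<open>e\<close> shrinks. Its limit
    \<open>L\<close> below is finite because controls have norm at most 1.\<close>
  define al where "al e = Inf (q ` A e)" for e
  have bdd: "bdd_below (q ` A e)" for e using q_nn by (auto intro!: bdd_belowI[where m=0])
  have al_le: "al e \<le> q \<sigma>" if "\<sigma> \<in> A e" for e \<sigma>
    unfolding al_def using that bdd by (intro cInf_lower) auto
  have al_le1: "al e \<le> 1" if "0 < e" for e
  proof -
    from A_ne[OF that] obtain \<sigma> where "\<sigma> \<in> A e" by auto
    then show ?thesis using al_le[of \<sigma> e] q_le[OF A_ctrl] by fastforce
  qed
  define L where "L = Sup (al ` {0<..})"
  have bddL: "bdd_above (al ` {0<..})" using al_le1 by (auto intro!: bdd_aboveI[where M=1])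
  have al_L: "al e \<le> L" if "0 < e" for e unfolding L_def using that bddL by (intro cSup_upper) auto
  \<comment> \<open>Besides being small, the level must be so late that the infimum has come within
    \<open>(1/8)^i\<close> of its limit.\<close>
  have "\<exists>e>0. e \<le> (1/2)^i \<and> L - (1/8)^i < al e" for i :: nat
  proof -
    obtain e where e: "0 < e" "L - (1/8)^i < al e"
      using less_cSupD[of "al ` {0<..}" "L - (1/8)^i"] by (auto simp: L_def)
    define e' where "e' = min e ((1/2)^i)"
    have e': "0 < e'" "e' \<le> e" "e' \<le> (1/2)^i" using e by (auto simp: e'_def)
    have "al e \<le> al e'" unfolding al_def
      by (intro cInf_superset_mono bdd image_mono A_mono e') (use A_ne[OF e'(1)] in auto)
    with e e' show ?thesis by (intro exI[of _ e']) auto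
  qed
  then obtain e where e: "\<And>i::nat. 0 < e i" "\<And>i. e i \<le> (1/2)^i" "\<And>i. L - (1/8)^i < al (e i)" by metis
  have "\<exists>\<sigma>\<in>A (e i). q \<sigma> < L + (1/8)^i" for i
  proof -
    have "Inf (q ` A (e i)) < L + (1/8)^i" using al_L[OF e(1), of i] unfolding al_def
      by (smt (verit) zero_less_power zero_less_divide_1_iff)
    then show ?thesis using cInf_lessD[of "q ` A (e i)"] A_ne[OF e(1)] by auto
  qed
  then obtain g where gA: "\<And>i. g i \<in> A (e i)" and gq: "\<And>i. q (g i) < L + (1/8)^i" by metis
  note g = A_ctrl[OF gA]
  \<comment> \<open>The midpoint lies in the larger of the two sets, so its squared norm is at least
    \<open>L - (1/8)^i\<close>, while both ends are below \<open>L + (1/8)^i\<close>. In the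
    parallelogram law the errors add up to 2 + 2 + 4 = 8 times \<open>(1/8)^i\<close>.\<close>
  have fast: "(\<integral>s. (norm (g (Suc i) s - g i s))\<^sup>2 \<partial>expd) \<le> 8 * (1/8)^i" for i
  proof -
    define h where "h s = (1/2) *\<^sub>R g (Suc i) s + (1/2) *\<^sub>R g i s" for s
    define e' where "e' = max (e (Suc i)) (e i)"
    have "g (Suc i) \<in> A e'" "g i \<in> A e'" using gA A_mono[of "e (Suc i)" e'] A_mono[of "e i" e'] by (auto simp: e'_def)
    then have hA: "h \<in> A e'" unfolding h_def using e(1)[of i] by (intro A_mid) (auto simp: e'_def)
    have "(1/8::real) ^ Suc i \<le> (1/8)^i" by simp
    then have "L - (1/8)^i \<le> al (e (Suc i))" using e(3)[of "Suc i"] by linarith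
    then have "L - (1/8)^i \<le> al e'" using e(3)[of i] by (auto simp: e'_def max_def)
    also have "\<dots> \<le> q h" by (rule al_le[OF hA])
    finally have qh: "L - (1/8)^i \<le> q h" .
    have "(\<integral>s. (norm (g (Suc i) s - g i s))\<^sup>2 \<partial>expd) =
        (\<integral>s. 2 * (norm (g (Suc i) s))\<^sup>2 + 2 * (norm (g i s))\<^sup>2 - 4 * (norm (h s))\<^sup>2 \<partial>expd)"
      unfolding h_def parallelogram_midpoint ..
    also have "\<dots> = 2 * q (g (Suc i)) + 2 * q (g i) - 4 * q h"
      unfolding q_def using q_int[OF g] q_int[OF A_ctrl[OF hA]] by simp
    also have "\<dots> \<le> 8 * (1/8)^i" using qh gq[of i] less_le_trans[OF gq[of "Suc i"] add_left_mono[OF \<open>(1/8::real) ^ Suc i \<le> (1/8)^i\<close>]]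
      by linarith
    finally show ?thesis .
  qed
  from ctrl_fast_Cauchy_limit[OF g fast] obtain g' N where g': "g' \<in> ctrl" and N: "N \<in> null_sets expd"
    and lim: "\<And>s. s \<notin> N \<Longrightarrow> (\<lambda>i. g i s) \<longlonglongrightarrow> g' s" by blast
  have half: "(\<lambda>i. (1/2::real)^i) \<longlonglongrightarrow> 0" by (intro LIMSEQ_power_zero) auto
  have e0: "e \<longlonglongrightarrow> 0"
    by (rule tendsto_sandwich[OF _ _ tendsto_const half]) (auto intro!: always_eventually simp: e(2) less_imp_le[OF e(1)])
  have "(\<lambda>i. dist (occ (g i) 0) m) \<longlonglongrightarrow> 0"
  proof (rule tendsto_sandwich[OF _ _ tendsto_const e0])
    show "\<forall>\<^sub>F i in sequentially. dist (occ (g i) 0) m \<le> e i"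
      using gA by (intro always_eventually) (simp add: A_def)
  qed simp
  then have "(\<lambda>i. occ (g i) 0) \<longlonglongrightarrow> m" by (subst tendsto_dist_iff)
  with occ_tendsto[OF g g' N lim, of 0] have "occ g' 0 = m" using LIMSEQ_unique by blast
  moreover have "cost K g' \<le> ennreal c"
  proof -
    have "cost K g' \<le> liminf (\<lambda>i. cost K (g i))" by (rule cost_lsc[OF K g g' N lim])
    also have "\<dots> \<le> liminf (\<lambda>i. ennreal (c + e i))"
      using gA by (intro Liminf_mono always_eventually) (auto simp: A_def)
    also have "\<dots> = ennreal (c + 0)"
      by (intro lim_imp_Liminf tendsto_ennrealI tendsto_intros e0) auto
    finally show ?thesis by simp
  qed
  ultimately show ?thesis using g' c by (auto simp: achievable_def)
qed

subsection \<open>Laws of the occupation counts\<close>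

definition cvec :: "('d \<Rightarrow> nat) \<Rightarrow> real ^ 'd::finite" where
  "cvec N = (\<chi> y. real (N y))"

text \<open>\<open>count_prob K x0 n N\<close> is the probability that the counts of \<open>X 0, ..., X n\<close> are \<open>N\<close>.\<close>

fun count_prob :: "real ^ 'd ^ 'd \<Rightarrow> 'd \<Rightarrow> nat \<Rightarrow> ('d::finite \<Rightarrow> nat) \<Rightarrow> real" where
  "count_prob K x0 0 N = (if N = (\<lambda>_. 0)(x0 := 1) then 1 else 0)"
| "count_prob K x0 (Suc n) N = (\<Sum>y\<in>{y. 0 < N y}. count_prob K x0 n (N(y := N y - 1)) *
     ((cvec (N(y := N y - 1)) v* K) $ y / real (n + 1)))"

lemma cvec_nth[simp]: "cvec N $ y = real (N y)"
  by (simp add: cvec_def)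

lemma cvec_kernel_nonneg: "K \<in> transition_kernels \<Longrightarrow> 0 \<le> (cvec N v* K) $ y"
  by (auto simp: vec_kernel_nth kernelD intro!: sum_nonneg)

lemma count_prob_nonneg:
  assumes K: "K \<in> transition_kernels"
  shows "0 \<le> count_prob K x0 n N"
proof (induction n arbitrary: N)
  case (Suc n)
  then show ?case unfolding count_prob.simps
    by (intro sum_nonneg mult_nonneg_nonneg divide_nonneg_nonneg cvec_kernel_nonneg[OF K]) auto
qed simp

lemma count_prob_total:
  assumes K: "K \<in> transition_kernels" and pos: "0 < count_prob K x0 n N"
  shows "(\<Sum>y\<in>UNIV. N y) = n + 1"
  using pos
proof (induction n arbitrary: N)
  case 0
  then have "N = (\<lambda>_. 0)(x0 := 1)" by (auto split: if_splits)
  then show ?case by (simp add: fun_upd_def)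
next
  case (Suc n)
  then obtain y where y: "0 < N y" "count_prob K x0 n (N(y := N y - 1)) * ((cvec (N(y := N y - 1)) v* K) $ y / real (n + 1)) \<noteq> 0"
    using sum.neutral[of "{y. 0 < N y}"] by (metis (mono_tags, lifting) count_prob.simps(2) less_irrefl mem_Collect_eq)
  then have "0 < count_prob K x0 n (N(y := N y - 1))" using count_prob_nonneg[OF K, of x0 n "N(y := N y - 1)"] by auto
  from Suc.IH[OF this] have "(\<Sum>z\<in>UNIV. (N(y := N y - 1)) z) = n + 1" .
  moreover have "(\<Sum>z\<in>UNIV. N z) = (\<Sum>z\<in>UNIV. (N(y := N y - 1)) z) + 1"
    using y(1) by (simp add: sum.remove[of UNIV y])
  ultimately show ?case by simp
qed

lemma cvec_prob:
  assumes "(\<Sum>y\<in>UNIV. N y) = n" "0 < n"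
  shows "(1 / real n) *\<^sub>R cvec N \<in> prob_vectors"
  using assms by (auto simp: prob_vectors_def simp flip: sum_divide_distrib of_nat_sum)

lemma achievable_mono: "achievable K m c \<Longrightarrow> c \<le> c' \<Longrightarrow> achievable K m c'"
  unfolding achievable_def by (meson ennreal_leI order_trans)

lemma achievable_convex_sum:
  assumes K: "K \<in> transition_kernels" and "finite S" and "\<And>i. i \<in> S \<Longrightarrow> 0 \<le> a i" and "(\<Sum>i\<in>S. a i) = 1"
    and "\<And>i. i \<in> S \<Longrightarrow> achievable K (m i) (c i)"
  shows "achievable K (\<Sum>i\<in>S. a i *\<^sub>R m i) (\<Sum>i\<in>S. a i * c i)"
proof -
  have "(\<Sum>i\<in>S. a i *\<^sub>R (m i, c i)) \<in> {(m, c). achievable K m c}"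
    using assms by (intro convex_sum achievable_convex) auto
  moreover have "(\<Sum>i\<in>S. a i *\<^sub>R (m i, c i)) = (\<Sum>i\<in>S. a i *\<^sub>R m i, \<Sum>i\<in>S. a i * c i)"
    by (simp add: prod_eq_iff fst_sum snd_sum)
  ultimately show ?thesis by simp
qed

text \<open>Turns an error of order \<open>1 / n\<close> in a single step into an increment of
  \<open>ln\<close>, so that the errors of all steps sum to a logarithm.\<close>

lemma ln_Suc_diff_ge:
  assumes "0 < (k::real)" shows "1 / (k + 1) \<le> ln ((k + 1) / k)"
proof -
  have "ln (k / (k + 1)) \<le> k / (k + 1) - 1" using assms by (intro ln_le_minus_one) auto
  then show ?thesis using assms by (simp add: ln_div field_simps)
qed

subsection \<open>From probabilities of counts to controls\<close>

text \<open>\<open>m v* K\<close> may have zero entries, which makes entropies infinite and ratios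
  of nearby laws unbounded. A weight \<epsilon> on \<rho> bounds all entries below by
  \<open>\<epsilon> * \<kappa>\<close>.\<close>

locale regularised_kernel =
  fixes K :: "real ^ 'd::finite ^ 'd" and \<rho> :: "real ^ 'd" and \<kappa> :: real and \<epsilon> :: real
  assumes K: "K \<in> transition_kernels" and \<rho>: "\<rho> \<in> prob_vectors"
    and \<kappa>: "0 < \<kappa>" "\<And>y. \<kappa> \<le> (\<rho> v* K) $ y" and \<epsilon>: "0 < \<epsilon>" "\<epsilon> < 1"
begin

definition T :: "real ^ 'd \<Rightarrow> real ^ 'd" where
  "T m = (1 - \<epsilon>) *\<^sub>R m + \<epsilon> *\<^sub>R \<rho>"

lemma T_prob: "m \<in> prob_vectors \<Longrightarrow> T m \<in> prob_vectors"
  unfolding T_def using prob_vectors_convex \<rho> \<epsilon> by (auto simp: convex_def)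

lemma T_affine:
  assumes "u + v = 1" shows "T (u *\<^sub>R a + v *\<^sub>R b) = u *\<^sub>R T a + v *\<^sub>R T b"
proof -
  have "T (u *\<^sub>R a + v *\<^sub>R b) = (1 - \<epsilon>) *\<^sub>R (u *\<^sub>R a + v *\<^sub>R b) + (u + v) *\<^sub>R (\<epsilon> *\<^sub>R \<rho>)"
    by (simp add: T_def assms)
  also have "\<dots> = u *\<^sub>R T a + v *\<^sub>R T b"
    unfolding T_def scaleR_add_right scaleR_add_left[of u v] by (simp add: mult.commute)
  finally show ?thesis .
qed

lemma T_kernel_ge:
  assumes "\<And>z. 0 \<le> m $ z"
  shows "\<epsilon> * \<kappa> \<le> (T m v* K) $ y"
proof -
  have "(T m v* K) $ y = (1 - \<epsilon>) * (m v* K) $ y + \<epsilon> * (\<rho> v* K) $ y"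
    by (simp add: T_def vec_kernel_linear)
  moreover have "0 \<le> (1 - \<epsilon>) * (m v* K) $ y"
    using \<epsilon> assms kernelD[OF K] by (auto simp: vec_kernel_nth intro!: mult_nonneg_nonneg sum_nonneg)
  moreover have "\<epsilon> * \<kappa> \<le> \<epsilon> * (\<rho> v* K) $ y" using \<kappa>(2) \<epsilon> by (intro mult_left_mono) auto
  ultimately show ?thesis by linarith
qed

text \<open>The first term pays for the factor \<open>1 - \<epsilon>\<close> in front of the true
  transition law, the second for the component \<rho> of the regularised letter law. Both vanish as
  \<epsilon> tends to 0.\<close>

definition rate_err :: real where
  "rate_err = ln (1 / (1 - \<epsilon>)) + \<epsilon> * ln (1 / (\<epsilon> * \<kappa>))"

text \<open>The cost of the first sample, then \<open>rate_err\<close> per step, then the errors of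
  order \<open>1 / n\<close>, summed to a logarithm: the coefficient
  \<open>1 / (\<epsilon> * \<kappa>)\<close> stems from a discrepancy of one sample, the 1 from
  exchanging the denominators \<open>n + 1\<close> and \<open>n + 2\<close>.\<close>

definition err :: "nat \<Rightarrow> real" where
  "err n = ln (1 / (\<epsilon> * \<kappa>)) + real n * rate_err + (1 / (\<epsilon> * \<kappa>) + 1) * ln (real (n + 1))"

text \<open>\<open>B\<close> is the entropy against the actual transition probabilities
  \<open>q\<close> plus the price of exchanging \<open>q\<close> for the regularised law. The
  exchange works because \<open>N / (n + 2)\<close> exceeds the occupation during the added stretch
  by at most one sample, a relative error of \<open>1 / (\<epsilon> * \<kappa> * (n + 2))\<close>
  for a law whose entries are at least \<open>\<epsilon> * \<kappa>\<close>.\<close>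

lemma count_prob_step_bound:
  assumes \<eta>: "\<eta> \<in> prob_vectors" and w: "w \<in> prob_vectors"
    and N: "cvec N = \<eta> + real (n + 1) *\<^sub>R w"
    and Y: "\<And>y. \<eta> $ y \<noteq> 0 \<Longrightarrow> y \<in> Y" and q0: "\<And>y. y \<in> Y \<Longrightarrow> 0 < q y"
    and qN: "\<And>y. y \<in> Y \<Longrightarrow> q y \<le> (cvec N v* K) $ y / real (n + 1)"
    and \<theta>: "real (n + 1) / real (n + 2) \<le> \<theta>" "\<theta> \<le> 1"
  defines "B \<equiv> (\<Sum>y\<in>Y. \<eta> $ y * ln (\<eta> $ y / q y)) + 1 / (\<epsilon> * \<kappa> * real (n + 2)) + ln (real (n + 2) / real (n + 1)) + rate_err"
  shows "rent (T \<eta>) (((1 - \<theta>) *\<^sub>R T \<eta> + \<theta> *\<^sub>R T w) v* K) \<le> ennreal B" "0 \<le> B"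
proof -
  define v where "v = (1 - \<theta>) *\<^sub>R \<eta> + \<theta> *\<^sub>R w"
  have \<theta>0: "0 \<le> \<theta>" using \<theta>(1) by (smt (verit) divide_nonneg_nonneg of_nat_0_le_iff)
  have v: "v \<in> prob_vectors" unfolding v_def using prob_vectors_convex \<eta> w \<theta> \<theta>0 by (auto simp: convex_def)
  define b where "b = T v v* K"
  have Tv: "((1 - \<theta>) *\<^sub>R T \<eta> + \<theta> *\<^sub>R T w) v* K = b" unfolding b_def v_def by (subst T_affine) auto
  have bp: "b \<in> prob_vectors" unfolding b_def by (intro vec_kernel_prob T_prob v K)
  have ek: "0 < \<epsilon> * \<kappa>" using \<epsilon> \<kappa> by simp
  have bge: "\<epsilon> * \<kappa> \<le> b $ y" for y unfolding b_def by (intro T_kernel_ge prob_vectorsD(1)[OF v])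
  then have b0: "0 < b $ y" for y using ek by (meson less_le_trans)
  define kn where "kn = 1 / (\<epsilon> * \<kappa> * real (n + 2))"
  have kn: "0 < kn" using ek by (simp add: kn_def)
  define Z where "Z = (\<Sum>y\<in>UNIV. \<eta> $ y * ln (\<eta> $ y / b $ y))"
  have Z: "rent \<eta> b = ennreal Z" "0 \<le> Z" unfolding Z_def by (rule rent_eq_sum[OF \<eta> bp b0])+
  have qb: "ln (q y / b $ y) \<le> kn + ln (1 / (1 - \<epsilon>)) + ln (real (n + 2) / real (n + 1))" if y: "y \<in> Y" for y
  proof -
    define Nn where "Nn = (1 / real (n + 2)) *\<^sub>R cvec N"
    \<comment> \<open>As \<theta> is at least \<open>(n + 1) / (n + 2)\<close>, the vector
      \<open>v\<close> contains enough of \<open>w\<close>; only the single sample \<eta> may be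
      missing.\<close>
    have "Nn $ z \<le> v $ z + 1 / real (n + 2) * \<eta> $ z" for z
    proof -
      have "Nn $ z = 1 / real (n + 2) * \<eta> $ z + real (n + 1) / real (n + 2) * w $ z"
        unfolding Nn_def N vector_scaleR_component vector_add_component real_scaleR_def distrib_left by simp
      also have "\<dots> \<le> 1 / real (n + 2) * \<eta> $ z + \<theta> * w $ z"
        using \<theta> prob_vectorsD(1)[OF w, of z] by (intro add_left_mono mult_right_mono) auto
      moreover have "0 \<le> (1 - \<theta>) * \<eta> $ z" using \<theta> prob_vectorsD(1)[OF \<eta>, of z] by simp
      ultimately show ?thesis by (simp add: v_def)
    qed
    then have "(Nn v* K) $ y \<le> ((1 *\<^sub>R v + (1 / real (n + 2)) *\<^sub>R \<eta>) v* K) $ y"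
      unfolding vec_kernel_nth using kernelD[OF K] by (intro sum_mono mult_right_mono) auto
    also have "\<dots> = (v v* K) $ y + (1 / real (n + 2)) * (\<eta> v* K) $ y" by (simp only: vec_kernel_linear) simp
    also have "\<dots> \<le> (v v* K) $ y + (1 / real (n + 2)) * 1"
      using prob_vectorsD(2)[OF vec_kernel_prob[OF \<eta> K]] by (intro add_left_mono mult_left_mono) auto
    finally have Nv: "(Nn v* K) $ y \<le> (v v* K) $ y + 1 / real (n + 2)" by simp
    have "(1 - \<epsilon>) * (Nn v* K) $ y \<le> (1 - \<epsilon>) * ((v v* K) $ y + 1 / real (n + 2))"
      using Nv \<epsilon> by (intro mult_left_mono) auto
    also have "\<dots> \<le> b $ y + 1 / real (n + 2)"
    proof -
      have "b $ y = (1 - \<epsilon>) * (v v* K) $ y + \<epsilon> * (\<rho> v* K) $ y" by (simp add: b_def T_def vec_kernel_linear)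
      moreover have "0 \<le> \<epsilon> * (\<rho> v* K) $ y" using \<epsilon> \<kappa>(1) \<kappa>(2)[of y] by simp
      moreover have "(1 - \<epsilon>) * (1 / real (n + 2)) \<le> 1 / real (n + 2)" using \<epsilon> by (intro mult_left_le_one_le) auto
      ultimately show ?thesis by (simp only: distrib_left)
    qed
    also have "\<dots> \<le> b $ y * (1 + kn)"
    proof -
      have "1 / real (n + 2) = \<epsilon> * \<kappa> * kn" using ek \<epsilon> \<kappa> by (simp add: kn_def)
      also have "\<dots> \<le> b $ y * kn" using bge kn by (intro mult_right_mono) auto
      finally show ?thesis by (simp add: algebra_simps)
    qed
    finally have Nb: "(1 - \<epsilon>) * (Nn v* K) $ y \<le> b $ y * (1 + kn)" .
    have "q y \<le> (cvec N v* K) $ y / real (n + 1)" by (rule qN[OF y])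
    also have "\<dots> = (Nn v* K) $ y * (real (n + 2) / real (n + 1))"
      by (simp add: Nn_def vec_kernel_nth sum_divide_distrib sum_distrib_right)
    also have "\<dots> \<le> (b $ y * (1 + kn) / (1 - \<epsilon>)) * (real (n + 2) / real (n + 1))"
      using Nb \<epsilon> by (intro mult_right_mono) (simp_all add: pos_le_divide_eq mult.commute)
    finally have "q y / b $ y \<le> (1 + kn) * (1 / (1 - \<epsilon>)) * (real (n + 2) / real (n + 1))"
      using b0[of y] by (simp add: pos_divide_le_eq field_simps)
    then have "ln (q y / b $ y) \<le> ln ((1 + kn) * (1 / (1 - \<epsilon>)) * (real (n + 2) / real (n + 1)))"
      using q0[OF y] b0[of y] kn \<epsilon> by (intro iffD2[OF ln_le_cancel_iff]) auto
    also have "\<dots> = ln (1 + kn) + ln (1 / (1 - \<epsilon>)) + ln (real (n + 2) / real (n + 1))"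
      using ln_mult_pos[of "(1 + kn) * (1 / (1 - \<epsilon>))" "real (n + 2) / real (n + 1)"] ln_mult_pos[of "1 + kn" "1 / (1 - \<epsilon>)"] kn \<epsilon>
      by simp
    also have "ln (1 + kn) \<le> kn" using kn by (intro ln_add_one_self_le_self) auto
    finally show ?thesis by simp
  qed
  have sumY: "(\<Sum>y\<in>Y. \<eta> $ y) = 1" "(\<Sum>y\<in>Y. f y) = (\<Sum>y\<in>UNIV. f y)" if "\<And>y. \<eta> $ y = 0 \<Longrightarrow> f y = 0" for f :: "'d \<Rightarrow> real"
    using Y prob_vectorsD(3)[OF \<eta>] that
    by (auto simp flip: prob_vectorsD(3)[OF \<eta>] intro!: sum.mono_neutral_left)
  have "Z = (\<Sum>y\<in>Y. \<eta> $ y * ln (\<eta> $ y / b $ y))" unfolding Z_def by (rule sumY(2)[symmetric]) auto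
  also have "\<dots> \<le> (\<Sum>y\<in>Y. \<eta> $ y * ln (\<eta> $ y / q y) + \<eta> $ y * (kn + ln (1 / (1 - \<epsilon>)) + ln (real (n + 2) / real (n + 1))))"
  proof (rule sum_mono)
    fix y assume y: "y \<in> Y"
    show "\<eta> $ y * ln (\<eta> $ y / b $ y) \<le> \<eta> $ y * ln (\<eta> $ y / q y) + \<eta> $ y * (kn + ln (1 / (1 - \<epsilon>)) + ln (real (n + 2) / real (n + 1)))"
    proof (cases "\<eta> $ y = 0")
      case False
      then have "ln (\<eta> $ y / b $ y) = ln (\<eta> $ y / q y) + ln (q y / b $ y)"
        using prob_vectorsD(1)[OF \<eta>, of y] q0[OF y] b0[of y] by (simp add: ln_div)
      then show ?thesis using qb[OF y] prob_vectorsD(1)[OF \<eta>, of y]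
        by (simp add: mult_left_mono flip: distrib_left)
    qed simp
  qed
  also have "\<dots> = (\<Sum>y\<in>Y. \<eta> $ y * ln (\<eta> $ y / q y)) + (kn + ln (1 / (1 - \<epsilon>)) + ln (real (n + 2) / real (n + 1)))"
    using sumY(1)[of "\<lambda>_. 0"] by (simp add: sum.distrib flip: sum_distrib_right)
  finally have Zle: "Z + \<epsilon> * ln (1 / (\<epsilon> * \<kappa>)) \<le> B" by (simp add: B_def rate_err_def kn_def)
  have rb: "rent \<rho> b \<le> ennreal (ln (1 / (\<epsilon> * \<kappa>)))" "0 \<le> ln (1 / (\<epsilon> * \<kappa>))"
    by (rule rent_le_ln[OF \<rho> bp ek bge])+
  show "0 \<le> B" using Zle Z(2) rb(2) \<epsilon> by (smt (verit) mult_nonneg_nonneg)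
  \<comment> \<open>Writing \<open>b\<close> as a mixture of itself lets joint convexity separate
    the \<rho>-part of \<open>T \<eta>\<close>.\<close>
  have "rent (T \<eta>) b = rent ((1 - \<epsilon>) *\<^sub>R \<eta> + \<epsilon> *\<^sub>R \<rho>) ((1 - \<epsilon>) *\<^sub>R b + \<epsilon> *\<^sub>R b)"
    by (simp add: T_def algebra_simps)
  also have "\<dots> \<le> ennreal (1 - \<epsilon>) * rent \<eta> b + ennreal \<epsilon> * rent \<rho> b"
    using \<epsilon> by (intro rent_convex \<eta> bp \<rho>) auto
  also have "\<dots> \<le> ennreal (1 - \<epsilon>) * ennreal Z + ennreal \<epsilon> * ennreal (ln (1 / (\<epsilon> * \<kappa>)))"
    unfolding Z(1) by (intro add_left_mono mult_left_mono rb) auto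
  also have "\<dots> = ennreal ((1 - \<epsilon>) * Z + \<epsilon> * ln (1 / (\<epsilon> * \<kappa>)))"
    using \<epsilon> Z(2) rb(2) by (intro ennreal_lincomb) auto
  also have "\<dots> \<le> ennreal B"
  proof (rule ennreal_leI)
    have "(1 - \<epsilon>) * Z \<le> Z" using \<epsilon> Z(2) by (intro mult_left_le_one_le) auto
    then show "(1 - \<epsilon>) * Z + \<epsilon> * ln (1 / (\<epsilon> * \<kappa>)) \<le> B" using Zle by linarith
  qed
  finally show "rent (T \<eta>) (((1 - \<theta>) *\<^sub>R T \<eta> + \<theta> *\<^sub>R T w) v* K) \<le> ennreal B" unfolding Tv .
qed

text \<open>The control for the counts \<open>N\<close> averages those for the possible predecessors of \<open>N\<close>, weighted by the
  conditional law \<open>\<eta>\<close> of the last letter, and spends the time \<open>ln ((n + 2) / (n + 1))\<close> on \<open>\<eta>\<close> first.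
  The map \<open>T\<close> keeps all transition probabilities away from \<open>0\<close>.\<close>

lemma count_prob_achievable:
  assumes "0 < count_prob K x0 n N"
  shows "achievable K (T ((1 / real (n + 1)) *\<^sub>R cvec N)) ((err n - ln (count_prob K x0 n N)) / real (n + 1))"
  using assms
proof (induction n arbitrary: N)
  case 0
  then have N: "N = (\<lambda>_. 0)(x0 := 1)" by (auto split: if_splits)
  have ek: "0 < \<epsilon> * \<kappa>" using \<epsilon> \<kappa> by simp
  have p: "cvec N \<in> prob_vectors" using cvec_prob[of N 1] by (simp add: N fun_upd_def)
  have r: "rent (T (cvec N)) (T (cvec N) v* K) \<le> ennreal (ln (1 / (\<epsilon> * \<kappa>)))" "0 \<le> ln (1 / (\<epsilon> * \<kappa>))"
    using rent_le_ln[OF T_prob[OF p] vec_kernel_prob[OF T_prob[OF p] K] ek T_kernel_ge[OF prob_vectorsD(1)[OF p]]]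
    by auto
  have "achievable K (T (cvec N)) (ln (1 / (\<epsilon> * \<kappa>)))" by (intro achievable_const T_prob p r)
  moreover have "count_prob K x0 0 N = 1" unfolding count_prob.simps N by (simp only: if_True simp_thms)
  ultimately show ?case by (simp add: err_def)
next
  case (Suc n)
  define D where "D y = N(y := N y - 1)" for y
  define q where "q y = (cvec (D y) v* K) $ y / real (n + 1)" for y
  define p where "p = count_prob K x0 (Suc n) N"
  \<comment> \<open>Only predecessors of positive weight are kept, so that the logarithms below have
    positive arguments.\<close>
  define Y where "Y = {y. 0 < N y \<and> 0 < count_prob K x0 n (D y) \<and> 0 < q y}"
  define \<eta> :: "real ^ 'd" where "\<eta> = (\<chi> y. if y \<in> Y then count_prob K x0 n (D y) * q y / p else 0)"
  have p0: "0 < p" using Suc.prems by (simp only: p_def)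
  have q_nn: "0 \<le> q y" for y unfolding q_def by (simp add: cvec_kernel_nonneg[OF K])
  have pY: "p = (\<Sum>y\<in>Y. count_prob K x0 n (D y) * q y)"
  proof -
    have "p = (\<Sum>y\<in>{y. 0 < N y}. count_prob K x0 n (D y) * q y)"
      unfolding p_def q_def D_def by (simp only: count_prob.simps)
    also have "\<dots> = (\<Sum>y\<in>Y. count_prob K x0 n (D y) * q y)"
    proof (rule sum.mono_neutral_right)
      show "\<forall>y\<in>{y. 0 < N y} - Y. count_prob K x0 n (D y) * q y = 0"
      proof
        fix y assume "y \<in> {y. 0 < N y} - Y"
        then have "\<not> (0 < count_prob K x0 n (D y) \<and> 0 < q y)" by (auto simp: Y_def)
        then show "count_prob K x0 n (D y) * q y = 0"
          using count_prob_nonneg[OF K, of x0 n "D y"] q_nn[of y] by (metis less_eq_real_def mult_eq_0_iff)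
      qed
    qed (simp_all add: Y_def subset_iff)
    finally show ?thesis .
  qed
  have \<eta>Y: "\<eta> $ y = count_prob K x0 n (D y) * q y / p" "0 < \<eta> $ y" if "y \<in> Y" for y
    using that p0 by (auto simp: \<eta>_def Y_def)
  have \<eta>0: "\<eta> $ y = 0" if "y \<notin> Y" for y using that by (simp add: \<eta>_def)
  have s\<eta>: "(\<Sum>y\<in>Y. \<eta> $ y) = 1"
    using p0 by (simp add: \<eta>Y pY flip: sum_divide_distrib cong: sum.cong)
  also have "(\<Sum>y\<in>Y. \<eta> $ y) = (\<Sum>y\<in>UNIV. \<eta> $ y)"
    by (rule sum.mono_neutral_left) (auto simp: \<eta>0)
  finally have \<eta>p: "\<eta> \<in> prob_vectors"
    using \<eta>Y(2) \<eta>0 by (auto simp: prob_vectors_def) (metis less_eq_real_def)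
  \<comment> \<open>The averaged empirical measure of the predecessors. Each predecessor is
    \<open>N\<close> less one letter, so \<open>w\<close> and \<eta> together recover
    \<open>N\<close>.\<close>
  define w where "w = (\<Sum>y\<in>Y. \<eta> $ y *\<^sub>R ((1 / real (n + 1)) *\<^sub>R cvec (D y)))"
  have wp: "w \<in> prob_vectors" unfolding w_def
  proof (rule convex_sum[OF _ prob_vectors_convex s\<eta>])
    fix y assume "y \<in> Y"
    then show "0 \<le> \<eta> $ y" "(1 / real (n + 1)) *\<^sub>R cvec (D y) \<in> prob_vectors"
      using \<eta>Y(2) count_prob_total[OF K, of x0 n "D y"] cvec_prob[of "D y" "n + 1"] by (auto simp: Y_def less_imp_le)
  qed simp
  have "cvec (D y) = cvec N - axis y 1" if "y \<in> Y" for y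
    using that by (auto simp: vec_eq_iff D_def Y_def axis_def of_nat_diff)
  then have "real (n + 1) *\<^sub>R w = (\<Sum>y\<in>Y. \<eta> $ y *\<^sub>R (cvec N - axis y 1))"
    by (simp add: w_def scaleR_sum_right cong: sum.cong)
  also have "\<dots> = cvec N - (\<Sum>y\<in>Y. \<eta> $ y *\<^sub>R axis y 1)"
    by (simp add: scaleR_right_diff_distrib sum_subtractf s\<eta> flip: scaleR_left.sum)
  also have "(\<Sum>y\<in>Y. \<eta> $ y *\<^sub>R axis y 1) = \<eta>"
    using \<eta>0 by (auto simp: vec_eq_iff axis_def if_distrib cong: if_cong)
  finally have Nw: "cvec N = \<eta> + real (n + 1) *\<^sub>R w" by simp
  define cc where "cc y = (err n - ln (count_prob K x0 n (D y))) / real (n + 1)" for y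
  have "achievable K (\<Sum>y\<in>Y. \<eta> $ y *\<^sub>R T ((1 / real (n + 1)) *\<^sub>R cvec (D y))) (\<Sum>y\<in>Y. \<eta> $ y * cc y)"
    unfolding cc_def using \<eta>Y(2) Suc.IH
    by (intro achievable_convex_sum K s\<eta>) (auto simp: Y_def less_imp_le)
  also have "(\<Sum>y\<in>Y. \<eta> $ y *\<^sub>R T ((1 / real (n + 1)) *\<^sub>R cvec (D y))) = T w"
    unfolding T_def w_def scaleR_right_distrib sum.distrib scaleR_left.sum[symmetric]
    by (simp add: scaleR_sum_right s\<eta> mult.commute mult.left_commute flip: scaleR_left.sum)
  finally have A: "achievable K (T w) (\<Sum>y\<in>Y. \<eta> $ y * cc y)" .
  \<comment> \<open>The gap in Gibbs' formula: the \<eta>-average of minus the logarithm of the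
    predecessors' probabilities is \<open>- ln p - W\<close>. The same \<open>W\<close> enters
    \<open>B\<close>, and with equal weights the two cancel.\<close>
  define W where "W = (\<Sum>y\<in>Y. \<eta> $ y * ln (\<eta> $ y / q y))"
  define B where "B = W + 1 / (\<epsilon> * \<kappa> * real (n + 2)) + ln (real (n + 2) / real (n + 1)) + rate_err"
  \<comment> \<open>This duration gives the old samples the weight \<open>(n + 1) / (n + 2)\<close>
    and the new letter the weight \<open>1 / (n + 2)\<close>.\<close>
  define h where "h = ln (real (n + 2) / real (n + 1))"
  have h: "0 \<le> h" "exp (- h) = real (n + 1) / real (n + 2)"
    by (simp_all add: h_def ln_div exp_minus exp_diff)
  have qN: "q y \<le> (cvec N v* K) $ y / real (n + 1)" for y
    unfolding q_def vec_kernel_nth using kernelD[OF K]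
    by (intro divide_right_mono sum_mono mult_right_mono) (auto simp: D_def)
  have \<eta>Y': "y \<in> Y" if "\<eta> $ y \<noteq> 0" for y using \<eta>0 that by blast
  have qY: "0 < q y" if "y \<in> Y" for y using that by (simp add: Y_def)
  note sb = count_prob_step_bound[OF \<eta>p wp Nw \<eta>Y' qY qN, folded W_def, folded B_def]
  have B0: "0 \<le> B" by (rule sb(2)[of 1]) auto
  have "achievable K ((1 - exp (- h)) *\<^sub>R T \<eta> + exp (- h) *\<^sub>R T w) (exp (- h) * (\<Sum>y\<in>Y. \<eta> $ y * cc y) + (1 - exp (- h)) * B)"
    by (intro achievable_append K A T_prob \<eta>p h B0 sb(1)) (auto simp: h(2))
  also have "(1 - exp (- h)) *\<^sub>R T \<eta> + exp (- h) *\<^sub>R T w = T ((1 - exp (- h)) *\<^sub>R \<eta> + exp (- h) *\<^sub>R w)"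
    by (subst T_affine) auto
  also have "(1 - exp (- h)) *\<^sub>R \<eta> + exp (- h) *\<^sub>R w = (1 / real (Suc n + 1)) *\<^sub>R cvec N"
  proof -
    have "1 - real (n + 1) / real (n + 2) = 1 / real (n + 2)" by (simp add: field_simps)
    then show ?thesis unfolding Nw h(2) by (simp add: scaleR_add_right)
  qed
  finally have A2: "achievable K (T ((1 / real (Suc n + 1)) *\<^sub>R cvec N)) (exp (- h) * (\<Sum>y\<in>Y. \<eta> $ y * cc y) + (1 - exp (- h)) * B)" .
  have "(\<Sum>y\<in>Y. \<eta> $ y * cc y) = (\<Sum>y\<in>Y. (\<eta> $ y * err n - \<eta> $ y * ln p - \<eta> $ y * ln (\<eta> $ y / q y)) / real (n + 1))"
  proof (rule sum.cong[OF refl])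
    fix y assume y: "y \<in> Y"
    then have pos: "0 < count_prob K x0 n (D y)" "0 < q y" by (auto simp: Y_def)
    have "ln (\<eta> $ y / q y) = ln (count_prob K x0 n (D y)) - ln p"
      using pos p0 by (simp add: \<eta>Y[OF y] ln_div)
    then have "ln (count_prob K x0 n (D y)) = ln p + ln (\<eta> $ y / q y)" by simp
    then show "\<eta> $ y * cc y = (\<eta> $ y * err n - \<eta> $ y * ln p - \<eta> $ y * ln (\<eta> $ y / q y)) / real (n + 1)"
      unfolding cc_def by (simp only:) (simp add: algebra_simps)
  qed
  also have "\<dots> = (err n - ln p - W) / real (n + 1)"
    by (simp add: W_def sum_subtractf s\<eta> flip: sum_divide_distrib sum_distrib_right)
  finally have S: "(\<Sum>y\<in>Y. \<eta> $ y * cc y) = (err n - ln p - W) / real (n + 1)" .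
  have "1 - exp (- h) = 1 / real (n + 2)" unfolding h(2) by (simp add: field_simps)
  then have "exp (- h) * (\<Sum>y\<in>Y. \<eta> $ y * cc y) + (1 - exp (- h)) * B = (err n - ln p - W + B) / real (n + 2)"
    unfolding S h(2) by (simp flip: add_divide_distrib)
  also have "\<dots> \<le> (err (Suc n) - ln p) / real (n + 2)"
  proof (rule divide_right_mono)
    \<comment> \<open>\<open>L\<close> is the increment of the logarithm in \<open>err\<close>; it
      dominates \<open>1 / (n + 2)\<close>, so the last term of \<open>err\<close> absorbs the
      errors of this step.\<close>
    define L where "L = ln (real (n + 2) / real (n + 1))"
    have "1 / real (n + 2) \<le> L" unfolding L_def using ln_Suc_diff_ge[of "real (n + 1)"] by (simp add: add.commute)
    then have "1 / (\<epsilon> * \<kappa>) * (1 / real (n + 2)) \<le> 1 / (\<epsilon> * \<kappa>) * L" using \<epsilon> \<kappa> by (intro mult_left_mono) auto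
    moreover have "ln (real (Suc n + 1)) = L + ln (real (n + 1))" by (simp add: L_def ln_div)
    then have "err (Suc n) = err n + rate_err + (1 / (\<epsilon> * \<kappa>) + 1) * L"
      unfolding err_def by (simp only:) (simp add: algebra_simps)
    ultimately show "err n - ln p - W + B \<le> err (Suc n) - ln p"
      unfolding B_def L_def[symmetric] by (simp add: algebra_simps)
  qed simp
  finally show ?case using achievable_mono[OF A2] unfolding p_def by simp
qed

end

subsection \<open>The law of the empirical measure\<close>

definition cnts :: "(nat \<Rightarrow> 'd) \<Rightarrow> nat \<Rightarrow> 'd \<Rightarrow> nat" where
  "cnts x n y = card {i. i < n \<and> x i = y}"

lemma cnts_Suc: "cnts x (Suc n) = (cnts x n)(x n := cnts x n (x n) + 1)"
proof
  fix y
  have "{i. i < Suc n \<and> x i = y} = (if x n = y then insert n {i. i < n \<and> x i = y} else {i. i < n \<and> x i = y})"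
    by (auto simp: less_Suc_eq)
  then show "cnts x (Suc n) y = ((cnts x n)(x n := cnts x n (x n) + 1)) y"
    by (auto simp: cnts_def)
qed

lemma cnts_0[simp]: "cnts x 0 = (\<lambda>_. 0)"
  by (simp add: cnts_def fun_eq_iff)

lemma cnts_total: "(\<Sum>y\<in>(UNIV :: 'd::finite set). cnts x n y) = n"
proof (induction n)
  case (Suc n)
  have "(\<Sum>y\<in>UNIV. cnts x (Suc n) y) = (\<Sum>y\<in>UNIV. cnts x n y + (if y = x n then 1 else 0))"
    unfolding cnts_Suc by (intro sum.cong) auto
  then show ?case by (simp add: sum.distrib Suc)
qed simp

lemma cnts_le: "cnts x n y \<le> n"
  using card_mono[of "{..<n}" "{i. i < n \<and> x i = y}"] by (auto simp: cnts_def)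

lemma cnts_cong: "(\<And>i. i < n \<Longrightarrow> x i = x' i) \<Longrightarrow> cnts x n = cnts x' n"
  by (auto simp: cnts_def fun_eq_iff intro!: arg_cong[where f=card])

lemma empirical_measure_cnts: "empirical_measure x n = (1 / real n) *\<^sub>R cvec (cnts x n)"
proof -
  have "(\<Sum>i<n. axis (x i) 1) = cvec (cnts x n)"
    by (induction n) (auto simp: cnts_Suc vec_eq_iff axis_def)
  then show ?thesis by (simp add: empirical_measure_def)
qed

context
  fixes K :: "real ^ 'd::finite ^ 'd" and G :: "real ^ 'd \<Rightarrow> real ^ 'd ^ 'd"
    and P :: "'w measure" and X :: "nat \<Rightarrow> 'w \<Rightarrow> 'd" and x0 :: 'd
  assumes G: "\<And>m x y. m \<in> prob_vectors \<Longrightarrow> G m $ x $ y = (m v* K) $ y"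
    and chain: "self_interacting_chain P G x0 X"
begin

interpretation P: prob_space P
  using chain by (simp add: self_interacting_chain_def)

lemma X_measurable[measurable]: "X n \<in> measurable P (count_space UNIV)"
  using chain by (simp add: self_interacting_chain_def)

lemma cnts_measurable[measurable]: "(\<lambda>\<omega>. cnts (\<lambda>i. X i \<omega>) n) \<in> measurable P (count_space UNIV)"
proof (induction n)
  case (Suc n)
  have "(\<lambda>\<omega>. (cnts (\<lambda>i. X i \<omega>) n)(y := cnts (\<lambda>i. X i \<omega>) n y + 1)) \<in> measurable P (count_space UNIV)" for y
    by (rule measurable_compose[OF Suc]) simp
  note measurable_compose_countable[where f="\<lambda>y \<omega>. (cnts (\<lambda>i. X i \<omega>) n)(y := cnts (\<lambda>i. X i \<omega>) n y + 1)", OF this X_measurable[of n]]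
  then show ?case by (simp only: cnts_Suc)
qed simp

text \<open>The product form also covers paths of probability 0, for which the conditional
  probabilities prescribe nothing.\<close>

lemma path_step:
  "\<P>(\<omega> in P. (\<forall>i\<le>n. X i \<omega> = \<pi> i) \<and> X (Suc n) \<omega> = y) =
    \<P>(\<omega> in P. \<forall>i\<le>n. X i \<omega> = \<pi> i) * ((cvec (cnts \<pi> (Suc n)) v* K) $ y / real (n + 1))"
proof -
  let ?p = "\<P>(\<omega> in P. \<forall>i\<le>n. X i \<omega> = \<pi> i)"
  let ?j = "\<P>(\<omega> in P. (\<forall>i\<le>n. X i \<omega> = \<pi> i) \<and> X (Suc n) \<omega> = y)"
  have le: "?j \<le> ?p" by (intro P.finite_measure_mono) auto
  have em: "empirical_measure \<pi> (Suc n) \<in> prob_vectors"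
    unfolding empirical_measure_cnts by (intro cvec_prob cnts_total) simp
  show ?thesis
  proof (cases "0 < ?p")
    case True
    then have "\<P>(\<omega> in P. X (Suc n) \<omega> = y \<bar> \<forall>i\<le>n. X i \<omega> = \<pi> i) = G (empirical_measure \<pi> (Suc n)) $ \<pi> n $ y"
      using chain unfolding self_interacting_chain_def by blast
    also have "\<dots> = (cvec (cnts \<pi> (Suc n)) v* K) $ y / real (n + 1)"
      unfolding G[OF em] unfolding empirical_measure_cnts by (simp add: vec_kernel_nth sum_divide_distrib)
    also have "\<P>(\<omega> in P. X (Suc n) \<omega> = y \<bar> \<forall>i\<le>n. X i \<omega> = \<pi> i) = ?j / ?p"
      unfolding cond_prob_def by (rule arg_cong2[where f="(/)"]) (rule arg_cong[where f="measure P"], blast, rule refl)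
    finally have E: "?j / ?p = (cvec (cnts \<pi> (Suc n)) v* K) $ y / real (n + 1)" .
    have "a = b * c" if "0 < b" "a / b = c" for a b c :: real using that by (auto simp: field_simps)
    from this[OF True E] show ?thesis .
  next
    case False
    have "a = b * c" if "\<not> 0 < b" "0 \<le> a" "a \<le> b" for a b c :: real
    proof -
      from that have "a = 0" "b = 0" by linarith+
      then show ?thesis by simp
    qed
    from this[OF False measure_nonneg le] show ?thesis .
  qed
qed

text \<open>The transition factor of a path depends on its counts alone and can be pulled out of the
  sum over all paths with these counts.\<close>

lemma count_step:
  "\<P>(\<omega> in P. cnts (\<lambda>i. X i \<omega>) (Suc n) = N \<and> X (Suc n) \<omega> = y) =
    \<P>(\<omega> in P. cnts (\<lambda>i. X i \<omega>) (Suc n) = N) * ((cvec N v* K) $ y / real (n + 1))"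
proof -
  \<comment> \<open>Extensional functions represent every path of \<open>n + 1\<close> states
    exactly once, so the set is finite.\<close>
  define V where "V = {\<pi> \<in> {..n} \<rightarrow>\<^sub>E (UNIV :: 'd set). cnts \<pi> (Suc n) = N}"
  have fin: "finite V" unfolding V_def by (rule finite_subset[OF _ finite_PiE[of "{..n}" "\<lambda>_. UNIV"]]) auto
  have ex1: "\<exists>!\<pi>\<in>V. \<forall>i\<le>n. X i \<omega> = \<pi> i" if "cnts (\<lambda>i. X i \<omega>) (Suc n) = N" for \<omega>
  proof (rule ex1I)
    have "cnts (restrict (\<lambda>i. X i \<omega>) {..n}) (Suc n) = N"
      using that by (subst cnts_cong[of "Suc n" _ "\<lambda>i. X i \<omega>"]) auto
    then show "restrict (\<lambda>i. X i \<omega>) {..n} \<in> V \<and> (\<forall>i\<le>n. X i \<omega> = restrict (\<lambda>i. X i \<omega>) {..n} i)"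
      by (auto simp: V_def)
    fix \<pi> assume "\<pi> \<in> V \<and> (\<forall>i\<le>n. X i \<omega> = \<pi> i)"
    then show "\<pi> = restrict (\<lambda>i. X i \<omega>) {..n}"
      by (auto simp: V_def fun_eq_iff PiE_def extensional_def)
  qed
  have cV: "cnts (\<lambda>i. X i \<omega>) (Suc n) = N" if "\<pi> \<in> V" "\<forall>i\<le>n. X i \<omega> = \<pi> i" for \<omega> \<pi>
    using that cnts_cong[of "Suc n" "\<lambda>i. X i \<omega>" \<pi>] by (auto simp: V_def)
  have "\<P>(\<omega> in P. cnts (\<lambda>i. X i \<omega>) (Suc n) = N \<and> X (Suc n) \<omega> = y) =
      (\<Sum>\<pi>\<in>V. \<P>(\<omega> in P. (\<forall>i\<le>n. X i \<omega> = \<pi> i) \<and> X (Suc n) \<omega> = y))"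
  proof (rule P.prob_sum[OF fin])
    show "AE \<omega> in P. (\<forall>\<pi>\<in>V. (\<forall>i\<le>n. X i \<omega> = \<pi> i) \<and> X (Suc n) \<omega> = y \<longrightarrow>
          cnts (\<lambda>i. X i \<omega>) (Suc n) = N \<and> X (Suc n) \<omega> = y) \<and>
        (cnts (\<lambda>i. X i \<omega>) (Suc n) = N \<and> X (Suc n) \<omega> = y \<longrightarrow>
          (\<exists>!\<pi>\<in>V. (\<forall>i\<le>n. X i \<omega> = \<pi> i) \<and> X (Suc n) \<omega> = y))"
    proof (rule AE_I2, rule conjI)
      fix \<omega>
      show "\<forall>\<pi>\<in>V. (\<forall>i\<le>n. X i \<omega> = \<pi> i) \<and> X (Suc n) \<omega> = y \<longrightarrow>
          cnts (\<lambda>i. X i \<omega>) (Suc n) = N \<and> X (Suc n) \<omega> = y" using cV by blast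
      show "cnts (\<lambda>i. X i \<omega>) (Suc n) = N \<and> X (Suc n) \<omega> = y \<longrightarrow>
          (\<exists>!\<pi>\<in>V. (\<forall>i\<le>n. X i \<omega> = \<pi> i) \<and> X (Suc n) \<omega> = y)"
      proof
        assume a: "cnts (\<lambda>i. X i \<omega>) (Suc n) = N \<and> X (Suc n) \<omega> = y"
        then have "X (Suc n) \<omega> = y" by blast
        then show "\<exists>!\<pi>\<in>V. (\<forall>i\<le>n. X i \<omega> = \<pi> i) \<and> X (Suc n) \<omega> = y"
          using ex1[OF conjunct1[OF a]] by (simp only: simp_thms)
      qed
    qed
  qed measurable
  also have "\<dots> = (\<Sum>\<pi>\<in>V. \<P>(\<omega> in P. \<forall>i\<le>n. X i \<omega> = \<pi> i)) * ((cvec N v* K) $ y / real (n + 1))"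
    unfolding path_step sum_distrib_right by (intro sum.cong) (auto simp: V_def)
  also have "(\<Sum>\<pi>\<in>V. \<P>(\<omega> in P. \<forall>i\<le>n. X i \<omega> = \<pi> i)) = \<P>(\<omega> in P. cnts (\<lambda>i. X i \<omega>) (Suc n) = N)"
  proof (rule P.prob_sum[OF fin, symmetric])
    show "AE \<omega> in P. (\<forall>\<pi>\<in>V. (\<forall>i\<le>n. X i \<omega> = \<pi> i) \<longrightarrow> cnts (\<lambda>i. X i \<omega>) (Suc n) = N) \<and>
        (cnts (\<lambda>i. X i \<omega>) (Suc n) = N \<longrightarrow> (\<exists>!\<pi>\<in>V. \<forall>i\<le>n. X i \<omega> = \<pi> i))"
      by (rule AE_I2) (rule conjI[OF ballI[OF impI[OF cV]] impI[OF ex1]])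
  qed measurable
  finally show ?thesis .
qed

lemma prob_cnts: "\<P>(\<omega> in P. cnts (\<lambda>i. X i \<omega>) (Suc n) = N) = count_prob K x0 n N"
proof (induction n arbitrary: N)
  case 0
  have AE0: "AE \<omega> in P. X 0 \<omega> = x0" using chain by (simp add: self_interacting_chain_def)
  show ?case
  proof (cases "N = (\<lambda>_. 0)(x0 := 1)")
    case True
    have "AE \<omega> in P. cnts (\<lambda>i. X i \<omega>) (Suc 0) = N"
      using AE0 by eventually_elim (simp add: cnts_Suc True)
    then have "\<P>(\<omega> in P. cnts (\<lambda>i. X i \<omega>) (Suc 0) = N) = 1" by (simp add: P.prob_eq_1)
    moreover have "count_prob K x0 0 N = 1" unfolding count_prob.simps True by (simp only: if_True simp_thms)
    ultimately show ?thesis by simp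
  next
    case False
    have "AE \<omega> in P. \<not> cnts (\<lambda>i. X i \<omega>) (Suc 0) = N"
      using AE0 by eventually_elim (use False in \<open>auto simp: cnts_Suc\<close>)
    then show ?thesis using False by (simp add: P.prob_eq_0)
  qed
next
  case (Suc n)
  \<comment> \<open>The condition \<open>0 < N y\<close> makes the subtraction on natural numbers
    invertible.\<close>
  have iff: "cnts (\<lambda>i. X i \<omega>) (Suc (Suc n)) = N \<and> X (Suc n) \<omega> = y \<longleftrightarrow>
      0 < N y \<and> cnts (\<lambda>i. X i \<omega>) (Suc n) = N(y := N y - 1) \<and> X (Suc n) \<omega> = y" for \<omega> y
    unfolding cnts_Suc[of _ "Suc n"] by (auto simp: fun_eq_iff)
  have "\<P>(\<omega> in P. cnts (\<lambda>i. X i \<omega>) (Suc (Suc n)) = N) =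
      (\<Sum>y\<in>UNIV. \<P>(\<omega> in P. cnts (\<lambda>i. X i \<omega>) (Suc (Suc n)) = N \<and> X (Suc n) \<omega> = y))"
  proof (rule P.prob_sum)
    show "AE \<omega> in P. (\<forall>y\<in>UNIV. cnts (\<lambda>i. X i \<omega>) (Suc (Suc n)) = N \<and> X (Suc n) \<omega> = y \<longrightarrow>
          cnts (\<lambda>i. X i \<omega>) (Suc (Suc n)) = N) \<and>
        (cnts (\<lambda>i. X i \<omega>) (Suc (Suc n)) = N \<longrightarrow>
          (\<exists>!y\<in>UNIV. cnts (\<lambda>i. X i \<omega>) (Suc (Suc n)) = N \<and> X (Suc n) \<omega> = y))"
      by (rule AE_I2) blast
  qed (simp, measurable)
  also have "\<dots> = (\<Sum>y\<in>{y. 0 < N y}. \<P>(\<omega> in P. cnts (\<lambda>i. X i \<omega>) (Suc n) = N(y := N y - 1) \<and> X (Suc n) \<omega> = y))"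
    unfolding iff by (intro sum.mono_neutral_cong_right) auto
  also have "\<dots> = count_prob K x0 (Suc n) N"
    unfolding count_step Suc.IH count_prob.simps ..
  finally show ?case .
qed

end

definition grid :: "nat \<Rightarrow> ('d::finite \<Rightarrow> nat) set" where
  "grid n = (UNIV \<rightarrow>\<^sub>E {..n + 1})"

text \<open>The law of the empirical measure in terms of \<open>count_prob\<close> alone; from here
  on the probability space disappears from the estimates.\<close>

definition emp_prob :: "real ^ 'd ^ 'd \<Rightarrow> 'd \<Rightarrow> nat \<Rightarrow> (real ^ 'd::finite) set \<Rightarrow> real" where
  "emp_prob K x0 n A = (\<Sum>N\<in>{N \<in> grid n. (1 / real (n + 1)) *\<^sub>R cvec N \<in> A}. count_prob K x0 n N)"

lemma finite_grid: "finite (grid n)" "card (grid n :: ('d::finite \<Rightarrow> nat) set) = (n + 2) ^ CARD('d)"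
  by (auto simp: grid_def card_PiE intro!: finite_PiE)

lemma in_grid: "N \<in> grid n \<longleftrightarrow> (\<forall>y. N y \<le> n + 1)"
  by (auto simp: grid_def PiE_def Pi_def)

lemma prob_empirical_measure:
  assumes "\<And>m x y. m \<in> prob_vectors \<Longrightarrow> G m $ x $ y = (m v* K) $ y"
    and chain: "self_interacting_chain P G x0 X"
  shows "\<P>(\<omega> in P. empirical_measure (\<lambda>i. X i \<omega>) (n + 1) \<in> A) = emp_prob K x0 n A"
proof -
  interpret P: prob_space P using chain by (simp add: self_interacting_chain_def)
  note [measurable] = cnts_measurable[OF assms]
  have "\<P>(\<omega> in P. empirical_measure (\<lambda>i. X i \<omega>) (n + 1) \<in> A) =
      \<P>(\<omega> in P. (1 / real (Suc n)) *\<^sub>R cvec (cnts (\<lambda>i. X i \<omega>) (Suc n)) \<in> A)"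
    by (simp add: empirical_measure_cnts)
  also have "\<dots> = (\<Sum>N\<in>{N \<in> grid n. (1 / real (n + 1)) *\<^sub>R cvec N \<in> A}. \<P>(\<omega> in P. cnts (\<lambda>i. X i \<omega>) (Suc n) = N))"
  proof (rule P.prob_sum)
    show "{\<omega> \<in> space P. (1 / real (Suc n)) *\<^sub>R cvec (cnts (\<lambda>i. X i \<omega>) (Suc n)) \<in> A} \<in> P.events"
      using measurable_sets[OF cnts_measurable[OF assms], of "{N. (1 / real (Suc n)) *\<^sub>R cvec N \<in> A}" "Suc n"]
      by (simp add: vimage_def Int_def conj_commute)
    show "AE \<omega> in P. (\<forall>N\<in>{N \<in> grid n. (1 / real (n + 1)) *\<^sub>R cvec N \<in> A}. cnts (\<lambda>i. X i \<omega>) (Suc n) = N \<longrightarrow>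
          (1 / real (Suc n)) *\<^sub>R cvec (cnts (\<lambda>i. X i \<omega>) (Suc n)) \<in> A) \<and>
        ((1 / real (Suc n)) *\<^sub>R cvec (cnts (\<lambda>i. X i \<omega>) (Suc n)) \<in> A \<longrightarrow>
          (\<exists>!N\<in>{N \<in> grid n. (1 / real (n + 1)) *\<^sub>R cvec N \<in> A}. cnts (\<lambda>i. X i \<omega>) (Suc n) = N))"
      by (rule AE_I2) (auto simp: in_grid cnts_le)
  qed (auto simp: finite_grid intro!: finite_subset[OF _ finite_grid(1)[of n]])
  also have "\<dots> = emp_prob K x0 n A"
    unfolding emp_prob_def by (simp only: prob_cnts[OF assms])
  finally show ?thesis .
qed

subsection \<open>The upper bound\<close>

text \<open>Some single count vector carries the probability up to a polynomial factor, and
  \<open>count_prob_achievable\<close> turns it into a control whose endpoint \<open>T m\<close> is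
  close to \<open>m\<close>.\<close>

lemma upper_achievable:
  assumes K: "K \<in> transition_kernels" and \<rho>: "\<rho> \<in> prob_vectors"
    and \<kappa>: "0 < \<kappa>" "\<And>y. \<kappa> \<le> (\<rho> v* K) $ y"
    and freq: "\<exists>\<^sub>F n in sequentially. exp (- b * real n) < emp_prob K x0 n F"
    and F: "F \<subseteq> prob_vectors" and \<delta>: "0 < \<delta>"
  shows "\<exists>m\<in>F. \<exists>m' c'. achievable K m' c' \<and> dist m' m \<le> \<delta> \<and> c' \<le> b + \<delta>"
proof -
  \<comment> \<open>The error rate vanishes with \<epsilon>. It is fixed before \<open>n\<close>,
    because other coefficients of \<open>err\<close> blow up as \<epsilon> tends to 0.\<close>
  have "((\<lambda>\<epsilon>. ln (1 / (1 - \<epsilon>)) + \<epsilon> * ln (1 / (\<epsilon> * \<kappa>))) \<longlongrightarrow> 0) (at_right 0)"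
    using \<kappa>(1) by real_asymp
  then have "\<forall>\<^sub>F \<epsilon> in at_right 0. ln (1 / (1 - \<epsilon>)) + \<epsilon> * ln (1 / (\<epsilon> * \<kappa>)) < \<delta> / 2"
    using \<delta> by (intro order_tendstoD) auto
  moreover have "\<forall>\<^sub>F \<epsilon> in at_right 0. \<epsilon> \<in> {0<..<min 1 (\<delta> / 2)}"
    using \<delta> by (intro eventually_at_right_real) auto
  ultimately have "\<forall>\<^sub>F \<epsilon> in at_right 0. ln (1 / (1 - \<epsilon>)) + \<epsilon> * ln (1 / (\<epsilon> * \<kappa>)) < \<delta> / 2 \<and> \<epsilon> \<in> {0<..<min 1 (\<delta> / 2)}"
    by eventually_elim auto
  then obtain \<epsilon> where eps: "0 < \<epsilon>" "\<epsilon> < 1" "\<epsilon> < \<delta> / 2" and re: "ln (1 / (1 - \<epsilon>)) + \<epsilon> * ln (1 / (\<epsilon> * \<kappa>)) < \<delta> / 2"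
    using eventually_happens'[OF trivial_limit_at_right_real] by auto
  interpret regularised_kernel K \<rho> \<kappa> \<epsilon> by unfold_locales (fact K \<rho> \<kappa> eps)+
  define D where "D = CARD('a)"
  have "(\<lambda>n. (ln (1 / (\<epsilon> * \<kappa>)) + real n * rate_err + (1 / (\<epsilon> * \<kappa>) + 1) * ln (real (n + 1)) + b * real n + real D * ln (real (n + 2))) / real (n + 1))
      \<longlonglongrightarrow> rate_err + b"
    by real_asymp
  moreover have "rate_err + b < b + \<delta>" using re \<delta> by (simp add: rate_err_def)
  ultimately have "\<forall>\<^sub>F n in sequentially. (err n + b * real n + real D * ln (real (n + 2))) / real (n + 1) < b + \<delta>"
    unfolding err_def by (intro order_tendstoD)
  then obtain n where n: "exp (- b * real n) < emp_prob K x0 n F"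
    "(err n + b * real n + real D * ln (real (n + 2))) / real (n + 1) < b + \<delta>"
    using frequently_eventually_frequently[OF freq] by (metis (mono_tags, lifting) frequently_ex)
  define S where "S = {N \<in> grid n. (1 / real (n + 1)) *\<^sub>R cvec N \<in> F}"
  have fS: "finite S" unfolding S_def by (rule finite_subset[OF _ finite_grid(1)]) auto
  have cS: "card S \<le> (n + 2) ^ D" unfolding S_def D_def finite_grid(2)[symmetric]
    by (intro card_mono finite_grid) auto
  \<comment> \<open>Pigeonhole over at most \<open>(n + 2) ^ D\<close> count vectors.\<close>
  have "\<exists>N\<in>S. exp (- b * real n) / real ((n + 2) ^ D) \<le> count_prob K x0 n N"
  proof (rule ccontr)
    assume "\<not> ?thesis"
    then have "(\<Sum>N\<in>S. count_prob K x0 n N) \<le> (\<Sum>N\<in>S. exp (- b * real n) / real ((n + 2) ^ D))"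
      by (intro sum_mono) force
    also have "\<dots> = real (card S) * (exp (- b * real n) / real ((n + 2) ^ D))" by simp
    also have "\<dots> \<le> real ((n + 2) ^ D) * (exp (- b * real n) / real ((n + 2) ^ D))"
      using cS by (intro mult_right_mono of_nat_mono) auto
    also have "\<dots> = exp (- b * real n)" by simp
    finally show False using n(1) unfolding emp_prob_def S_def by simp
  qed
  then obtain N where N: "N \<in> S" "exp (- b * real n) / real ((n + 2) ^ D) \<le> count_prob K x0 n N" by blast
  define m where "m = (1 / real (n + 1)) *\<^sub>R cvec N"
  have mF: "m \<in> F" using N(1) by (simp add: S_def m_def)
  have pos: "0 < count_prob K x0 n N" using N(2) by (rule less_le_trans[rotated]) simp
  have "ln (exp (- b * real n) / real ((n + 2) ^ D)) \<le> ln (count_prob K x0 n N)"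
    using N(2) pos by (subst ln_le_cancel_iff) auto
  moreover have "ln (exp (- b * real n) / real ((n + 2) ^ D)) = - b * real n - real D * ln (real (n + 2))"
    by (subst ln_divide_pos) (auto simp: ln_realpow simp del: of_nat_add)
  ultimately have "(err n - ln (count_prob K x0 n N)) / real (n + 1) \<le> (err n + b * real n + real D * ln (real (n + 2))) / real (n + 1)"
    by (intro divide_right_mono) auto
  with n(2) have "(err n - ln (count_prob K x0 n N)) / real (n + 1) \<le> b + \<delta>" by linarith
  moreover have "dist (T m) m \<le> \<delta>"
  proof -
    have "T m - m = \<epsilon> *\<^sub>R (\<rho> - m)" by (simp add: T_def vec_eq_iff algebra_simps)
    then have "dist (T m) m = \<epsilon> * norm (\<rho> - m)" using \<epsilon> by (simp add: dist_norm)
    also have "\<dots> \<le> \<epsilon> * 2"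
      using norm_triangle_ineq4[of \<rho> m] norm_prob_le1[OF \<rho>] norm_prob_le1[of m] F mF \<epsilon>
      by (intro mult_left_mono) auto
    finally show ?thesis using eps by simp
  qed
  ultimately show ?thesis using count_prob_achievable[OF pos] mF unfolding m_def by blast
qed

text \<open>If the estimate failed infinitely often, there would be approximately achievable points
  near \<open>F\<close>; compactness of \<open>F\<close> and \<open>achievable_closed\<close> would
  produce a point of \<open>F\<close> achievable at cost \<open>b\<close>.\<close>

lemma upper_bound:
  assumes K: "K \<in> transition_kernels" and \<rho>: "\<rho> \<in> prob_vectors"
    and \<kappa>: "0 < \<kappa>" "\<And>y. \<kappa> \<le> (\<rho> v* K) $ y"
    and F: "closed F" "F \<subseteq> prob_vectors" and no: "\<And>m. m \<in> F \<Longrightarrow> \<not> achievable K m b"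
  shows "\<forall>\<^sub>F n in sequentially. emp_prob K x0 n F \<le> exp (- b * real n)"
proof (rule ccontr)
  assume "\<not> ?thesis"
  then have freq: "\<exists>\<^sub>F n in sequentially. exp (- b * real n) < emp_prob K x0 n F"
    by (simp add: frequently_def not_less)
  have "\<exists>m\<in>F. \<exists>m' c'. achievable K m' c' \<and> dist m' m \<le> 1 / real (Suc k) \<and> c' \<le> b + 1 / real (Suc k)" for k
    by (rule upper_achievable[OF K \<rho> \<kappa> freq F(2)]) simp
  then obtain m m' c' where m: "\<And>k. m k \<in> F" and achievable: "\<And>k. achievable K (m' k) (c' k)"
    and d: "\<And>k. dist (m' k) (m k) \<le> 1 / real (Suc k)" and c': "\<And>k. c' k \<le> b + 1 / real (Suc k)"
    by metis
  have "compact F" using F compact_prob_vectors by (metis closed_Int_compact inf.absorb_iff1)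
  then obtain l r where l: "l \<in> F" "strict_mono r" "(m \<circ> r) \<longlonglongrightarrow> l"
    using m unfolding compact_def by blast
  have small: "\<forall>\<^sub>F k in sequentially. 1 / real (Suc k) < e" if "0 < e" for e :: real
    using LIMSEQ_inverse_real_of_nat that by (auto simp: inverse_eq_divide dest!: order_tendstoD(2)[of _ _ _ e])
  have smallr: "\<forall>\<^sub>F k in sequentially. 1 / real (Suc (r k)) < e" if "0 < e" for e :: real
    using eventually_subseq[OF l(2) small[OF that]] .
  \<comment> \<open>Costs are nonnegative, so a negative \<open>b\<close> already contradicts the
    approximations.\<close>
  have b0: "0 \<le> b"
  proof (rule ccontr)
    assume "\<not> 0 \<le> b"
    with small[of "- b"] obtain k where "1 / real (Suc k) < - b" by (auto dest!: eventually_happens)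
    with c'[of k] achievable[of k] show False by (simp add: achievable_def)
  qed
  have "achievable K l b"
  proof (rule achievable_closed[OF K b0])
    fix e :: real assume e: "0 < e"
    have "\<forall>\<^sub>F k in sequentially. dist ((m \<circ> r) k) l < e / 2" using e by (intro tendstoD[OF l(3)]) simp
    with smallr[of "e / 2"] e have "\<forall>\<^sub>F k in sequentially. dist ((m \<circ> r) k) l < e / 2 \<and> 1 / real (Suc (r k)) < e / 2"
      by (auto elim: eventually_elim2)
    then obtain k where k: "dist (m (r k)) l < e / 2" "1 / real (Suc (r k)) < e / 2"
      by (auto dest!: eventually_happens)
    have "dist (m' (r k)) l \<le> e" using dist_triangle[of "m' (r k)" l "m (r k)"] d[of "r k"] k by linarith
    moreover have "c' (r k) \<le> b + e" using c'[of "r k"] k e by linarith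
    ultimately show "\<exists>m' c'. achievable K m' c' \<and> dist m' l \<le> e \<and> c' \<le> b + e" using achievable by blast
  qed
  with no[OF l(1)] show False by blast
qed

subsection \<open>Lower bounds for the empirical measure\<close>

text \<open>The exponent carries \<open>n\<close>, although \<open>emp_prob K x0 n\<close> refers to \<open>n + 1\<close> samples, as in
  \<open>satisfies_LDP\<close>.\<close>

definition lower_rate :: "real ^ 'd ^ 'd \<Rightarrow> 'd \<Rightarrow> real ^ 'd::finite \<Rightarrow> real \<Rightarrow> bool" where
  "lower_rate K x0 m c \<longleftrightarrow> (\<forall>r>0. \<forall>\<^sub>F n in sequentially. exp (- (c + r) * real n) \<le> emp_prob K x0 n (ball m r))"

text \<open>Inclusion on the simplex suffices because \<open>count_prob\<close> vanishes on counts
  of the wrong total; thus balls can be compared with relatively open sets.\<close>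

lemma emp_prob_mono:
  assumes K: "K \<in> transition_kernels" and sub: "A \<inter> prob_vectors \<subseteq> B"
  shows "emp_prob K x0 n A \<le> emp_prob K x0 n B"
proof -
  let ?S = "\<lambda>A. {N \<in> grid n. (1 / real (n + 1)) *\<^sub>R cvec N \<in> A}"
  have fin: "finite (?S C)" for C using finite_grid(1)[of n] by (auto intro: finite_subset)
  have z: "count_prob K x0 n N = 0" if "(1 / real (n + 1)) *\<^sub>R cvec N \<notin> prob_vectors" for N
  proof (rule ccontr)
    assume "count_prob K x0 n N \<noteq> 0"
    then have "0 < count_prob K x0 n N" using count_prob_nonneg[OF K, of x0 n N] by simp
    from cvec_prob[OF count_prob_total[OF K this]] that show False by simp
  qed
  have "emp_prob K x0 n A = (\<Sum>N\<in>?S (A \<inter> prob_vectors). count_prob K x0 n N)"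
    unfolding emp_prob_def using z by (intro sum.mono_neutral_right fin) auto
  also have "\<dots> \<le> emp_prob K x0 n B"
    unfolding emp_prob_def using sub count_prob_nonneg[OF K] by (intro sum_mono2 fin) auto
  finally show ?thesis .
qed

text \<open>In \<open>lower_rate\<close> the number \<open>r\<close> is both the radius and the loss
  in the exponent. Half of it pays for the approximation, the other half goes to the approximating
  statement.\<close>

lemma lower_rate_closed:
  assumes K: "K \<in> transition_kernels"
    and approx: "\<And>e. 0 < e \<Longrightarrow> \<exists>m' c'. lower_rate K x0 m' c' \<and> dist m' m \<le> e \<and> c' \<le> c + e"
  shows "lower_rate K x0 m c"
  unfolding lower_rate_def
proof (intro allI impI)
  fix r :: real assume r: "0 < r"
  from approx[of "r / 2"] r obtain m' c' where l: "lower_rate K x0 m' c'" "dist m' m \<le> r / 2" "c' \<le> c + r / 2" by auto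
  from l(1) r have "\<forall>\<^sub>F n in sequentially. exp (- (c' + r / 2) * real n) \<le> emp_prob K x0 n (ball m' (r / 2))"
    unfolding lower_rate_def by auto
  then show "\<forall>\<^sub>F n in sequentially. exp (- (c + r) * real n) \<le> emp_prob K x0 n (ball m r)"
  proof eventually_elim
    case (elim n)
    have "exp (- (c + r) * real n) \<le> exp (- (c' + r / 2) * real n)"
      using l(3) r by (intro exp_mono mult_right_mono) auto
    also have "\<dots> \<le> emp_prob K x0 n (ball m' (r / 2))" by (rule elim)
    also have "\<dots> \<le> emp_prob K x0 n (ball m r)"
    proof (rule emp_prob_mono[OF K], rule subsetI)
      fix z assume "z \<in> ball m' (r / 2) \<inter> prob_vectors"
      then show "z \<in> ball m r" using dist_triangle[of m z m'] l(2) by (simp add: dist_commute)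
    qed
    finally show ?case .
  qed
qed

text \<open>Each of the multinomially many words with letter counts \<open>c\<close> has conditional
  probability at least the product of the \<open>q y\<close>: counts only increase during the block,
  and the number of samples in the denominator never exceeds \<open>n + b\<close>.\<close>

lemma count_prob_block:
  fixes K :: "real ^ 'd::finite ^ 'd"
  assumes K: "K \<in> transition_kernels" and q0: "\<And>y. 0 \<le> q y"
    and q: "\<And>y. q y * real (n + b) \<le> (cvec N v* K) $ y" and c: "(\<Sum>y\<in>UNIV. c y) = b"
  shows "count_prob K x0 n N * (fact b / (\<Prod>y\<in>UNIV. fact (c y)) * (\<Prod>y\<in>UNIV. q y ^ c y)) \<le> count_prob K x0 (n + b) (\<lambda>y. N y + c y)"
  using q c
proof (induction b arbitrary: c)
  case 0
  then have "c = (\<lambda>_. 0)" by (auto simp: fun_eq_iff)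
  then show ?case by simp
next
  case (Suc b)
  define c' where "c' y = c(y := c y - 1)" for y
  define F where "F c = (\<Prod>y\<in>UNIV. fact (c y) :: real)" for c :: "'d \<Rightarrow> nat"
  define M where "M c = (\<Prod>y\<in>UNIV. q y ^ c y)" for c :: "'d \<Rightarrow> nat"
  define S where "S = {y. 0 < c y}"
  have Fpos: "0 < F c" for c unfolding F_def by (intro prod_pos) auto
  have M0: "0 \<le> M c" for c unfolding M_def using q0 by (intro prod_nonneg) auto
  have q': "q y * real (n + b) \<le> (cvec N v* K) $ y" for y
  proof -
    have "q y * real (n + b) \<le> q y * real (n + Suc b)" using q0 by (intro mult_left_mono) auto
    with Suc.prems(1)[of y] show ?thesis by linarith
  qed
  have term_le: "count_prob K x0 n N * (fact b / F c * M c) * real (c y) \<le>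
      count_prob K x0 (n + b) ((\<lambda>y. N y + c y)(y := N y + c y - 1)) * ((cvec ((\<lambda>y. N y + c y)(y := N y + c y - 1)) v* K) $ y / real (n + b + 1))"
    if y: "y \<in> S" for y
  proof -
    have cy: "0 < c y" using y by (simp add: S_def)
    have upd: "(\<lambda>y. N y + c y)(y := N y + c y - 1) = (\<lambda>z. N z + c' y z)"
      using cy by (auto simp: c'_def fun_eq_iff)
    have Fc: "F c = real (c y) * F (c' y)"
    proof -
      have "F c = fact (c y) * (\<Prod>z\<in>UNIV - {y}. fact (c z))" unfolding F_def by (rule prod.remove) auto
      moreover have "F (c' y) = fact (c' y y) * (\<Prod>z\<in>UNIV - {y}. fact (c' y z))" unfolding F_def by (rule prod.remove) auto
      moreover have "(\<Prod>z\<in>UNIV - {y}. fact (c' y z) :: real) = (\<Prod>z\<in>UNIV - {y}. fact (c z))"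
        by (intro prod.cong) (auto simp: c'_def)
      ultimately show ?thesis using cy by (simp add: c'_def fact_reduce)
    qed
    have Mc: "M c = M (c' y) * q y"
    proof -
      have "M c = q y ^ c y * (\<Prod>z\<in>UNIV - {y}. q z ^ c z)" unfolding M_def by (rule prod.remove) auto
      moreover have "M (c' y) = q y ^ c' y y * (\<Prod>z\<in>UNIV - {y}. q z ^ c' y z)" unfolding M_def by (rule prod.remove) auto
      moreover have "(\<Prod>z\<in>UNIV - {y}. q z ^ c' y z) = (\<Prod>z\<in>UNIV - {y}. q z ^ c z)"
        by (intro prod.cong) (auto simp: c'_def)
      moreover have "q y ^ c y = q y ^ (c y - 1) * q y" using cy by (metis power_minus_mult)
      ultimately show ?thesis by (simp add: c'_def)
    qed
    have sc: "(\<Sum>z\<in>UNIV. c' y z) = b"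
    proof -
      have "(\<Sum>z\<in>UNIV. c z) = (\<Sum>z\<in>UNIV. c' y z + (if z = y then 1 else 0))"
        using cy by (intro sum.cong) (auto simp: c'_def)
      then show ?thesis using Suc.prems(2) by (simp add: sum.distrib)
    qed
    have "q y * real (n + b + 1) \<le> (cvec N v* K) $ y" using Suc.prems(1)[of y] by simp
    also have "\<dots> \<le> (cvec (\<lambda>z. N z + c' y z) v* K) $ y"
      unfolding vec_kernel_nth using kernelD[OF K] by (intro sum_mono mult_right_mono) auto
    finally have qy: "q y \<le> (cvec (\<lambda>z. N z + c' y z) v* K) $ y / real (n + b + 1)"
      by (simp add: pos_le_divide_eq)
    have "count_prob K x0 n N * (fact b / F c * M c) * real (c y) = count_prob K x0 n N * (fact b / F (c' y) * M (c' y)) * q y"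
      using cy Fpos[of "c' y"] by (simp add: Fc Mc)
    also have "\<dots> \<le> count_prob K x0 (n + b) (\<lambda>z. N z + c' y z) * ((cvec (\<lambda>z. N z + c' y z) v* K) $ y / real (n + b + 1))"
      using Suc.IH[OF q' sc] qy q0 count_prob_nonneg[OF K] by (intro mult_mono) (auto simp: F_def M_def)
    finally show ?thesis unfolding upd .
  qed
  \<comment> \<open>Recursion of the multinomial coefficient over the last letter, as the
    \<open>c y\<close> sum to \<open>b + 1\<close>.\<close>
  have "count_prob K x0 n N * (fact (Suc b) / F c * M c) = (\<Sum>y\<in>UNIV. count_prob K x0 n N * (fact b / F c * M c) * real (c y))"
    unfolding sum_distrib_left[symmetric] of_nat_sum[symmetric] Suc.prems(2) by (simp add: algebra_simps)
  also have "\<dots> = (\<Sum>y\<in>S. count_prob K x0 n N * (fact b / F c * M c) * real (c y))"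
    by (rule sum.mono_neutral_right) (auto simp: S_def)
  also have "\<dots> \<le> (\<Sum>y\<in>S. count_prob K x0 (n + b) ((\<lambda>y. N y + c y)(y := N y + c y - 1)) * ((cvec ((\<lambda>y. N y + c y)(y := N y + c y - 1)) v* K) $ y / real (n + b + 1)))"
    by (intro sum_mono term_le)
  also have "\<dots> \<le> (\<Sum>y\<in>{y. 0 < N y + c y}. count_prob K x0 (n + b) ((\<lambda>y. N y + c y)(y := N y + c y - 1)) * ((cvec ((\<lambda>y. N y + c y)(y := N y + c y - 1)) v* K) $ y / real (n + b + 1)))"
    by (intro sum_mono2) (auto simp: S_def intro!: mult_nonneg_nonneg count_prob_nonneg[OF K] divide_nonneg_nonneg cvec_kernel_nonneg[OF K])
  also have "\<dots> = count_prob K x0 (n + Suc b) (\<lambda>y. N y + c y)" by simp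
  finally show ?case unfolding F_def M_def .
qed

section \<open>Factorials, rounding and continuity of x ln x\<close>

lemma ln_fact_ge: "real n * ln (real n) - real n \<le> ln (fact n)"
proof (induction n)
  case (Suc n)
  show ?case
  proof (cases "n = 0")
    case False
    have "ln (1 + 1 / real n) \<le> 1 / real n" using False by (intro ln_add_one_self_le_self) auto
    then have "real n * ln (1 + 1 / real n) \<le> real n * (1 / real n)" using False by (intro mult_left_mono) auto
    moreover have "ln (1 + 1 / real n) = ln (real (Suc n)) - ln (real n)"
    proof -
      have "1 + 1 / real n = real (Suc n) / real n" using False by (simp add: field_simps)
      then show ?thesis using False by (simp only: ln_divide_pos of_nat_0_less_iff zero_less_Suc neq0_conv)
    qed
    ultimately have "real n * (ln (real (Suc n)) - ln (real n)) \<le> 1" using False by simp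
    moreover have "ln (fact (Suc n) :: real) = ln (real (Suc n)) + ln (fact n)"
      by (simp add: ln_mult_pos del: of_nat_Suc)
    moreover have "real (Suc n) * L = real n * L + L" for L by (simp add: algebra_simps)
    ultimately show ?thesis using Suc.IH by (simp add: right_diff_distrib del: of_nat_Suc)
  qed simp
qed simp

text \<open>Together with the preceding bound, Stirling's formula up to an error of order
  \<open>ln n\<close>. The constant 1 gives equality at \<open>n = 1\<close>, from where the
  induction proceeds.\<close>

lemma ln_fact_le: "ln (fact n) \<le> real n * ln (real n) - real n + ln (real n) + 1"
proof (induction n)
  case (Suc n)
  show ?case
  proof (cases "n = 0")
    case False
    have "1 / real (Suc n) \<le> ln (real (Suc n) / real n)"
      using ln_Suc_diff_ge[of "real n"] False by (simp add: add.commute)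
    then have "real (Suc n) * (1 / real (Suc n)) \<le> real (Suc n) * ln (real (Suc n) / real n)"
      by (intro mult_left_mono) auto
    then have "1 \<le> real (Suc n) * (ln (real (Suc n)) - ln (real n))"
      using False by (simp add: ln_divide_pos del: of_nat_Suc)
    moreover have "ln (fact (Suc n) :: real) = ln (real (Suc n)) + ln (fact n)"
      by (simp add: ln_mult_pos del: of_nat_Suc)
    moreover have "real (Suc n) * L = real n * L + L" for L by (simp add: algebra_simps)
    ultimately show ?thesis using Suc.IH by (simp add: right_diff_distrib del: of_nat_Suc)
  qed simp
qed simp

text \<open>All coordinates are rounded down, and the deficit, at most the number of states, is
  given to a single one.\<close>

lemma exists_rounding:
  assumes \<eta>: "(\<eta> :: real ^ 'd::finite) \<in> prob_vectors"
  shows "\<exists>c. (\<Sum>y\<in>UNIV. c y) = b \<and> (\<forall>y. \<bar>real (c y) - real b * \<eta> $ y\<bar> \<le> real CARD('d))"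
proof -
  define f where "f y = nat \<lfloor>real b * \<eta> $ y\<rfloor>" for y
  have e0: "0 \<le> real b * \<eta> $ y" for y using prob_vectorsD(1)[OF \<eta>] by simp
  have f: "real (f y) \<le> real b * \<eta> $ y" "real b * \<eta> $ y \<le> real (f y) + 1" for y
    using e0[of y] unfolding f_def by linarith+
  have sb: "(\<Sum>y\<in>UNIV. real b * \<eta> $ y) = real b"
    using prob_vectorsD(3)[OF \<eta>] by (simp flip: sum_distrib_left)
  have "real (\<Sum>y\<in>UNIV. f y) \<le> (\<Sum>y\<in>UNIV. real b * \<eta> $ y)"
    unfolding of_nat_sum by (intro sum_mono f)
  then have "real (\<Sum>y\<in>UNIV. f y) \<le> real b" unfolding sb .
  then have fb: "(\<Sum>y\<in>UNIV. f y) \<le> b" by (simp only: of_nat_le_iff)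
  have "(\<Sum>y\<in>UNIV. real b * \<eta> $ y) \<le> (\<Sum>y\<in>UNIV. real (f y) + 1)"
    by (intro sum_mono f)
  then have "real b \<le> (\<Sum>y\<in>UNIV. real (f y) + 1)" unfolding sb .
  then have fd: "real b - real (\<Sum>y\<in>UNIV. f y) \<le> real CARD('d)" by (simp add: sum.distrib)
  fix y0 :: 'd
  define c where "c y = f y + (if y = y0 then b - (\<Sum>y\<in>UNIV. f y) else 0)" for y
  have "(\<Sum>y\<in>UNIV. c y) = b" using fb by (simp add: c_def sum.distrib)
  moreover have "\<bar>real (c y) - real b * \<eta> $ y\<bar> \<le> real CARD('d)" for y
  proof -
    have one: "1 \<le> real CARD('d)" by (simp add: Suc_leI)
    define z where "z = real b - real (\<Sum>y\<in>UNIV. f y)"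
    have z: "0 \<le> z" "z \<le> real CARD('d)" using fb fd unfolding z_def by (simp_all only: of_nat_le_iff diff_ge_0_iff_ge)
    have "real (c y) = real (f y) + (if y = y0 then z else 0)"
      using fb by (simp add: c_def of_nat_diff z_def)
    then have "real (f y) \<le> real (c y)" "real (c y) \<le> real (f y) + z" using z(1) by auto
    then show ?thesis using f[of y] z one unfolding abs_le_iff by linarith
  qed
  ultimately show ?thesis by blast
qed

text \<open>The point 0 is included, where the value \<open>0 * ln 0 = 0\<close> is the continuous
  one; this admits letters of frequency 0.\<close>

lemma tendsto_xlnx:
  fixes f :: "nat \<Rightarrow> real"
  assumes lim: "f \<longlonglongrightarrow> l" and nn: "\<And>n. 0 \<le> f n"
  shows "(\<lambda>n. f n * ln (f n)) \<longlonglongrightarrow> l * ln l"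
proof -
  have l: "0 \<le> l" using lim nn by (auto intro: LIMSEQ_le_const)
  have "continuous_on {0..} (\<lambda>x::real. x * ln x)"
    unfolding continuous_on_def
  proof
    fix x :: real assume x: "x \<in> {0..}"
    show "((\<lambda>x. x * ln x) \<longlongrightarrow> x * ln x) (at x within {0..})"
    proof (cases "x = 0")
      case True
      have "((\<lambda>x::real. x * ln x) \<longlongrightarrow> 0) (at_right 0)" by real_asymp
      then show ?thesis by (simp add: True at_within_Ici_at_right)
    next
      case False
      then show ?thesis by (intro tendsto_intros) auto
    qed
  qed
  from continuous_on_tendsto_compose[OF this lim] l nn show ?thesis by auto
qed

text \<open>About \<open>(1 - \<theta>) n\<close> samples with occupation near \<open>m\<close> are
  followed by a block of about \<open>\<theta> n\<close> letters with frequencies \<eta>. In the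
  transition probabilities the numerator is kept at its value before the block while the denominator
  may grow to \<open>n\<close>, whence the factor \<open>1 - \<theta>\<close> in the logarithm. The
  multinomial coefficient supplies the entropy of \<eta>.\<close>

lemma lower_rate_step:
  fixes K :: "real ^ 'd::finite ^ 'd"
  assumes K: "K \<in> transition_kernels" and lower_rate: "lower_rate K x0 m c" and \<eta>: "\<eta> \<in> prob_vectors"
    and \<theta>: "0 < \<theta>" "\<theta> < 1" and pos: "\<And>y. 0 < (m v* K) $ y"
  shows "lower_rate K x0 ((1 - \<theta>) *\<^sub>R m + \<theta> *\<^sub>R \<eta>)
    ((1 - \<theta>) * c + \<theta> * (\<Sum>y\<in>UNIV. \<eta> $ y * ln (\<eta> $ y / ((1 - \<theta>) * (m v* K) $ y))))"
  unfolding lower_rate_def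
proof (intro allI impI)
  fix r :: real assume r: "0 < r"
  define D where "D = real CARD('d)"
  define m' where "m' = (1 - \<theta>) *\<^sub>R m + \<theta> *\<^sub>R \<eta>"
  define C where "C = (1 - \<theta>) * c + \<theta> * (\<Sum>y\<in>UNIV. \<eta> $ y * ln (\<eta> $ y / ((1 - \<theta>) * (m v* K) $ y)))"
  \<comment> \<open>The factor \<open>exp (- r / 2)\<close> leaves room for empirical measures that
    are merely close to \<open>m\<close>.\<close>
  define q where "q y = (1 - \<theta>) * ((m v* K) $ y * exp (- r / 2))" for y
  have q0: "0 < q y" for y using \<theta> pos[of y] by (simp add: q_def)
  have cont: "((\<lambda>v. (v v* K) $ y) \<longlongrightarrow> (m v* K) $ y) (nhds m)" for y
    unfolding vec_kernel_nth by (intro tendsto_intros filterlim_ident)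
  have "(m v* K) $ y * exp (- r / 2) < (m v* K) $ y" for y using pos[of y] r by simp
  then have "\<forall>\<^sub>F v in nhds m. (m v* K) $ y * exp (- r / 2) < (v v* K) $ y" for y
    by (intro order_tendstoD(1)[OF cont])
  then have "\<forall>\<^sub>F v in nhds m. \<forall>y. (m v* K) $ y * exp (- r / 2) < (v v* K) $ y"
    by (intro eventually_all_finite) auto
  then obtain e where e: "0 < e" "\<And>v y. dist v m < e \<Longrightarrow> (m v* K) $ y * exp (- r / 2) < (v v* K) $ y"
    unfolding eventually_nhds_metric by blast
  define r0 where "r0 = min e (r / 2)"
  have r0: "0 < r0" "r0 \<le> e" "r0 \<le> r / 2" using e(1) r by (auto simp: r0_def)
  define b where "b n = nat \<lfloor>\<theta> * real n\<rfloor>" for n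
  have b_le: "real (b n) \<le> \<theta> * real n" and b_ge: "\<theta> * real n \<le> real (b n) + 1" for n
  proof -
    have "0 \<le> \<theta> * real n" using \<theta> by simp
    then show "real (b n) \<le> \<theta> * real n" "\<theta> * real n \<le> real (b n) + 1" unfolding b_def by linarith+
  qed
  have bn: "b n \<le> n" for n
  proof -
    have "real (b n) \<le> 1 * real n" by (rule order_trans[OF b_le]) (use \<theta> in \<open>intro mult_right_mono; simp\<close>)
    then show ?thesis by simp
  qed
  have "\<forall>n. \<exists>k. (\<Sum>y\<in>UNIV. k y) = b n \<and> (\<forall>y. \<bar>real (k y) - real (b n) * \<eta> $ y\<bar> \<le> D)"
    unfolding D_def using exists_rounding[OF \<eta>] by blast
  then obtain k where k: "\<And>n. (\<Sum>y\<in>UNIV. k n y) = b n" and kd: "\<And>n y. \<bar>real (k n y) - real (b n) * \<eta> $ y\<bar> \<le> D"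
    by metis
  have kb: "k n y \<le> b n" for n y unfolding k[of n, symmetric] by (rule member_le_sum) auto

  have lim1: "(\<lambda>n. a / real n) \<longlonglongrightarrow> 0" for a by real_asymp
  have lim_b: "(\<lambda>n. real (b n) / real n) \<longlonglongrightarrow> \<theta>"
  proof (rule tendsto_sandwich)
    show "(\<lambda>n. \<theta> - 1 / real n) \<longlonglongrightarrow> \<theta>" using tendsto_diff[OF tendsto_const lim1, of \<theta> 1] by simp
    show "\<forall>\<^sub>F n in sequentially. \<theta> - 1 / real n \<le> real (b n) / real n"
      using eventually_gt_at_top[of 0]
    proof eventually_elim
      case (elim n)
      then have "(\<theta> * real n - 1) / real n \<le> real (b n) / real n" using b_ge[of n] by (intro divide_right_mono) auto
      then show ?case using elim by (simp add: diff_divide_distrib)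
    qed
    show "\<forall>\<^sub>F n in sequentially. real (b n) / real n \<le> \<theta>"
      using eventually_gt_at_top[of 0] by eventually_elim (simp add: divide_le_eq b_le)
  qed (rule tendsto_const)
  have lim_k: "(\<lambda>n. real (k n y) / real n) \<longlonglongrightarrow> \<theta> * \<eta> $ y" for y
  proof -
    have "(\<lambda>n. real (k n y) / real n - real (b n) / real n * \<eta> $ y) \<longlonglongrightarrow> 0"
    proof (rule Lim_null_comparison[OF _ lim1[of D]])
      show "\<forall>\<^sub>F n in sequentially. norm (real (k n y) / real n - real (b n) / real n * \<eta> $ y) \<le> D / real n"
        using eventually_gt_at_top[of 0]
      proof eventually_elim
        case (elim n)
        have "real (k n y) / real n - real (b n) / real n * \<eta> $ y = (real (k n y) - real (b n) * \<eta> $ y) / real n"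
          by (simp add: diff_divide_distrib)
        then show ?case using kd[of n y] by (simp add: divide_right_mono)
      qed
    qed
    from tendsto_add[OF this tendsto_mult[OF lim_b tendsto_const[of "\<eta> $ y"]]] show ?thesis by simp
  qed

  define L where "L n = ln (fact (b n) / (\<Prod>y\<in>UNIV. fact (k n y)) * (\<Prod>y\<in>UNIV. q y ^ k n y))" for n
  \<comment> \<open>The exponent per step: that of the first \<open>n - b n\<close> steps, minus the
    Stirling bound for \<open>L n\<close>, whose linear terms cancel because \<open>k n\<close> sums
    to \<open>b n\<close>. Everything is expressed by fractions of \<open>n\<close>, which have
    limits.\<close>
  define g where "g n = (c + r0) * (1 - real (b n) / real n)
    - (real (b n) / real n * ln (real (b n) / real n) - (\<Sum>y\<in>UNIV. real (k n y) / real n * ln (real (k n y) / real n))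
       - D * ((ln (real (n + 1)) + 1) / real n) + (\<Sum>y\<in>UNIV. real (k n y) / real n * ln (q y)))" for n
  have "g \<longlonglongrightarrow> (c + r0) * (1 - \<theta>) - (\<theta> * ln \<theta> - (\<Sum>y\<in>UNIV. \<theta> * \<eta> $ y * ln (\<theta> * \<eta> $ y)) - D * 0 + (\<Sum>y\<in>UNIV. \<theta> * \<eta> $ y * ln (q y)))"
  proof -
    have "(\<lambda>n. (ln (real (n + 1)) + 1) / real n) \<longlonglongrightarrow> 0" by real_asymp
    then show ?thesis unfolding g_def
      by (intro tendsto_intros lim_b lim_k tendsto_xlnx) auto
  qed
  also have "(c + r0) * (1 - \<theta>) - (\<theta> * ln \<theta> - (\<Sum>y\<in>UNIV. \<theta> * \<eta> $ y * ln (\<theta> * \<eta> $ y)) - D * 0 + (\<Sum>y\<in>UNIV. \<theta> * \<eta> $ y * ln (q y)))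
      = C + r0 * (1 - \<theta>) + \<theta> * (r / 2)"
  proof -
    \<comment> \<open>After summation the terms in \<open>ln \<theta>\<close> cancel against
      \<open>\<theta> * ln \<theta>\<close>: the multinomial coefficient only sees frequencies
      within the block.\<close>
    have t: "\<theta> * \<eta> $ y * ln (\<theta> * \<eta> $ y) - \<theta> * \<eta> $ y * ln (q y) =
        \<theta> * \<eta> $ y * ln \<theta> + \<theta> * (\<eta> $ y * ln (\<eta> $ y / ((1 - \<theta>) * (m v* K) $ y))) + \<theta> * \<eta> $ y * (r / 2)" for y
    proof (cases "\<eta> $ y = 0")
      case False
      then have p: "0 < \<eta> $ y" using prob_vectorsD(1)[OF \<eta>, of y] by simp
      have "ln (q y) = ln ((1 - \<theta>) * (m v* K) $ y) - r / 2"
        using \<theta> pos[of y] by (simp add: q_def ln_mult_pos)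
      moreover have "ln (\<theta> * \<eta> $ y) = ln \<theta> + ln (\<eta> $ y)" using p \<theta> by (simp add: ln_mult_pos)
      moreover have "ln (\<eta> $ y / ((1 - \<theta>) * (m v* K) $ y)) = ln (\<eta> $ y) - ln ((1 - \<theta>) * (m v* K) $ y)"
        using p \<theta> pos[of y] by (intro ln_divide_pos) auto
      ultimately show ?thesis by (simp only:) (simp add: algebra_simps)
    qed simp
    have "(\<Sum>y\<in>UNIV. \<theta> * \<eta> $ y * ln (\<theta> * \<eta> $ y)) - (\<Sum>y\<in>UNIV. \<theta> * \<eta> $ y * ln (q y)) =
        \<theta> * ln \<theta> + \<theta> * (\<Sum>y\<in>UNIV. \<eta> $ y * ln (\<eta> $ y / ((1 - \<theta>) * (m v* K) $ y))) + \<theta> * (r / 2)"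
      unfolding sum_subtractf[symmetric] t sum.distrib
      using prob_vectorsD(3)[OF \<eta>] by (simp flip: sum_distrib_left sum_distrib_right sum_divide_distrib)
    then show ?thesis unfolding C_def by (simp add: algebra_simps)
  qed
  finally have lim_g: "g \<longlonglongrightarrow> C + r0 * (1 - \<theta>) + \<theta> * (r / 2)" .
  have "C + r0 * (1 - \<theta>) + \<theta> * (r / 2) < C + r"
  proof -
    have "r0 * (1 - \<theta>) \<le> r / 2 * (1 - \<theta>)" using r0 \<theta> by (intro mult_right_mono) auto
    then show ?thesis using r by (simp add: algebra_simps)
  qed
  then have "\<forall>\<^sub>F n in sequentially. g n < C + r" by (rule order_tendstoD(2)[OF lim_g])
  moreover have "\<forall>\<^sub>F n in sequentially. 0 < n" by (rule eventually_gt_at_top)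
  ultimately have rate: "\<forall>\<^sub>F n in sequentially. exp (- (C + r) * real n) \<le> exp (- (c + r0) * real (n - b n)) * exp (L n)"
  proof eventually_elim
    case (elim n)
    have Lge: "real (b n) * ln (real (b n)) - real (b n) - (\<Sum>y\<in>UNIV. real (k n y) * ln (real (k n y)) - real (k n y) + ln (real (n + 1)) + 1)
        + (\<Sum>y\<in>UNIV. real (k n y) * ln (q y)) \<le> L n"
    proof -
      have "L n = ln (fact (b n)) - (\<Sum>y\<in>UNIV. ln (fact (k n y))) + (\<Sum>y\<in>UNIV. real (k n y) * ln (q y))"
      proof -
        have p: "0 < (\<Prod>y\<in>UNIV. fact (k n y) :: real)" "0 < (\<Prod>y\<in>UNIV. q y ^ k n y)" using q0 by (auto intro!: prod_pos)
        have "L n = ln (fact (b n)) - ln (\<Prod>y\<in>UNIV. fact (k n y)) + ln (\<Prod>y\<in>UNIV. q y ^ k n y)"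
          unfolding L_def using p by (subst ln_mult_pos) (auto simp: ln_divide_pos)
        moreover have "ln (\<Prod>y\<in>UNIV. fact (k n y) :: real) = (\<Sum>y\<in>UNIV. ln (fact (k n y)))" by (intro ln_prod) auto
        moreover have "ln (\<Prod>y\<in>UNIV. q y ^ k n y) = (\<Sum>y\<in>UNIV. ln (q y ^ k n y))"
          using less_imp_neq[OF q0] by (intro ln_prod) (auto dest: sym)
        moreover have "ln (q y ^ k n y) = real (k n y) * ln (q y)" for y using q0 by (simp add: ln_realpow)
        ultimately show ?thesis by simp
      qed
      moreover have "(\<Sum>y\<in>UNIV. ln (fact (k n y))) \<le> (\<Sum>y\<in>UNIV. real (k n y) * ln (real (k n y)) - real (k n y) + ln (real (n + 1)) + 1)"
      proof (rule sum_mono)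
        fix y
        have "ln (real (k n y)) \<le> ln (real (n + 1))"
        proof (cases "k n y = 0")
          case False
          then show ?thesis using kb[of n y] bn[of n] by (subst ln_le_cancel_iff) auto
        qed simp
        then show "ln (fact (k n y)) \<le> real (k n y) * ln (real (k n y)) - real (k n y) + ln (real (n + 1)) + 1"
          using ln_fact_le[of "k n y"] by linarith
      qed
      ultimately show ?thesis using ln_fact_ge[of "b n"] by linarith
    qed
    have sk: "(\<Sum>y\<in>UNIV. real (k n y)) = real (b n)" unfolding k[of n, symmetric] by simp
    \<comment> \<open>Dividing by \<open>n\<close> inside the logarithms changes nothing in total:
      the terms in \<open>ln (real n)\<close> cancel since the letter counts sum to
      \<open>b n\<close>.\<close>
    have xl: "real n * (real a / real n * ln (real a / real n)) = real a * ln (real a) - real a * ln (real n)" for a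
      using elim(2) by (cases "a = 0") (auto simp: ln_divide_pos algebra_simps)
    have "real n * g n = (c + r0) * (real n - real (b n)) - (real (b n) * ln (real (b n)) - real (b n)
        - (\<Sum>y\<in>UNIV. real (k n y) * ln (real (k n y)) - real (k n y) + ln (real (n + 1)) + 1) + (\<Sum>y\<in>UNIV. real (k n y) * ln (q y)))"
    proof -
      have "real n * g n = (c + r0) * (real n * (1 - real (b n) / real n))
        - (real n * (real (b n) / real n * ln (real (b n) / real n))
           - (\<Sum>y\<in>UNIV. real n * (real (k n y) / real n * ln (real (k n y) / real n)))
           - D * (real n * ((ln (real (n + 1)) + 1) / real n)) + (\<Sum>y\<in>UNIV. real n * (real (k n y) / real n * ln (q y))))"
        unfolding g_def sum_distrib_left[symmetric] by (simp only: right_diff_distrib distrib_left mult.left_commute)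
      moreover have "real n * (1 - real (b n) / real n) = real n - real (b n)" using elim(2) by (simp add: right_diff_distrib)
      moreover have "real n * ((ln (real (n + 1)) + 1) / real n) = ln (real (n + 1)) + 1" using elim(2) by simp
      moreover have "real n * (real (k n y) / real n * ln (q y)) = real (k n y) * ln (q y)" for y using elim(2) by simp
      ultimately have "real n * g n = (c + r0) * (real n - real (b n)) - ((real (b n) * ln (real (b n)) - real (b n) * ln (real n))
           - (\<Sum>y\<in>UNIV. real (k n y) * ln (real (k n y)) - real (k n y) * ln (real n))
           - D * (ln (real (n + 1)) + 1) + (\<Sum>y\<in>UNIV. real (k n y) * ln (q y)))"
        by (simp only: xl)
      then show ?thesis
        by (simp add: sum_subtractf sum.distrib sk D_def distrib_left flip: sum_distrib_right)
    qed
    with Lge have "real n * g n \<ge> (c + r0) * (real n - real (b n)) - L n" by linarith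
    moreover have "real n * g n \<le> real n * (C + r)" using elim by (intro mult_left_mono) auto
    ultimately have "- (C + r) * real n \<le> - (c + r0) * real (n - b n) + L n"
      using bn[of n] by (simp add: of_nat_diff algebra_simps)
    then show ?case by (simp add: exp_add[symmetric])
  qed

  have "filterlim (\<lambda>n. n - b n) at_top sequentially"
  proof -
    have "filterlim (\<lambda>n. (1 - \<theta>) * real n) at_top sequentially" using \<theta> by real_asymp
    then have "filterlim (\<lambda>n. real (n - b n)) at_top sequentially"
    proof (rule filterlim_at_top_mono, intro always_eventually allI)
      fix n show "(1 - \<theta>) * real n \<le> real (n - b n)" using b_le[of n] bn[of n] by (simp add: of_nat_diff algebra_simps)
    qed
    then show ?thesis by (simp add: filterlim_sequentially_iff_filterlim_real)
  qed
  moreover have "\<forall>\<^sub>F n in sequentially. exp (- (c + r0) * real n) \<le> emp_prob K x0 n (ball m r0)"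
    using lower_rate r0 unfolding lower_rate_def by blast
  ultimately have start: "\<forall>\<^sub>F n in sequentially. exp (- (c + r0) * real (n - b n)) \<le> emp_prob K x0 (n - b n) (ball m r0)"
    by (rule eventually_compose_filterlim[rotated])

  \<comment> \<open>At time \<open>n\<close> there are \<open>n + 1\<close> samples, and
    \<open>n - b n + 1\<close> of them precede the block.\<close>
  define w where "w n = real (n - b n + 1) / real (n + 1)" for n
  have lim_n1: "(\<lambda>n. real n / real (n + 1)) \<longlonglongrightarrow> 1" by real_asymp
  have lim_w: "w \<longlonglongrightarrow> 1 - \<theta>"
  proof -
    have l: "(\<lambda>n. 1 - real (b n) / real n * (real n / real (n + 1))) \<longlonglongrightarrow> 1 - \<theta> * 1"
      by (intro tendsto_intros lim_b lim_n1)
    have "1 - real (b n) / real n * (real n / real (n + 1)) = w n" if "0 < n" for n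
      using that bn[of n] by (simp add: w_def of_nat_diff field_simps)
    then have "\<forall>\<^sub>F n in sequentially. 1 - real (b n) / real n * (real n / real (n + 1)) = w n"
      by (rule eventually_mono[OF eventually_gt_at_top[of 0]])
    from Lim_transform_eventually[OF l this] show ?thesis by simp
  qed
  have lim_kv: "(\<lambda>n. (1 / real (n + 1)) *\<^sub>R cvec (k n)) \<longlonglongrightarrow> \<theta> *\<^sub>R \<eta>"
  proof (rule vec_tendstoI)
    fix y
    have l: "(\<lambda>n. real (k n y) / real n * (real n / real (n + 1))) \<longlonglongrightarrow> \<theta> * \<eta> $ y * 1"
      by (intro tendsto_intros lim_k lim_n1)
    have "real (k n y) / real n * (real n / real (n + 1)) = ((1 / real (n + 1)) *\<^sub>R cvec (k n)) $ y" if "0 < n" for n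
      using that by simp
    then have "\<forall>\<^sub>F n in sequentially. real (k n y) / real n * (real n / real (n + 1)) = ((1 / real (n + 1)) *\<^sub>R cvec (k n)) $ y"
      by (rule eventually_mono[OF eventually_gt_at_top[of 0]])
    from Lim_transform_eventually[OF l this]
    show "(\<lambda>n. ((1 / real (n + 1)) *\<^sub>R cvec (k n)) $ y) \<longlonglongrightarrow> (\<theta> *\<^sub>R \<eta>) $ y" by simp
  qed
  have "(\<lambda>n. w n *\<^sub>R m + (1 / real (n + 1)) *\<^sub>R cvec (k n)) \<longlonglongrightarrow> m'"
    unfolding m'_def by (intro tendsto_intros lim_w lim_kv)
  then have near: "\<forall>\<^sub>F n in sequentially. dist (w n *\<^sub>R m + (1 / real (n + 1)) *\<^sub>R cvec (k n)) m' < r / 2"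
    using r by (intro tendstoD) auto

  show "\<forall>\<^sub>F n in sequentially. exp (- (C + r) * real n) \<le> emp_prob K x0 n (ball m' r)"
    using rate start near
  proof eventually_elim
    case (elim n)
    define n' where "n' = n - b n"
    have n: "n = n' + b n" using bn[of n] by (simp add: n'_def)
    define S where "S = {N \<in> grid n'. (1 / real (n' + 1)) *\<^sub>R cvec N \<in> ball m r0}"
    define sh where "sh N y = N y + k n y" for N :: "'d \<Rightarrow> nat" and y
    \<comment> \<open>Different counts before the block lead to different counts after it, so the
      lower bounds may be added.\<close>
    have sh_inj: "inj_on sh S" unfolding sh_def inj_on_def fun_eq_iff by simp
    have shS: "sh N \<in> {N \<in> grid n. (1 / real (n + 1)) *\<^sub>R cvec N \<in> ball m' r}" if N: "N \<in> S" for N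
    proof -
      define v where "v = (1 / real (n' + 1)) *\<^sub>R cvec N"
      have v: "dist m v < r0" using N by (simp add: S_def v_def)
      have "(1 / real (n + 1)) *\<^sub>R cvec (sh N) = w n *\<^sub>R v + (1 / real (n + 1)) *\<^sub>R cvec (k n)"
      proof -
        have "w n *\<^sub>R v = (1 / real (n + 1)) *\<^sub>R cvec N" unfolding w_def v_def n'_def[symmetric] by simp
        moreover have "cvec (sh N) = cvec N + cvec (k n)" by (simp add: vec_eq_iff sh_def)
        ultimately show ?thesis by (simp only: scaleR_add_right)
      qed
      moreover have "dist (w n *\<^sub>R v + (1 / real (n + 1)) *\<^sub>R cvec (k n)) (w n *\<^sub>R m + (1 / real (n + 1)) *\<^sub>R cvec (k n)) < r0"
      proof -
        have "0 \<le> w n" "w n \<le> 1" unfolding w_def by (auto simp: divide_le_eq)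
        have "dist (w n *\<^sub>R v + (1 / real (n + 1)) *\<^sub>R cvec (k n)) (w n *\<^sub>R m + (1 / real (n + 1)) *\<^sub>R cvec (k n)) = w n * dist v m"
          using \<open>0 \<le> w n\<close> by (simp add: dist_norm flip: scaleR_diff_right)
        also have "\<dots> \<le> 1 * dist v m" using \<open>w n \<le> 1\<close> by (intro mult_right_mono) auto
        finally show ?thesis using v by (simp add: dist_commute)
      qed
      ultimately have "dist ((1 / real (n + 1)) *\<^sub>R cvec (sh N)) m' < r"
        using elim(3) r0(3) dist_triangle[of "(1 / real (n + 1)) *\<^sub>R cvec (sh N)" m' "w n *\<^sub>R m + (1 / real (n + 1)) *\<^sub>R cvec (k n)"]
        by simp
      moreover have "sh N \<in> grid n" unfolding in_grid sh_def
      proof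
        fix y have "N y \<le> n' + 1" using N by (simp add: S_def in_grid)
        then show "N y + k n y \<le> n + 1" using kb[of n y] n by linarith
      qed
      ultimately show ?thesis by (simp add: dist_commute)
    qed
    have step: "count_prob K x0 n' N * exp (L n) \<le> count_prob K x0 n (sh N)" if N: "N \<in> S" for N
    proof -
      have qle: "q y * real (n' + b n) \<le> (cvec N v* K) $ y" for y
      proof -
        have d: "dist ((1 / real (n' + 1)) *\<^sub>R cvec N) m < e" using N r0(2) by (simp add: S_def dist_commute)
        \<comment> \<open>The length of the block was rounded down, so at least
          \<open>(1 - \<theta>) n\<close> samples precede it, as the factor in \<open>q\<close>
          presupposes.\<close>
        have "(1 - \<theta>) * real n \<le> real (n' + 1)" using b_le[of n] n by (simp add: n'_def of_nat_diff bn algebra_simps)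
        then have "q y * real n \<le> real (n' + 1) * ((m v* K) $ y * exp (- r / 2))"
          unfolding q_def using pos[of y] by (simp add: mult.commute mult.left_commute mult_left_mono)
        also have "\<dots> \<le> real (n' + 1) * ((((1 / real (n' + 1)) *\<^sub>R cvec N) v* K) $ y)"
          using e(2)[OF d, of y] by (intro mult_left_mono) auto
        also have "\<dots> = (cvec N v* K) $ y"
          by (simp add: vec_kernel_nth flip: sum_divide_distrib del: of_nat_Suc of_nat_add)
        finally show ?thesis using n by simp
      qed
      have "exp (L n) = fact (b n) / (\<Prod>y\<in>UNIV. fact (k n y)) * (\<Prod>y\<in>UNIV. q y ^ k n y)"
        unfolding L_def using q0 by (intro exp_ln mult_pos_pos divide_pos_pos prod_pos) auto
      then show ?thesis
        using count_prob_block[OF K less_imp_le[OF q0] qle k[of n], of x0] n unfolding sh_def by simp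
    qed
    have "exp (- (C + r) * real n) \<le> exp (- (c + r0) * real n') * exp (L n)" using elim(1) by (simp add: n'_def)
    also have "\<dots> \<le> emp_prob K x0 n' (ball m r0) * exp (L n)"
      using elim(2) by (intro mult_right_mono) (simp_all add: n'_def)
    also have "\<dots> = (\<Sum>N\<in>S. count_prob K x0 n' N * exp (L n))" unfolding emp_prob_def S_def sum_distrib_right ..
    also have "\<dots> \<le> (\<Sum>N\<in>S. count_prob K x0 n (sh N))" by (intro sum_mono step)
    also have "\<dots> = (\<Sum>N\<in>sh ` S. count_prob K x0 n N)" by (rule sum.reindex[OF sh_inj, symmetric, unfolded o_def])
    also have "\<dots> \<le> emp_prob K x0 n (ball m' r)"
      unfolding emp_prob_def using shS finite_grid(1)[of n] count_prob_nonneg[OF K]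
      by (intro sum_mono2) (auto intro: finite_subset)
    finally show ?case .
  qed
qed

subsection \<open>Periodic walks of an irreducible kernel\<close>

lemma irreducible_rtranclp:
  assumes K: "K \<in> transition_kernels" and "irreducible_kernel K"
  shows "(\<lambda>x y. 0 < K $ x $ y)\<^sup>*\<^sup>* x y"
proof -
  have "0 \<le> ((\<lambda>B. B ** K) ^^ n) (mat 1) $ x $ y" for n y
  proof (induction n arbitrary: y)
    case (Suc n)
    then show ?case by (auto simp: matrix_matrix_mult_def kernelD[OF K] intro!: sum_nonneg)
  qed (simp add: mat_def)
  note nn = this
  have "0 < ((\<lambda>B. B ** K) ^^ n) (mat 1) $ x $ y \<Longrightarrow> (\<lambda>x y. 0 < K $ x $ y)\<^sup>*\<^sup>* x y" for n
  proof (induction n arbitrary: y)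
    case 0
    then show ?case by (auto simp: mat_def split: if_splits)
  next
    case (Suc n)
    let ?B = "((\<lambda>B. B ** K) ^^ n) (mat 1)"
    have "0 < (\<Sum>z\<in>UNIV. ?B $ x $ z * K $ z $ y)"
      using Suc.prems by (simp add: matrix_matrix_mult_def)
    then obtain z where "0 < ?B $ x $ z * K $ z $ y"
      by (meson not_less sum_nonpos)
    then have "0 < ?B $ x $ z" "0 < K $ z $ y"
      using nn[of n z] kernelD(1)[OF K, of z y] by (auto simp: zero_less_mult_iff)
    then show ?case using rtranclp.rtrancl_into_rtrancl[OF Suc.IH[of z]] by simp
  qed
  then show ?thesis using assms(2) unfolding irreducible_kernel_def by blast
qed

text \<open>\<open>walk E x p z\<close>: the states \<open>p\<close> followed by \<open>z\<close> form a path which starts at \<open>x\<close>.\<close>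

fun walk :: "('a \<Rightarrow> 'a \<Rightarrow> bool) \<Rightarrow> 'a \<Rightarrow> 'a list \<Rightarrow> 'a \<Rightarrow> bool" where
  "walk E x [] z \<longleftrightarrow> x = z"
| "walk E x (a # p) z \<longleftrightarrow> a = x \<and> (\<exists>u. E x u \<and> walk E u p z)"

lemma walk_append: "walk E x p y \<Longrightarrow> walk E y p' z \<Longrightarrow> walk E x (p @ p') z"
  by (induction p arbitrary: x) auto

lemma walk_nth:
  "walk E x p z \<Longrightarrow> i < length p \<Longrightarrow> E (p ! i) (if Suc i < length p then p ! Suc i else z)"
proof (induction p arbitrary: x i)
  case (Cons a p)
  then obtain u where u: "a = x" "E x u" "walk E u p z" by auto
  show ?case
  proof (cases i)
    case 0
    then show ?thesis using u by (cases p) auto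
  next
    case (Suc j)
    then have "j < length p" using Cons.prems by simp
    from Cons.IH[OF u(3) this] show ?thesis unfolding Suc by (simp split: if_splits)
  qed
qed simp

lemma rtranclp_walk: "E\<^sup>*\<^sup>* x z \<Longrightarrow> \<exists>p. walk E x p z"
proof (induction rule: converse_rtranclp_induct)
  case base
  show ?case by (rule exI[of _ "[]"]) simp
next
  case (step x u)
  then obtain p where "walk E u p z" by blast
  with step show ?case by (intro exI[of _ "x # p"]) auto
qed

text \<open>Induction on the set, joining one more state to the endpoint each time. The list does
  not record the endpoint, hence the \<open>insert\<close>.\<close>

lemma walk_through:
  assumes conn: "\<And>x y. E\<^sup>*\<^sup>* x y" and "finite S"
  shows "\<exists>p z. walk E x p z \<and> S \<subseteq> insert z (set p)"
  using \<open>finite S\<close>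
proof (induction S)
  case empty
  show ?case by (intro exI[of _ "[]"] exI[of _ x]) simp
next
  case (insert s S)
  then obtain p z where p: "walk E x p z" "S \<subseteq> insert z (set p)" by blast
  obtain p' where p': "walk E z p' s" using rtranclp_walk[OF conn] by blast
  have "z \<in> insert s (set p')" using p' by (cases p') auto
  then show ?case using walk_append[OF p(1) p'] p(2) by (intro exI[of _ "p @ p'"] exI[of _ s]) auto
qed

text \<open>A closed walk through all states, repeated forever. The first step to \<open>u0\<close>
  makes its length positive even if there is only one state.\<close>

lemma periodic_walk:
  fixes x0 :: "'a::finite"
  assumes conn: "\<And>x y. E\<^sup>*\<^sup>* x y" and succ: "E x0 u0"
  obtains w l where "0 < (l::nat)" "w 0 = x0" "\<And>k. w (k + l) = w k" "\<And>k. E (w k) (w (Suc k))"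
    "\<And>y. \<exists>k<l. w k = y"
proof -
  obtain p z where p: "walk E u0 p z" "UNIV \<subseteq> insert z (set p)" using walk_through[OF conn, of UNIV u0] by auto
  obtain p' where p': "walk E z p' x0" using rtranclp_walk[OF conn] by blast
  define q where "q = x0 # p @ p'"
  have wq: "walk E x0 q x0" using succ walk_append[OF p(1) p'] by (auto simp: q_def)
  have "z \<in> insert x0 (set p')" using p' by (cases p') auto
  then have all: "set q = UNIV" using p(2) by (auto simp: q_def)
  define l where "l = length q"
  define w where "w k = q ! (k mod l)" for k
  have l: "0 < l" by (simp add: l_def q_def)
  show thesis
  proof
    show "0 < l" by (rule l)
    show "w 0 = x0" by (simp add: w_def q_def)
    show "w (k + l) = w k" for k by (simp add: w_def)
    show "E (w k) (w (Suc k))" for k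
    proof -
      have "E (q ! (k mod l)) (if Suc (k mod l) < l then q ! Suc (k mod l) else x0)"
        using walk_nth[OF wq, of "k mod l"] l by (simp add: l_def)
      moreover have "w (Suc k) = (if Suc (k mod l) < l then q ! Suc (k mod l) else x0)"
      proof -
        have "k mod l < l" using l by simp
        then have "Suc (k mod l) < l \<or> Suc (k mod l) = l" by linarith
        moreover have "q ! 0 = x0" by (simp add: q_def)
        ultimately show ?thesis by (auto simp: w_def mod_Suc)
      qed
      ultimately show ?thesis by (simp add: w_def)
    qed
    show "\<exists>k<l. w k = y" for y
    proof -
      have "y \<in> set q" by (simp add: all)
      then obtain k where "k < l" "q ! k = y" by (auto simp: in_set_conv_nth l_def)
      then show ?thesis by (intro exI[of _ k]) (simp add: w_def)
    qed
  qed
qed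

lemma cnts_periodic:
  assumes per: "\<And>k. w (k + l) = w k"
  shows "cnts w (n + l) y = cnts w n y + cnts w l y"
proof (induction n)
  case (Suc n)
  have "w (n + l) = w n" by (rule per)
  then show ?case using Suc by (auto simp: cnts_Suc)
qed simp

text \<open>The next letter has law \<open>m v* K\<close> whatever the current state, so a step
  along the edge from \<open>w n\<close> is likely as soon as \<open>w n\<close> has been visited
  often. On a periodic walk it accounts for at least a fraction \<open>1 / l\<close> of the samples,
  so every step has probability at least \<kappa> / l.\<close>

lemma lower_rate_start:
  fixes K :: "real ^ 'd::finite ^ 'd"
  assumes K: "K \<in> transition_kernels" and irr: "irreducible_kernel K"
  obtains \<rho> C where "\<rho> \<in> prob_vectors" "\<And>y. 0 < \<rho> $ y" "0 \<le> C" "lower_rate K x0 \<rho> C"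
proof -
  let ?E = "\<lambda>x y. 0 < K $ x $ y"
  have conn: "?E\<^sup>*\<^sup>* x y" for x y by (rule irreducible_rtranclp[OF K irr])
  have "\<exists>u. ?E x0 u"
  proof (rule ccontr)
    assume "\<not> ?thesis"
    then have "(\<Sum>u\<in>UNIV. K $ x0 $ u) \<le> 0" by (intro sum_nonpos) (auto simp: not_less)
    then show False using kernelD(3)[OF K, of x0] by simp
  qed
  then obtain u0 where "?E x0 u0" ..
  then obtain w l where l: "0 < (l::nat)" and w0: "w 0 = x0" and per: "\<And>k. w (k + l) = w k"
    and E: "\<And>k. 0 < K $ w k $ w (Suc k)" and all: "\<And>y. \<exists>k<l. w k = y"
    using periodic_walk[of ?E, OF conn] by metis
  define \<rho> where "\<rho> = (1 / real l) *\<^sub>R cvec (cnts w l)"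
  have \<rho>p: "\<rho> \<in> prob_vectors" unfolding \<rho>_def by (intro cvec_prob cnts_total l)
  have cl: "1 \<le> cnts w l y" for y
  proof -
    obtain k where "k < l" "w k = y" using all by blast
    then have "{k} \<subseteq> {i. i < l \<and> w i = y}" by auto
    from card_mono[OF _ this] show ?thesis by (simp add: cnts_def)
  qed
  have \<rho>0: "0 < \<rho> $ y" for y
  proof -
    have "0 < real (cnts w l y)" using cl[of y] by linarith
    then show ?thesis using l by (simp add: \<rho>_def)
  qed
  \<comment> \<open>Every full period contains each state, and the incomplete one contains at least
    \<open>w n\<close>, as the visit at time \<open>n\<close> is counted.\<close>
  have visits: "n + 1 \<le> l * cnts w (Suc n) (w n)" for n
  proof (induction n rule: less_induct)
    case (less n)
    show ?case
    proof (cases "n < l")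
      case True
      have "1 \<le> cnts w (Suc n) (w n)" by (simp add: cnts_Suc)
      then have "l * 1 \<le> l * cnts w (Suc n) (w n)" by (rule mult_le_mono2)
      then show ?thesis using True by linarith
    next
      case False
      define k where "k = n - l"
      have n: "n = k + l" using False by (simp add: k_def)
      have "k < n" using l n by simp
      have "cnts w (Suc n) (w n) = cnts w (Suc k) (w k) + cnts w l (w k)"
        using cnts_periodic[of w l "Suc k" "w k", OF per] per[of k] by (simp add: n)
      moreover have "l * 1 \<le> l * cnts w l (w k)" by (rule mult_le_mono2[OF cl])
      moreover have "k + 1 \<le> l * cnts w (Suc k) (w k)" by (rule less.IH[OF \<open>k < n\<close>])
      moreover have "l * (a + b) = l * a + l * b" for a b by (rule distrib_left)
      ultimately show ?thesis using n by (simp only:)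
    qed
  qed
  define \<kappa> where "\<kappa> = Min {K $ x $ y |x y. 0 < K $ x $ y}"
  have fin: "finite {K $ x $ y |x y. 0 < K $ x $ y}"
    by (rule finite_subset[of _ "(\<lambda>(x, y). K $ x $ y) ` UNIV"]) auto
  have ne: "{K $ x $ y |x y. 0 < K $ x $ y} \<noteq> {}" using E by auto
  have \<kappa>0: "0 < \<kappa>" using Min_in[OF fin ne] by (auto simp: \<kappa>_def)
  have \<kappa>le: "\<kappa> \<le> K $ w k $ w (Suc k)" for k
    unfolding \<kappa>_def using E[of k] by (intro Min_le[OF fin]) auto
  have \<kappa>1: "\<kappa> \<le> 1" using \<kappa>le[of 0] kernelD(2)[OF K, of "w 0" "w (Suc 0)"] by linarith
  define \<beta> where "\<beta> = \<kappa> / real l"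
  have \<beta>: "0 < \<beta>" "\<beta> \<le> 1" using \<kappa>0 \<kappa>1 l by (auto simp: \<beta>_def divide_le_eq)
  have lower: "\<beta> ^ n \<le> count_prob K x0 n (cnts w (Suc n))" for n
  proof (induction n)
    case 0
    have "cnts w (Suc 0) = (\<lambda>_. 0)(x0 := 1)" by (simp add: cnts_Suc w0)
    then show ?case unfolding count_prob.simps by simp
  next
    case (Suc n)
    define N where "N = cnts w (Suc n)"
    define y where "y = w (Suc n)"
    define N' where "N' = cnts w (Suc (Suc n))"
    have N': "N' = N(y := N y + 1)" unfolding N'_def N_def y_def by (rule cnts_Suc)
    then have dec: "N'(y := N' y - 1) = N" by (simp add: fun_eq_iff)
    have "\<beta> \<le> (cvec N v* K) $ y / real (n + 1)"
    proof -
      have "real (n + 1) \<le> real l * real (N (w n))"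
        using visits[of n] unfolding N_def by (metis of_nat_le_iff of_nat_mult)
      then have "\<kappa> * real (n + 1) \<le> \<kappa> * (real l * real (N (w n)))" using \<kappa>0 by (intro mult_left_mono) auto
      also have "\<dots> \<le> K $ w n $ y * (real l * real (N (w n)))"
        using \<kappa>le[of n] by (intro mult_right_mono) (auto simp: y_def)
      also have "\<dots> = real l * (cvec N $ w n * K $ w n $ y)" by simp
      also have "\<dots> \<le> real l * (cvec N v* K) $ y"
        unfolding vec_kernel_nth
        by (intro mult_left_mono member_le_sum[where f="\<lambda>z. cvec N $ z * K $ z $ y"]) (auto simp: kernelD[OF K])
      finally show ?thesis using l by (simp add: \<beta>_def field_simps)
    qed
    then have "\<beta> ^ Suc n \<le> count_prob K x0 n N * ((cvec N v* K) $ y / real (n + 1))"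
      using Suc \<beta> count_prob_nonneg[OF K] unfolding N_def power_Suc2 by (intro mult_mono) auto
    also have "\<dots> = count_prob K x0 n (N'(y := N' y - 1)) * ((cvec (N'(y := N' y - 1)) v* K) $ y / real (n + 1))"
      unfolding dec ..
    also have "\<dots> \<le> count_prob K x0 (Suc n) N'"
      unfolding count_prob.simps
      by (intro member_le_sum[where f="\<lambda>y. count_prob K x0 n (N'(y := N' y - 1)) * ((cvec (N'(y := N' y - 1)) v* K) $ y / real (n + 1))"])
        (auto simp: N' intro!: mult_nonneg_nonneg count_prob_nonneg[OF K] divide_nonneg_nonneg cvec_kernel_nonneg[OF K])
    finally show ?case unfolding N'_def .
  qed
  \<comment> \<open>The deviation is periodic with period \<open>l\<close>, so the trivial bound for
    \<open>n < l\<close> persists.\<close>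
  have close: "\<bar>real (cnts w n y) - real n * \<rho> $ y\<bar> \<le> real l" for n y
  proof (induction n rule: less_induct)
    case (less n)
    show ?case
    proof (cases "n < l")
      case True
      have "0 \<le> real n * \<rho> $ y" "real n * \<rho> $ y \<le> real n * 1"
        using prob_vectorsD(1,2)[OF \<rho>p, of y] by (simp_all add: mult_left_le)
      moreover have "real (cnts w n y) \<le> real n" using cnts_le[of w n y] by simp
      ultimately show ?thesis using True unfolding abs_le_iff by auto
    next
      case False
      define k where "k = n - l"
      have n: "n = k + l" using False by (simp add: k_def)
      have "k < n" using l n by simp
      have "real (cnts w n y) - real n * \<rho> $ y = real (cnts w k y) - real k * \<rho> $ y"
        using cnts_periodic[of w l k y, OF per] l by (simp add: n \<rho>_def field_simps)
      then show ?thesis using less.IH[OF \<open>k < n\<close>] by simp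
    qed
  qed
  have lim: "(\<lambda>n. (1 / real (n + 1)) *\<^sub>R cvec (cnts w (n + 1))) \<longlonglongrightarrow> \<rho>"
  proof (rule vec_tendstoI)
    fix y
    have z: "(\<lambda>n. real l / real (n + 1)) \<longlonglongrightarrow> 0" by real_asymp
    have "(\<lambda>n. ((1 / real (n + 1)) *\<^sub>R cvec (cnts w (n + 1))) $ y - \<rho> $ y) \<longlonglongrightarrow> 0"
    proof (rule Lim_null_comparison[OF always_eventually z], rule allI)
      fix n
      have "((1 / real (n + 1)) *\<^sub>R cvec (cnts w (n + 1))) $ y - \<rho> $ y = (real (cnts w (n + 1) y) - real (n + 1) * \<rho> $ y) / real (n + 1)"
        by (simp add: diff_divide_distrib)
      then show "norm (((1 / real (n + 1)) *\<^sub>R cvec (cnts w (n + 1))) $ y - \<rho> $ y) \<le> real l / real (n + 1)"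
        using close[of "n + 1" y] by (simp add: divide_right_mono del: of_nat_Suc of_nat_add)
    qed
    then show "(\<lambda>n. ((1 / real (n + 1)) *\<^sub>R cvec (cnts w (n + 1))) $ y) \<longlonglongrightarrow> \<rho> $ y"
      by (simp only: LIM_zero_iff)
  qed
  have "lower_rate K x0 \<rho> (- ln \<beta>)"
    unfolding lower_rate_def
  proof (intro allI impI)
    fix r :: real assume r: "0 < r"
    have "\<forall>\<^sub>F n in sequentially. dist ((1 / real (n + 1)) *\<^sub>R cvec (cnts w (n + 1))) \<rho> < r"
      using r by (intro tendstoD[OF lim])
    then show "\<forall>\<^sub>F n in sequentially. exp (- (- ln \<beta> + r) * real n) \<le> emp_prob K x0 n (ball \<rho> r)"
    proof eventually_elim
      case (elim n)
      have "exp (- (- ln \<beta> + r) * real n) \<le> exp (real n * ln \<beta>)" using r by (simp add: algebra_simps)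
      also have "\<dots> = \<beta> ^ n" using \<beta> by (simp add: exp_of_nat_mult)
      also have "\<dots> \<le> count_prob K x0 n (cnts w (n + 1))" using lower[of n] by simp
      also have "\<dots> \<le> emp_prob K x0 n (ball \<rho> r)"
        unfolding emp_prob_def
      proof (rule member_le_sum)
        show "cnts w (n + 1) \<in> {N \<in> grid n. (1 / real (n + 1)) *\<^sub>R cvec N \<in> ball \<rho> r}"
          using elim cnts_le[of w "n + 1"] by (auto simp: in_grid dist_commute)
      qed (use finite_grid(1)[of n] count_prob_nonneg[OF K] in \<open>auto intro: finite_subset\<close>)
      finally show ?case .
    qed
  qed
  moreover have "0 \<le> - ln \<beta>" using \<beta> by (simp add: ln_le_zero_iff)
  ultimately show thesis using that \<rho>p \<rho>0 by blast
qed

subsection \<open>From controls to lower bounds\<close>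

text \<open>The substitution \<open>u = exp (- r)\<close> turns the exponential law into the uniform
  law on [0, 1], and \<open>late u\<close> is the event that the uniform variable is at most
  \<open>u\<close>. Written with \<open>exp\<close> rather than \<open>ln\<close>, it is correct,
  namely empty, at \<open>u = 0\<close>.\<close>

definition late :: "real \<Rightarrow> real set" where
  "late u = {r. exp (- r) \<le> u}"

lemma late_sets[measurable]: "late u \<in> sets borel"
  unfolding late_def by measurable

lemma late_exp: "late (exp (- s)) = {s..}"
  by (auto simp: late_def)

lemma measure_late:
  assumes "0 \<le> u" "u \<le> 1"
  shows "measure expd (late u) = u"
proof (cases "u = 0")
  case True
  then have "late u = {}" by (auto simp: late_def not_le)
  then show ?thesis using True by simp
next
  case False
  then have "u = exp (- (- ln u))" using assms by simp
  then have "measure expd (late u) = measure expd {- ln u..}" by (metis late_exp)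
  also have "\<dots> = u" using assms False by (subst measure_expd_atLeast) auto
  finally show ?thesis .
qed

lemma late_mono: "u \<le> u' \<Longrightarrow> late u \<subseteq> late u'"
  by (auto simp: late_def)

lemma measure_late_diff:
  assumes "0 \<le> u" "u \<le> u'" "u' \<le> 1"
  shows "measure expd (late u' - late u) = u' - u"
  using assms by (subst expd.finite_measure_Diff) (auto simp: measure_late late_mono)

lemma prob_integrable:
  fixes f :: "real \<Rightarrow> real ^ 'd::finite"
  assumes [measurable]: "f \<in> borel_measurable borel" "A \<in> sets borel" and f: "\<And>r. f r \<in> prob_vectors"
  shows "integrable expd (\<lambda>r. f r $ y * indicator A r)"
  using prob_vectorsD[OF f] by (intro expd_bounded_integrable[where B=1]) (auto simp: indicator_def)

lemma prob_integral_sum: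
  fixes f :: "real \<Rightarrow> real ^ 'd::finite"
  assumes "f \<in> borel_measurable borel" "A \<in> sets borel" and f: "\<And>r. f r \<in> prob_vectors"
  shows "(\<Sum>y\<in>UNIV. \<integral>r. f r $ y * indicator A r \<partial>expd) = measure expd A"
proof -
  have "(\<Sum>y\<in>UNIV. \<integral>r. f r $ y * indicator A r \<partial>expd) = (\<integral>r. (\<Sum>y\<in>UNIV. f r $ y * indicator A r) \<partial>expd)"
    by (intro Bochner_Integration.integral_sum[symmetric] prob_integrable assms)
  also have "\<dots> = (\<integral>r. indicator A r \<partial>expd)"
    by (simp only: sum_distrib_right[symmetric] prob_vectorsD(3)[OF f] mult_1)
  finally show ?thesis by simp
qed

text \<open>Integrands such as \<open>aff s\<close> may be negative; truncation by
  \<open>ennreal\<close> can only increase the right-hand side.\<close>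

lemma ennreal_integral_le_nn_integral:
  fixes h :: "real \<Rightarrow> real"
  assumes h: "integrable M h"
  shows "ennreal (integral\<^sup>L M h) \<le> (\<integral>\<^sup>+r. ennreal (h r) \<partial>M)"
proof -
  have "integral\<^sup>L M h \<le> (\<integral>r. max 0 (h r) \<partial>M)"
    using h by (intro integral_mono) auto
  then have "ennreal (integral\<^sup>L M h) \<le> ennreal (\<integral>r. max 0 (h r) \<partial>M)" by (rule ennreal_leI)
  also have "\<dots> = (\<integral>\<^sup>+r. ennreal (max 0 (h r)) \<partial>M)"
    using h by (intro nn_integral_eq_integral[symmetric]) auto
  also have "\<dots> = (\<integral>\<^sup>+r. ennreal (h r) \<partial>M)" by (simp add: ennreal_max_0)
  finally show ?thesis .
qed

definition avg :: "real set \<Rightarrow> (real \<Rightarrow> real ^ 'd::finite) \<Rightarrow> real ^ 'd" where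
  "avg A f = (\<chi> y. (\<integral>r. f r $ y * indicator A r \<partial>expd) / measure expd A)"

lemma avg_prob:
  fixes f :: "real \<Rightarrow> real ^ 'd::finite"
  assumes [measurable]: "f \<in> borel_measurable borel" "A \<in> sets borel" and f: "\<And>r. f r \<in> prob_vectors"
    and A: "0 < measure expd A"
  shows "avg A f \<in> prob_vectors"
proof -
  have "(\<Sum>y\<in>UNIV. avg A f $ y) = measure expd A / measure expd A"
    unfolding avg_def vec_lambda_beta sum_divide_distrib[symmetric] prob_integral_sum[OF assms(1-3)] ..
  then have "(\<Sum>y\<in>UNIV. avg A f $ y) = 1" using A by simp
  moreover have "0 \<le> avg A f $ y" for y
    unfolding avg_def using prob_vectorsD(1)[OF f] by (auto intro!: divide_nonneg_nonneg Bochner_Integration.integral_nonneg)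
  ultimately show ?thesis by (simp add: prob_vectors_def)
qed

text \<open>Averaging commutes with \<open>aff s\<close> by linearity; the inequality therefore
  holds for every test vector and then for the supremum.\<close>

lemma rent_Jensen:
  fixes f g :: "real \<Rightarrow> real ^ 'd::finite"
  assumes f[measurable]: "f \<in> borel_measurable borel" and g[measurable]: "g \<in> borel_measurable borel"
    and A[measurable]: "A \<in> sets borel"
    and fp: "\<And>r. f r \<in> prob_vectors" and gp: "\<And>r. g r \<in> prob_vectors" and wA: "0 < measure expd A"
  shows "ennreal (measure expd A) * rent (avg A f) (avg A g) \<le> (\<integral>\<^sup>+r. rent (f r) (g r) * indicator A r \<partial>expd)"
proof -
  define w where "w = measure expd A"
  have w: "0 < w" using wA by (simp add: w_def)
  let ?X = "\<integral>\<^sup>+r. rent (f r) (g r) * indicator A r \<partial>expd"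
  have "rent (avg A f) (avg A g) \<le> ennreal (1 / w) * ?X"
  proof (rule rent_leI[OF avg_prob[OF f A fp wA] avg_prob[OF g A gp wA]])
    fix s
    have If: "integrable expd (\<lambda>r. f r $ y * indicator A r)" and Ig: "integrable expd (\<lambda>r. g r $ y * indicator A r)" for y
      by (rule prob_integrable[OF f A fp], rule prob_integrable[OF g A gp])
    have "aff s (f r) (g r) * indicator A r =
        (\<Sum>y\<in>UNIV. f r $ y * indicator A r * s $ y - g r $ y * indicator A r * (exp (s $ y) - 1))" for r
      unfolding aff_def sum_distrib_right by (intro sum.cong) (auto simp: algebra_simps)
    then have I: "integrable expd (\<lambda>r. aff s (f r) (g r) * indicator A r)"
      and "(\<integral>r. aff s (f r) (g r) * indicator A r \<partial>expd) =
        (\<Sum>y\<in>UNIV. (\<integral>r. f r $ y * indicator A r \<partial>expd) * s $ y - (\<integral>r. g r $ y * indicator A r \<partial>expd) * (exp (s $ y) - 1))"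
      using If Ig by simp_all
    then have "(1 / w) * (\<integral>r. aff s (f r) (g r) * indicator A r \<partial>expd) = aff s (avg A f) (avg A g)"
      unfolding aff_def by (simp add: avg_def w_def sum_distrib_left diff_divide_distrib flip: sum_divide_distrib)
    then have "ennreal (aff s (avg A f) (avg A g)) = ennreal (1 / w) * ennreal (\<integral>r. aff s (f r) (g r) * indicator A r \<partial>expd)"
      using w by (metis ennreal_mult' less_imp_le zero_less_divide_1_iff)
    also have "\<dots> \<le> ennreal (1 / w) * (\<integral>\<^sup>+r. ennreal (aff s (f r) (g r) * indicator A r) \<partial>expd)"
      by (intro mult_left_mono ennreal_integral_le_nn_integral I) auto
    also have "\<dots> \<le> ennreal (1 / w) * ?X"
      by (intro mult_left_mono nn_integral_mono) (auto simp: indicator_def intro: aff_le_rent fp gp)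
    finally show "ennreal (aff s (avg A f) (avg A g)) \<le> ennreal (1 / w) * ?X" .
  qed
  then have "ennreal w * rent (avg A f) (avg A g) \<le> ennreal w * (ennreal (1 / w) * ?X)"
    by (intro mult_left_mono) auto
  also have "\<dots> = ?X" using w by (simp add: mult.assoc[symmetric] ennreal_mult[symmetric])
  finally show ?thesis by (simp add: w_def)
qed

text \<open>The chain is made to follow a periodic walk with occupation law \<open>\<rho>\<close> for a fraction \<open>\<epsilon>\<close> of the
  time and then to track the path \<open>(1 - \<epsilon>) S\<close>, where \<open>S u = u M (- ln u)\<close>, in \<open>B\<close> blocks. At the start of
  block \<open>j\<close> the elapsed fraction of time is \<open>t j\<close> and the occupation is \<open>numer j\<close>.\<close>

locale blocks =
  fixes K :: "real ^ 'd::finite ^ 'd" and x0 :: 'd and \<rho> :: "real ^ 'd" and C \<kappa> \<epsilon> c :: real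
    and \<sigma> :: "real \<Rightarrow> real ^ 'd" and B :: nat
  assumes K: "K \<in> transition_kernels" and \<rho>: "\<rho> \<in> prob_vectors" and C: "0 \<le> C" and lower_rate\<rho>: "lower_rate K x0 \<rho> C"
    and \<kappa>: "0 < \<kappa>" "\<And>y. \<kappa> \<le> (\<rho> v* K) $ y" and \<epsilon>: "0 < \<epsilon>" "\<epsilon> < 1" and B: "0 < B"
    and \<sigma>: "\<sigma> \<in> ctrl" and c: "0 \<le> c" "cost K \<sigma> \<le> ennreal c"
begin

definition S :: "real \<Rightarrow> real ^ 'd" where
  "S u = (\<chi> x. \<integral>r. \<sigma> r $ x * indicator (late u) r \<partial>expd)"

definition blk :: "nat \<Rightarrow> real set" where
  "blk j = late (real (Suc j) / real B) - late (real j / real B)"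

definition numer :: "nat \<Rightarrow> real ^ 'd" where
  "numer j = \<epsilon> *\<^sub>R \<rho> + (1 - \<epsilon>) *\<^sub>R S (real j / real B)"

definition t :: "nat \<Rightarrow> real" where
  "t j = \<epsilon> + (1 - \<epsilon>) * (real j / real B)"

text \<open>Occupation at the start of the block divided by the elapsed time at its end, hence a
  lower bound for the transition law throughout the block and the form in which
  \<open>lower_rate_step\<close> delivers it.\<close>

definition Q :: "nat \<Rightarrow> 'd \<Rightarrow> real" where
  "Q j y = (numer j v* K) $ y / t (Suc j)"

definition \<eta> :: "nat \<Rightarrow> real ^ 'd" where
  "\<eta> j = avg (blk j) \<sigma>"

text \<open>The share of the initial walk among the samples drawn when the control is at time
  \<open>s\<close>, and so the weight of \<rho> in the regularised occupation.\<close>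

definition wt :: "real \<Rightarrow> real" where
  "wt s = \<epsilon> / (\<epsilon> + (1 - \<epsilon>) * exp (- s))"

definition g :: "real \<Rightarrow> real ^ 'd" where
  "g s = (wt s *\<^sub>R \<rho> + (1 - wt s) *\<^sub>R occ \<sigma> s) v* K"

text \<open>The largest logarithmic gap between the law \<open>g\<close> inside a block and its
  lower bound \<open>Q\<close>. One factor comes from the numerator, one from the denominator; with
  \<epsilon> fixed it vanishes as \<open>B\<close> grows.\<close>

definition excess :: real where
  "excess = ln ((1 + 1 / (real B * (\<epsilon> * \<kappa>))) * (1 + 1 / (real B * \<epsilon>)))"

lemma \<sigma>_meas[measurable]: "\<sigma> \<in> borel_measurable borel"
  by (rule ctrl_measurable[OF \<sigma>])

lemma blk_sets[measurable]: "blk j \<in> sets borel"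
  unfolding blk_def by measurable

lemma S_exp: "0 \<le> s \<Longrightarrow> S (exp (- s)) = exp (- s) *\<^sub>R occ \<sigma> s"
  unfolding S_def late_exp occ_def vec_eq_iff
  by (simp add: integral_expd_shift[where B=1] ctrl_nonneg[OF \<sigma>] ctrl_le1[OF \<sigma>] add.commute)

lemma S_diff:
  assumes "u \<le> u'"
  shows "S u' $ x - S u $ x = (\<integral>r. \<sigma> r $ x * indicator (late u' - late u) r \<partial>expd)"
proof -
  have "S u' $ x - S u $ x = (\<integral>r. \<sigma> r $ x * indicator (late u') r - \<sigma> r $ x * indicator (late u) r \<partial>expd)"
    unfolding S_def by (simp add: prob_integrable ctrl_prob[OF \<sigma>])
  also have "\<dots> = (\<integral>r. \<sigma> r $ x * indicator (late u' - late u) r \<partial>expd)"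
    using late_mono[OF assms] by (intro Bochner_Integration.integral_cong) (auto simp: indicator_def)
  finally show ?thesis .
qed

lemma S_mono: "u \<le> u' \<Longrightarrow> S u $ x \<le> S u' $ x"
proof -
  assume "u \<le> u'"
  note S_diff[OF this, of x]
  moreover have "0 \<le> (\<integral>r. \<sigma> r $ x * indicator (late u' - late u) r \<partial>expd)"
    by (rule Bochner_Integration.integral_nonneg) (simp add: ctrl_nonneg[OF \<sigma>])
  ultimately show ?thesis by linarith
qed

lemma S_sum:
  assumes "0 \<le> u" "u \<le> 1"
  shows "(\<Sum>x\<in>UNIV. S u $ x) = u"
proof -
  have "(\<Sum>x\<in>UNIV. S u $ x) = measure expd (late u)"
    unfolding S_def vec_lambda_beta by (intro prob_integral_sum ctrl_prob[OF \<sigma>]) auto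
  then show ?thesis using assms by (simp add: measure_late)
qed

lemma S_nonneg: "0 \<le> S u $ x"
  unfolding S_def by (simp add: ctrl_nonneg[OF \<sigma>])

lemma grid_bounds:
  assumes "j < B"
  shows "0 \<le> real j / real B" "real j / real B \<le> real (Suc j) / real B" "real (Suc j) / real B \<le> 1"
    "real (Suc j) / real B - real j / real B = 1 / real B"
  using assms by (auto simp: divide_right_mono divide_le_eq diff_divide_distrib[symmetric])

lemma measure_blk: "j < B \<Longrightarrow> measure expd (blk j) = 1 / real B"
  using grid_bounds[of j] unfolding blk_def by (simp only: measure_late_diff)

lemma \<eta>_eq: "j < B \<Longrightarrow> \<eta> j = real B *\<^sub>R (S (real (Suc j) / real B) - S (real j / real B))"
  using grid_bounds(2)[of j] by (simp add: \<eta>_def avg_def vec_eq_iff measure_blk S_diff blk_def[symmetric] del: of_nat_Suc)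

lemma \<eta>_prob: "j < B \<Longrightarrow> \<eta> j \<in> prob_vectors"
  unfolding \<eta>_def using B by (intro avg_prob ctrl_prob[OF \<sigma>]) (auto simp: measure_blk)

lemma t_pos: "0 < t j"
  unfolding t_def using \<epsilon> by (intro add_pos_nonneg mult_nonneg_nonneg) auto

lemma t_ge: "\<epsilon> \<le> t j"
  unfolding t_def using \<epsilon> by simp

lemma t_Suc: "t (Suc j) = t j + (1 - \<epsilon>) / real B"
  unfolding t_def by (simp add: add_divide_distrib distrib_left)

lemma numer_ge: "\<epsilon> * \<kappa> \<le> (numer j v* K) $ y"
proof -
  have "(numer j v* K) $ y = \<epsilon> * (\<rho> v* K) $ y + (1 - \<epsilon>) * (S (real j / real B) v* K) $ y"
    by (simp add: numer_def vec_kernel_linear)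
  moreover have "\<epsilon> * \<kappa> \<le> \<epsilon> * (\<rho> v* K) $ y" using \<kappa>(2) \<epsilon> by (intro mult_left_mono) auto
  moreover have "0 \<le> (1 - \<epsilon>) * (S (real j / real B) v* K) $ y"
    using \<epsilon> by (auto simp: vec_kernel_nth S_nonneg kernelD[OF K] intro!: mult_nonneg_nonneg sum_nonneg)
  ultimately show ?thesis by linarith
qed

lemma numer_pos: "0 < (numer j v* K) $ y"
  using numer_ge[of j y] \<epsilon>(1) \<kappa>(1) by (meson less_le_trans mult_pos_pos)

lemma Q_pos: "0 < Q j y"
  unfolding Q_def using numer_pos t_pos by simp

definition Dsum :: "nat \<Rightarrow> real" where
  "Dsum j = (\<Sum>y\<in>UNIV. \<eta> j $ y * ln (\<eta> j $ y / Q j y))"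

text \<open>One application of \<open>lower_rate_step\<close> per block. Occupation and cost become
  additive after multiplication by the elapsed time, which explains the common divisor
  \<open>t j\<close>.\<close>

lemma lower_rate_blocks:
  "j \<le> B \<Longrightarrow> lower_rate K x0 ((1 / t j) *\<^sub>R numer j) ((\<epsilon> * C + (1 - \<epsilon>) / real B * (\<Sum>i<j. Dsum i)) / t j)"
proof (induction j)
  case 0
  have "late 0 = {}" by (auto simp: late_def not_le)
  then have "S 0 = 0" by (simp add: S_def vec_eq_iff)
  then show ?case using lower_rate\<rho> \<epsilon> by (simp add: t_def numer_def)
next
  case (Suc j)
  \<comment> \<open>The share of block \<open>j\<close> among the samples drawn by its end.\<close>
  define \<theta> where "\<theta> = 1 - t j / t (Suc j)"
  have j: "j < B" using Suc.prems by simp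
  have tS: "t j < t (Suc j)" unfolding t_Suc using \<epsilon> B by simp
  have \<theta>: "0 < \<theta>" "\<theta> < 1" "1 - \<theta> = t j / t (Suc j)" using tS t_pos[of j] t_pos[of "Suc j"] by (auto simp: \<theta>_def)
  have \<theta>': "\<theta> = (1 - \<epsilon>) / real B / t (Suc j)"
    using t_pos[of "Suc j"] t_Suc[of j] by (simp add: \<theta>_def field_simps)
  let ?m = "(1 / t j) *\<^sub>R numer j"
  have mK: "(?m v* K) $ y = (numer j v* K) $ y / t j" for y
    by (simp add: vec_kernel_nth sum_divide_distrib)
  have pos: "0 < (?m v* K) $ y" for y unfolding mK using numer_pos t_pos by simp
  have QK: "(1 - \<theta>) * (?m v* K) $ y = Q j y" for y
    unfolding mK \<theta>(3) Q_def using t_pos[of j] by simp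
  have IH: "lower_rate K x0 ?m ((\<epsilon> * C + (1 - \<epsilon>) / real B * (\<Sum>i<j. Dsum i)) / t j)"
    using Suc.IH Suc.prems by simp
  have m': "(1 - \<theta>) *\<^sub>R ?m + \<theta> *\<^sub>R \<eta> j = (1 / t (Suc j)) *\<^sub>R numer (Suc j)"
  proof -
    have "numer (Suc j) = numer j + ((1 - \<epsilon>) / real B) *\<^sub>R \<eta> j"
    proof -
      have "((1 - \<epsilon>) / real B) *\<^sub>R \<eta> j = (1 - \<epsilon>) *\<^sub>R (S (real (Suc j) / real B) - S (real j / real B))"
        unfolding \<eta>_eq[OF j] using B by simp
      then show ?thesis by (simp only: numer_def scaleR_diff_right) simp
    qed
    moreover have "(1 - \<theta>) *\<^sub>R ?m = (1 / t (Suc j)) *\<^sub>R numer j" unfolding \<theta>(3) using t_pos[of j] by simp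
    moreover have "\<theta> *\<^sub>R \<eta> j = (1 / t (Suc j)) *\<^sub>R (((1 - \<epsilon>) / real B) *\<^sub>R \<eta> j)" unfolding \<theta>' by simp
    ultimately show ?thesis by (simp only: scaleR_add_right)
  qed
  have c': "(1 - \<theta>) * ((\<epsilon> * C + (1 - \<epsilon>) / real B * (\<Sum>i<j. Dsum i)) / t j) + \<theta> * Dsum j =
      (\<epsilon> * C + (1 - \<epsilon>) / real B * (\<Sum>i<Suc j. Dsum i)) / t (Suc j)"
  proof -
    have "(1 - \<theta>) * (a / t j) = a / t (Suc j)" for a unfolding \<theta>(3) using t_pos[of j] by simp
    moreover have "\<theta> * Dsum j = ((1 - \<epsilon>) / real B * Dsum j) / t (Suc j)" unfolding \<theta>' by simp
    ultimately show ?thesis by (simp only: sum.lessThan_Suc distrib_left add_divide_distrib add.assoc)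
  qed
  show ?case
    using lower_rate_step[OF K IH \<eta>_prob[OF j] \<theta>(1,2) pos] unfolding QK Dsum_def[symmetric] m' c' .
qed

lemma wt_bounds: "0 < wt s" "wt s < 1"
  unfolding wt_def using \<epsilon> by (auto simp: add_pos_pos)

lemma g_prob: "g s \<in> prob_vectors"
  unfolding g_def using wt_bounds[of s] prob_vectors_convex \<rho> occ_prob[OF \<sigma>]
  by (intro vec_kernel_prob K) (auto simp: convex_def)

lemma wt_meas[measurable]: "wt \<in> borel_measurable borel"
  unfolding wt_def by measurable

lemma g_meas[measurable]: "g \<in> borel_measurable borel"
  unfolding g_def using occ_measurable[OF \<sigma>] by measurable

lemma g_eq:
  assumes "0 \<le> s"
  shows "g s $ y = ((\<epsilon> *\<^sub>R \<rho> + (1 - \<epsilon>) *\<^sub>R S (exp (- s))) v* K) $ y / (\<epsilon> + (1 - \<epsilon>) * exp (- s))"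
proof -
  have d: "0 < \<epsilon> + (1 - \<epsilon>) * exp (- s)" using \<epsilon> by (simp add: add_pos_pos)
  then have "1 - wt s = (1 - \<epsilon>) * exp (- s) / (\<epsilon> + (1 - \<epsilon>) * exp (- s))"
    unfolding wt_def by (simp add: field_simps)
  then show ?thesis
    unfolding g_def S_exp[OF assms] vec_kernel_linear by (simp add: wt_def add_divide_distrib)
       (simp add: vec_kernel_nth sum_distrib_left mult.assoc)
qed

text \<open>Within a block numerator and denominator change by at most \<open>1 / B\<close>.
  Relative to their lower bounds \<open>\<epsilon> * \<kappa>\<close> and \<epsilon> this yields the
  two factors of \<open>excess\<close>.\<close>

lemma g_bounds:
  assumes j: "j < B" and s: "s \<in> blk j"
  shows "g s $ y \<le> exp excess * Q j y" "\<epsilon> * \<kappa> \<le> g s $ y"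
proof -
  define u where "u = exp (- s)"
  have u: "real j / real B < u" "u \<le> real (Suc j) / real B" using s by (auto simp: blk_def late_def u_def)
  have u1: "u \<le> 1" using u grid_bounds(3)[OF j] by linarith
  have s0: "0 \<le> s" using u1 by (simp add: u_def)
  have d: "t j \<le> \<epsilon> + (1 - \<epsilon>) * u" unfolding t_def using u \<epsilon> by (intro add_left_mono mult_left_mono) auto
  have d0: "0 < \<epsilon> + (1 - \<epsilon>) * u" using d t_pos[of j] by linarith
  have d1: "\<epsilon> + (1 - \<epsilon>) * u \<le> 1"
  proof -
    have "(1 - \<epsilon>) * u \<le> (1 - \<epsilon>) * 1" using u1 \<epsilon> by (intro mult_left_mono) auto
    then show ?thesis by simp
  qed
  define nu where "nu = ((\<epsilon> *\<^sub>R \<rho> + (1 - \<epsilon>) *\<^sub>R S u) v* K) $ y"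
  have gy: "g s $ y = nu / (\<epsilon> + (1 - \<epsilon>) * u)" unfolding nu_def u_def by (rule g_eq[OF s0])
  have ek: "0 < \<epsilon> * \<kappa>" using \<epsilon> \<kappa> by simp
  have inc: "(S u v* K) $ y \<le> (S (real j / real B) v* K) $ y + 1 / real B"
  proof -
    have "(S u v* K) $ y - (S (real j / real B) v* K) $ y = (\<Sum>z\<in>UNIV. (S u $ z - S (real j / real B) $ z) * K $ z $ y)"
      by (simp add: vec_kernel_nth sum_subtractf left_diff_distrib)
    also have "\<dots> \<le> (\<Sum>z\<in>UNIV. (S u $ z - S (real j / real B) $ z) * 1)"
      using S_mono[of "real j / real B" u] u kernelD[OF K] by (intro sum_mono mult_left_mono) auto
    also have "\<dots> = u - real j / real B"
    proof -
      have "0 \<le> u" by (simp add: u_def)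
      moreover have "real j / real B \<le> 1" using u u1 by linarith
      ultimately show ?thesis using S_sum[of u] S_sum[of "real j / real B"] u1 grid_bounds(1)[OF j]
        by (simp add: sum_subtractf)
    qed
    also have "\<dots> \<le> 1 / real B" using u grid_bounds(4)[OF j] by linarith
    finally show ?thesis by linarith
  qed
  have nu_eq: "nu = \<epsilon> * (\<rho> v* K) $ y + (1 - \<epsilon>) * (S u v* K) $ y" by (simp add: nu_def vec_kernel_linear)
  have nj_eq: "(numer j v* K) $ y = \<epsilon> * (\<rho> v* K) $ y + (1 - \<epsilon>) * (S (real j / real B) v* K) $ y"
    by (simp add: numer_def vec_kernel_linear)
  have "nu \<le> (numer j v* K) $ y + 1 / real B"
  proof -
    have "(1 - \<epsilon>) * (S u v* K) $ y \<le> (1 - \<epsilon>) * ((S (real j / real B) v* K) $ y + 1 / real B)"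
      using inc \<epsilon> by (intro mult_left_mono) auto
    moreover have "(1 - \<epsilon>) * (1 / real B) \<le> 1 / real B" using \<epsilon> by (intro mult_left_le_one_le) auto
    ultimately show ?thesis unfolding nu_eq nj_eq by (simp only: distrib_left)
  qed
  also have "\<dots> \<le> (numer j v* K) $ y * (1 + 1 / (real B * (\<epsilon> * \<kappa>)))"
  proof -
    have "1 / real B = \<epsilon> * \<kappa> * (1 / (real B * (\<epsilon> * \<kappa>)))" using ek \<epsilon> \<kappa> by simp
    also have "\<dots> \<le> (numer j v* K) $ y * (1 / (real B * (\<epsilon> * \<kappa>)))"
      using numer_ge ek by (intro mult_right_mono) auto
    finally show ?thesis by (simp add: distrib_left)
  qed
  finally have nu_le: "nu \<le> (numer j v* K) $ y * (1 + 1 / (real B * (\<epsilon> * \<kappa>)))" .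
  have den: "1 / (\<epsilon> + (1 - \<epsilon>) * u) \<le> (1 + 1 / (real B * \<epsilon>)) / t (Suc j)"
  proof -
    have "t (Suc j) \<le> t j + 1 / real B" unfolding t_Suc using \<epsilon> B by (simp add: divide_right_mono)
    also have "\<dots> \<le> t j * (1 + 1 / (real B * \<epsilon>))"
    proof -
      have "1 / real B = \<epsilon> * (1 / (real B * \<epsilon>))" using \<epsilon> by simp
      also have "\<dots> \<le> t j * (1 / (real B * \<epsilon>))" using t_ge \<epsilon> by (intro mult_right_mono) auto
      finally show ?thesis by (simp add: distrib_left)
    qed
    also have "\<dots> \<le> (\<epsilon> + (1 - \<epsilon>) * u) * (1 + 1 / (real B * \<epsilon>))"
      using d \<epsilon> by (intro mult_right_mono) auto
    finally show ?thesis using d0 t_pos[of "Suc j"] by (simp add: field_simps)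
  qed
  have ex: "exp excess = (1 + 1 / (real B * (\<epsilon> * \<kappa>))) * (1 + 1 / (real B * \<epsilon>))"
    unfolding excess_def using \<epsilon> \<kappa> by (intro exp_ln mult_pos_pos) (auto intro!: add_pos_nonneg)
  have "g s $ y = nu * (1 / (\<epsilon> + (1 - \<epsilon>) * u))" by (simp add: gy)
  also have "\<dots> \<le> ((numer j v* K) $ y * (1 + 1 / (real B * (\<epsilon> * \<kappa>)))) * ((1 + 1 / (real B * \<epsilon>)) / t (Suc j))"
    using nu_le den numer_pos[of j y] d0 \<epsilon> \<kappa> by (intro mult_mono) auto
  also have "\<dots> = exp excess * Q j y" unfolding ex Q_def by simp
  finally show "g s $ y \<le> exp excess * Q j y" .
  have "\<epsilon> * \<kappa> \<le> nu"
  proof -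
    have "0 \<le> (1 - \<epsilon>) * (S u v* K) $ y"
      using \<epsilon> by (auto simp: vec_kernel_nth S_nonneg kernelD[OF K] intro!: mult_nonneg_nonneg sum_nonneg)
    moreover have "\<epsilon> * \<kappa> \<le> \<epsilon> * (\<rho> v* K) $ y" using \<kappa>(2) \<epsilon> by (intro mult_left_mono) auto
    ultimately show ?thesis unfolding nu_eq by linarith
  qed
  also have "nu \<le> g s $ y"
  proof -
    have "0 \<le> nu" using \<open>\<epsilon> * \<kappa> \<le> nu\<close> ek by linarith
    then have "nu / 1 \<le> nu / (\<epsilon> + (1 - \<epsilon>) * u)" using d0 d1 by (intro divide_left_mono) auto
    then show ?thesis by (simp add: gy)
  qed
  finally show "\<epsilon> * \<kappa> \<le> g s $ y" .
qed

lemma blk_avg_bounds: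
  assumes j: "j < B"
  shows "avg (blk j) g $ y \<le> exp excess * Q j y" "\<epsilon> * \<kappa> \<le> avg (blk j) g $ y"
proof -
  have B0: "0 < measure expd (blk j)" using B by (simp add: measure_blk[OF j])
  have I: "integrable expd (\<lambda>r. g r $ y * indicator (blk j) r)" by (intro prob_integrable g_prob) auto
  have Ic: "integrable expd (\<lambda>r. a * indicator (blk j) r)" for a :: real
    by (rule expd_bounded_integrable[where B="\<bar>a\<bar>"]) (auto simp: indicator_def)
  have "(\<integral>r. g r $ y * indicator (blk j) r \<partial>expd) \<le> (\<integral>r. exp excess * Q j y * indicator (blk j) r \<partial>expd)"
    using g_bounds(1)[OF j] by (intro integral_mono I Ic) (auto simp: indicator_def)
  then show "avg (blk j) g $ y \<le> exp excess * Q j y" using B0 by (simp add: avg_def pos_divide_le_eq)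
  have "(\<integral>r. \<epsilon> * \<kappa> * indicator (blk j) r \<partial>expd) \<le> (\<integral>r. g r $ y * indicator (blk j) r \<partial>expd)"
    using g_bounds(2)[OF j] by (intro integral_mono I Ic) (auto simp: indicator_def)
  then show "\<epsilon> * \<kappa> \<le> avg (blk j) g $ y" using B0 by (simp add: avg_def pos_le_divide_eq)
qed

definition R :: "nat \<Rightarrow> real" where
  "R j = (\<Sum>y\<in>UNIV. \<eta> j $ y * ln (\<eta> j $ y / avg (blk j) g $ y))"

text \<open>The law \<open>Q\<close> is exchanged for the block average of \<open>g\<close> at the
  price \<open>excess\<close>; Jensen's inequality then compares the block with its part of the cost
  integral.\<close>

lemma Dsum_le:
  assumes j: "j < B"
  shows "Dsum j \<le> R j + excess"
    and "ennreal (R j / real B) \<le> (\<integral>\<^sup>+r. rent (\<sigma> r) (g r) * indicator (blk j) r \<partial>expd)" "0 \<le> R j"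
proof -
  have ek: "0 < \<epsilon> * \<kappa>" using \<epsilon> \<kappa> by simp
  have B0: "0 < measure expd (blk j)" using B by (simp add: measure_blk[OF j])
  have qp: "avg (blk j) g \<in> prob_vectors" by (intro avg_prob g_prob B0) auto
  have q0: "0 < avg (blk j) g $ y" for y using blk_avg_bounds(2)[OF j, of y] ek by linarith
  note rr = rent_eq_sum[OF \<eta>_prob[OF j] qp q0, folded R_def]
  show "0 \<le> R j" by (rule rr(2))
  have "ennreal (R j / real B) = ennreal (measure expd (blk j)) * rent (avg (blk j) \<sigma>) (avg (blk j) g)"
    unfolding \<eta>_def[symmetric] rr(1) measure_blk[OF j] by (simp add: ennreal_mult'[symmetric])
  also have "\<dots> \<le> (\<integral>\<^sup>+r. rent (\<sigma> r) (g r) * indicator (blk j) r \<partial>expd)"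
    by (intro rent_Jensen ctrl_prob[OF \<sigma>] g_prob B0) auto
  finally show "ennreal (R j / real B) \<le> (\<integral>\<^sup>+r. rent (\<sigma> r) (g r) * indicator (blk j) r \<partial>expd)" .
  have "Dsum j \<le> (\<Sum>y\<in>UNIV. \<eta> j $ y * ln (\<eta> j $ y / avg (blk j) g $ y) + \<eta> j $ y * excess)"
    unfolding Dsum_def
  proof (rule sum_mono)
    fix y
    show "\<eta> j $ y * ln (\<eta> j $ y / Q j y) \<le> \<eta> j $ y * ln (\<eta> j $ y / avg (blk j) g $ y) + \<eta> j $ y * excess"
    proof (cases "\<eta> j $ y = 0")
      case False
      then have p: "0 < \<eta> j $ y" using prob_vectorsD(1)[OF \<eta>_prob[OF j], of y] by simp
      have "ln (avg (blk j) g $ y) \<le> ln (exp excess * Q j y)"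
        using blk_avg_bounds(1)[OF j] q0 Q_pos by (subst ln_le_cancel_iff) auto
      also have "\<dots> = excess + ln (Q j y)" using Q_pos by (simp add: ln_mult_pos)
      finally have "ln (\<eta> j $ y / Q j y) \<le> ln (\<eta> j $ y / avg (blk j) g $ y) + excess"
        using p q0 Q_pos by (simp add: ln_divide_pos)
      then show ?thesis using p by (simp add: mult_left_mono flip: distrib_left)
    qed simp
  qed
  also have "\<dots> = R j + excess"
    using prob_vectorsD(3)[OF \<eta>_prob[OF j]] by (simp add: R_def sum.distrib flip: sum_distrib_right)
  finally show "Dsum j \<le> R j + excess" .
qed

lemma R_sum:
  "j \<le> B \<Longrightarrow> ennreal (\<Sum>i<j. R i / real B) \<le> (\<integral>\<^sup>+r. rent (\<sigma> r) (g r) * indicator (late (real j / real B)) r \<partial>expd)"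
proof (induction j)
  case (Suc j)
  note [measurable] = rent_measurable[OF \<sigma>_meas g_meas ctrl_prob[OF \<sigma>] g_prob]
  have j: "j < B" using Suc.prems by simp
  have "0 \<le> (\<Sum>i<j. R i / real B)" "0 \<le> R j / real B"
    using Dsum_le(3) j by (auto intro!: sum_nonneg divide_nonneg_nonneg)
  then have "ennreal (\<Sum>i<Suc j. R i / real B) = ennreal (\<Sum>i<j. R i / real B) + ennreal (R j / real B)"
    by (simp only: sum.lessThan_Suc ennreal_plus)
  also have "\<dots> \<le> (\<integral>\<^sup>+r. rent (\<sigma> r) (g r) * indicator (late (real j / real B)) r \<partial>expd)
      + (\<integral>\<^sup>+r. rent (\<sigma> r) (g r) * indicator (blk j) r \<partial>expd)"
    using Suc by (intro add_mono Dsum_le(2) j) auto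
  also have "\<dots> = (\<integral>\<^sup>+r. rent (\<sigma> r) (g r) * indicator (late (real j / real B)) r + rent (\<sigma> r) (g r) * indicator (blk j) r \<partial>expd)"
    by (rule nn_integral_add[symmetric]) auto
  also have "\<dots> = (\<integral>\<^sup>+r. rent (\<sigma> r) (g r) * indicator (late (real (Suc j) / real B)) r \<partial>expd)"
    using late_mono[OF grid_bounds(2)[OF j]]
    by (intro nn_integral_cong) (auto simp: blk_def indicator_def simp del: of_nat_Suc)
  finally show ?case .
qed simp

text \<open>The weight is near 1 only at late control times, when the walk dominates the past.
  Splitting at the time \<open>h\<close> with \<open>exp (- h) = sqrt \<epsilon>\<close> bounds both
  parts by \<open>sqrt \<epsilon>\<close>.\<close>

lemma nn_integral_wt: "(\<integral>\<^sup>+s. ennreal (wt s) \<partial>expd) \<le> ennreal (2 * sqrt \<epsilon>)"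
proof -
  define h where "h = - ln (sqrt \<epsilon>)"
  have sq: "0 < sqrt \<epsilon>" "sqrt \<epsilon> < 1" using \<epsilon> by auto
  have h: "0 \<le> h" "exp (- h) = sqrt \<epsilon>" using sq by (auto simp: h_def)
  have "wt s \<le> sqrt \<epsilon> + indicator {h..} s" if "0 \<le> s" for s
  proof (cases "h \<le> s")
    case True
    then show ?thesis using wt_bounds(2)[of s] \<epsilon> by (simp add: indicator_def add_increasing)
  next
    case False
    have "sqrt \<epsilon> \<le> exp (- s)" using False unfolding h(2)[symmetric] by simp
    have e1: "exp (- s) \<le> 1" using that by simp
    have "exp (- s) \<le> \<epsilon> + (1 - \<epsilon>) * exp (- s)"
      using mult_left_mono[OF e1, of \<epsilon>] \<epsilon> by (simp add: algebra_simps)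
    then have "sqrt \<epsilon> \<le> \<epsilon> + (1 - \<epsilon>) * exp (- s)" using \<open>sqrt \<epsilon> \<le> exp (- s)\<close> by linarith
    then have "wt s \<le> \<epsilon> / sqrt \<epsilon>" unfolding wt_def using sq \<epsilon>
      by (intro divide_left_mono mult_pos_pos) (auto intro: add_pos_nonneg)
    also have "\<dots> = sqrt \<epsilon>" using \<epsilon> by (simp add: real_div_sqrt)
    finally show ?thesis by (simp add: indicator_def)
  qed
  note le = this
  have "(\<integral>\<^sup>+s. ennreal (wt s) \<partial>expd) \<le> (\<integral>\<^sup>+s. ennreal (sqrt \<epsilon>) + indicator {h..} s \<partial>expd)"
  proof (rule nn_integral_mono_AE, use AE_expd_nonneg in eventually_elim)
    case (elim s)
    have "ennreal (wt s) \<le> ennreal (sqrt \<epsilon> + indicator {h..} s)" by (intro ennreal_leI le elim)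
    also have "\<dots> = ennreal (sqrt \<epsilon>) + ennreal (indicator {h..} s)" using sq(1) by (intro ennreal_plus) auto
    finally show ?case by (simp only: ennreal_indicator)
  qed
  also have "\<dots> = ennreal (sqrt \<epsilon>) + emeasure expd {h..}"
    using expd.emeasure_space_1 by (subst nn_integral_add) auto
  also have "emeasure expd {h..} = ennreal (sqrt \<epsilon>)"
    using measure_expd_atLeast[OF h(1)] h(2) by (simp add: expd.emeasure_eq_measure)
  also have "ennreal (sqrt \<epsilon>) + ennreal (sqrt \<epsilon>) = ennreal (2 * sqrt \<epsilon>)"
    using sq by (simp flip: ennreal_plus)
  finally show ?thesis .
qed

text \<open>\<open>g s\<close> is a mixture of \<open>\<rho> v* K\<close> and
  \<open>occ \<sigma> s v* K\<close>. Convexity splits the entropy accordingly, and the part with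
  \<rho> is at most \<open>ln (1 / \<kappa>)\<close>.\<close>

lemma R_total: "(\<Sum>i<B. R i / real B) \<le> 2 * sqrt \<epsilon> * ln (1 / \<kappa>) + c"
proof -
  note [measurable] = rent_measurable[OF \<sigma>_meas g_meas ctrl_prob[OF \<sigma>] g_prob] cost_integrand_measurable[OF \<sigma> K]
  have rK: "\<rho> v* K \<in> prob_vectors" by (rule vec_kernel_prob[OF \<rho> K])
  have l: "rent (\<sigma> s) (\<rho> v* K) \<le> ennreal (ln (1 / \<kappa>))" "0 \<le> ln (1 / \<kappa>)" for s
    by (rule rent_le_ln[OF ctrl_prob[OF \<sigma>] rK \<kappa>])+
  have pt: "rent (\<sigma> s) (g s) \<le> ennreal (ln (1 / \<kappa>)) * ennreal (wt s) + rent (\<sigma> s) (occ \<sigma> s v* K)" for s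
  proof -
    have "rent (\<sigma> s) (g s) = rent (wt s *\<^sub>R \<sigma> s + (1 - wt s) *\<^sub>R \<sigma> s) (wt s *\<^sub>R (\<rho> v* K) + (1 - wt s) *\<^sub>R (occ \<sigma> s v* K))"
      unfolding g_def vec_kernel_linear by (simp flip: scaleR_add_left)
    also have "\<dots> \<le> ennreal (wt s) * rent (\<sigma> s) (\<rho> v* K) + ennreal (1 - wt s) * rent (\<sigma> s) (occ \<sigma> s v* K)"
      using wt_bounds[of s] by (intro rent_convex ctrl_prob[OF \<sigma>] rK vec_kernel_prob occ_prob[OF \<sigma>] K) auto
    also have "\<dots> \<le> ennreal (wt s) * ennreal (ln (1 / \<kappa>)) + 1 * rent (\<sigma> s) (occ \<sigma> s v* K)"
      using wt_bounds[of s] l by (intro add_mono mult_left_mono mult_right_mono) (auto simp: ennreal_le_1)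
    finally show ?thesis by (simp add: mult.commute)
  qed
  have "ennreal (\<Sum>i<B. R i / real B) \<le> (\<integral>\<^sup>+r. rent (\<sigma> r) (g r) * indicator (late (real B / real B)) r \<partial>expd)"
    by (rule R_sum) simp
  also have "\<dots> \<le> (\<integral>\<^sup>+r. ennreal (ln (1 / \<kappa>)) * ennreal (wt r) + rent (\<sigma> r) (occ \<sigma> r v* K) \<partial>expd)"
    using pt by (intro nn_integral_mono) (auto simp: indicator_def)
  also have "\<dots> = ennreal (ln (1 / \<kappa>)) * (\<integral>\<^sup>+r. ennreal (wt r) \<partial>expd) + cost K \<sigma>"
    unfolding cost_def by (subst nn_integral_add) (auto simp: nn_integral_cmult)
  also have "\<dots> \<le> ennreal (ln (1 / \<kappa>)) * ennreal (2 * sqrt \<epsilon>) + ennreal c"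
    by (intro add_mono mult_left_mono nn_integral_wt c) auto
  also have "\<dots> = ennreal (2 * sqrt \<epsilon> * ln (1 / \<kappa>) + c)"
    using l(2) c(1) \<epsilon> by (simp add: ennreal_mult[symmetric] mult.commute flip: ennreal_plus)
  finally show ?thesis using l(2) c(1) \<epsilon> by (subst (asm) ennreal_le_iff) auto
qed

lemma lower_rate_mix: "lower_rate K x0 (\<epsilon> *\<^sub>R \<rho> + (1 - \<epsilon>) *\<^sub>R occ \<sigma> 0)
    (\<epsilon> * C + (1 - \<epsilon>) / real B * (\<Sum>i<B. Dsum i))"
proof -
  have "S 1 = occ \<sigma> 0" using S_exp[of 0] by simp
  then show ?thesis using lower_rate_blocks[of B] B by (simp add: t_def numer_def)
qed

lemma Dsum_total: "(1 - \<epsilon>) / real B * (\<Sum>i<B. Dsum i) \<le> 2 * sqrt \<epsilon> * ln (1 / \<kappa>) + c + excess"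
proof -
  have ek: "0 < \<epsilon> * \<kappa>" using \<epsilon> \<kappa> by simp
  have "1 * 1 \<le> (1 + 1 / (real B * (\<epsilon> * \<kappa>))) * (1 + 1 / (real B * \<epsilon>))"
    using ek \<epsilon> by (intro mult_mono) auto
  then have ex: "0 \<le> excess" unfolding excess_def by (intro ln_ge_zero) simp
  have "(\<Sum>i<B. Dsum i) \<le> (\<Sum>i<B. R i + excess)" by (intro sum_mono Dsum_le) auto
  then have "1 / real B * (\<Sum>i<B. Dsum i) \<le> 1 / real B * (\<Sum>i<B. R i + excess)" by (intro mult_left_mono) auto
  also have "\<dots> = (\<Sum>i<B. R i / real B) + excess"
    using B by (simp add: sum.distrib sum_divide_distrib add_divide_distrib)
  also have "\<dots> \<le> 2 * sqrt \<epsilon> * ln (1 / \<kappa>) + c + excess" using R_total by simp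
  finally have a: "1 / real B * (\<Sum>i<B. Dsum i) \<le> 2 * sqrt \<epsilon> * ln (1 / \<kappa>) + c + excess" .
  have b: "0 \<le> 2 * sqrt \<epsilon> * ln (1 / \<kappa>) + c + excess"
  proof -
    have "0 \<le> (\<Sum>i<B. R i / real B)" by (intro sum_nonneg divide_nonneg_nonneg Dsum_le(3)) auto
    then show ?thesis using R_total ex by linarith
  qed
  have "(1 - \<epsilon>) / real B * (\<Sum>i<B. Dsum i) = (1 - \<epsilon>) * (1 / real B * (\<Sum>i<B. Dsum i))" by simp
  also have "\<dots> \<le> (1 - \<epsilon>) * (2 * sqrt \<epsilon> * ln (1 / \<kappa>) + c + excess)" using a \<epsilon> by (intro mult_left_mono) auto
  also have "\<dots> \<le> 2 * sqrt \<epsilon> * ln (1 / \<kappa>) + c + excess" using b \<epsilon> by (intro mult_left_le_one_le) auto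
  finally show ?thesis .
qed

end

text \<open>\<epsilon> is chosen first and the number of blocks afterwards, since
  \<open>excess\<close> contains \<open>1 / \<epsilon>\<close>.\<close>

lemma achievable_lower_rate:
  assumes K: "K \<in> transition_kernels" and \<rho>: "\<rho> \<in> prob_vectors" and C: "0 \<le> C" "lower_rate K x0 \<rho> C"
    and \<kappa>: "0 < \<kappa>" "\<And>y. \<kappa> \<le> (\<rho> v* K) $ y" and achievable: "achievable K m c"
  shows "lower_rate K x0 m c"
proof (rule lower_rate_closed[OF K])
  fix e :: real assume e: "0 < e"
  obtain \<sigma> where sig: "\<sigma> \<in> ctrl" "occ \<sigma> 0 = m" "cost K \<sigma> \<le> ennreal c" and c: "0 \<le> c"
    using achievable by (auto simp: achievable_def)
  have "((\<lambda>\<epsilon>. \<epsilon> * C + 2 * sqrt \<epsilon> * ln (1 / \<kappa>)) \<longlongrightarrow> 0) (at_right 0)" by real_asymp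
  then have "\<forall>\<^sub>F \<epsilon> in at_right 0. \<epsilon> * C + 2 * sqrt \<epsilon> * ln (1 / \<kappa>) < e / 2"
    using e by (intro order_tendstoD) auto
  moreover have "\<forall>\<^sub>F \<epsilon> in at_right 0. \<epsilon> \<in> {0<..<min 1 (e / 2)}"
    using e by (intro eventually_at_right_real) auto
  ultimately have "\<forall>\<^sub>F \<epsilon> in at_right 0. \<epsilon> * C + 2 * sqrt \<epsilon> * ln (1 / \<kappa>) < e / 2 \<and> \<epsilon> \<in> {0<..<min 1 (e / 2)}"
    by eventually_elim auto
  then obtain \<epsilon> where eps: "0 < \<epsilon>" "\<epsilon> < 1" "\<epsilon> < e / 2" "\<epsilon> * C + 2 * sqrt \<epsilon> * ln (1 / \<kappa>) < e / 2"
    using eventually_happens'[OF trivial_limit_at_right_real] by auto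
  have "(\<lambda>B. ln ((1 + 1 / (real B * (\<epsilon> * \<kappa>))) * (1 + 1 / (real B * \<epsilon>)))) \<longlonglongrightarrow> 0"
  proof -
    have "(\<lambda>B. 1 / (real B * a)) \<longlonglongrightarrow> 0" if "0 < a" for a :: real using that by real_asymp
    then have "(\<lambda>B. (1 + 1 / (real B * (\<epsilon> * \<kappa>))) * (1 + 1 / (real B * \<epsilon>))) \<longlonglongrightarrow> (1 + 0) * (1 + 0)"
      using eps \<kappa> by (intro tendsto_intros) auto
    from tendsto_ln[OF this] show ?thesis by simp
  qed
  then have "\<forall>\<^sub>F B in sequentially. ln ((1 + 1 / (real B * (\<epsilon> * \<kappa>))) * (1 + 1 / (real B * \<epsilon>))) < e / 2"
    using e by (intro order_tendstoD) auto
  with eventually_gt_at_top[of 0] have "\<forall>\<^sub>F B in sequentially. 0 < B \<and> ln ((1 + 1 / (real B * (\<epsilon> * \<kappa>))) * (1 + 1 / (real B * \<epsilon>))) < e / 2"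
    by (rule eventually_conj)
  then obtain B :: nat where nB: "0 < B" "ln ((1 + 1 / (real B * (\<epsilon> * \<kappa>))) * (1 + 1 / (real B * \<epsilon>))) < e / 2"
    by (auto dest!: eventually_happens)
  interpret blocks K x0 \<rho> C \<kappa> \<epsilon> c \<sigma> B
    using K \<rho> C \<kappa> eps nB sig c by unfold_locales auto
  have "dist (\<epsilon> *\<^sub>R \<rho> + (1 - \<epsilon>) *\<^sub>R m) m \<le> e"
  proof -
    have mp: "m \<in> prob_vectors" using occ_prob[OF sig(1), of 0] sig(2) by simp
    have "\<epsilon> *\<^sub>R \<rho> + (1 - \<epsilon>) *\<^sub>R m - m = \<epsilon> *\<^sub>R (\<rho> - m)" by (simp add: vec_eq_iff algebra_simps)
    then have "dist (\<epsilon> *\<^sub>R \<rho> + (1 - \<epsilon>) *\<^sub>R m) m = \<epsilon> * norm (\<rho> - m)" using \<open>0 < \<epsilon>\<close> by (simp add: dist_norm)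
    also have "\<dots> \<le> \<epsilon> * 2"
      using norm_triangle_ineq4[of \<rho> m] norm_prob_le1[OF \<rho>] norm_prob_le1[OF mp] \<open>0 < \<epsilon>\<close>
      by (intro mult_left_mono) auto
    finally show ?thesis using \<open>\<epsilon> < e / 2\<close> by simp
  qed
  moreover have "\<epsilon> * C + (1 - \<epsilon>) / real B * (\<Sum>i<B. Dsum i) \<le> c + e"
    using Dsum_total nB(2) \<open>\<epsilon> * C + 2 * sqrt \<epsilon> * ln (1 / \<kappa>) < e / 2\<close> unfolding excess_def by linarith
  ultimately show "\<exists>m' c'. lower_rate K x0 m' c' \<and> dist m' m \<le> e \<and> c' \<le> c + e"
    using lower_rate_mix unfolding sig(2) by blast
qed

subsection \<open>The integral equation\<close>

lemma ctrl_set_integrable: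
  assumes "\<sigma> \<in> ctrl"
  shows "set_integrable lborel {0..t} \<sigma>"
  unfolding set_integrable_def using norm_prob_le1[OF ctrl_prob[OF assms]] ctrl_measurable[OF assms]
  by (intro integrableI_bounded_set_indicator[where B=1]) (auto simp: emeasure_lborel_Icc_eq)

lemma nn_integral_bounded_Icc:
  fixes f :: "real \<Rightarrow> real"
  assumes [measurable]: "f \<in> borel_measurable borel" and f: "\<And>s. 0 \<le> f s" "\<And>s. f s \<le> 1"
  shows "(\<integral>\<^sup>+s. ennreal (f s) * indicator {0..t} s \<partial>lborel) = ennreal (integral {0..t} f)"
    and "0 \<le> integral {0..t} f"
proof -
  have I: "set_integrable lborel {0..t} f"
    unfolding set_integrable_def using f
    by (intro integrableI_bounded_set_indicator[where B=1]) (auto simp: emeasure_lborel_Icc_eq)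
  have "(\<integral>\<^sup>+s. ennreal (f s) * indicator {0..t} s \<partial>lborel) = (\<integral>\<^sup>+s. ennreal (indicator {0..t} s *\<^sub>R f s) \<partial>lborel)"
    by (intro nn_integral_cong) (auto simp: indicator_def)
  also have "\<dots> = ennreal (\<integral>s. indicator {0..t} s *\<^sub>R f s \<partial>lborel)"
    using I f unfolding set_integrable_def by (intro nn_integral_eq_integral) auto
  also have "(\<integral>s. indicator {0..t} s *\<^sub>R f s \<partial>lborel) = integral {0..t} f"
    using set_borel_integral_eq_integral(2)[OF I] by (simp add: set_lebesgue_integral_def)
  finally show "(\<integral>\<^sup>+s. ennreal (f s) * indicator {0..t} s \<partial>lborel) = ennreal (integral {0..t} f)" .
  show "0 \<le> integral {0..t} f" using set_borel_integral_eq_integral(1)[OF I] f by (intro integral_nonneg) auto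
qed

text \<open>The occupation at \<open>r\<close> is \<open>exp r\<close> times the integral of
  \<sigma> over \<open>s \<ge> r\<close>. After exchanging the integrals, integration of
  \<open>exp r\<close> up to \<open>min s t\<close> leaves the factor on the right.\<close>

lemma occ_integral_Fubini:
  assumes \<sigma>: "\<sigma> \<in> ctrl" and t: "0 \<le> t"
  shows "integral {0..t} (\<lambda>r. occ \<sigma> r $ x) = (\<integral>s. \<sigma> s $ x * (exp (min s t) - 1) * indicator {0..} s \<partial>expd)"
proof -
  define f where "f s = \<sigma> s $ x" for s
  note [measurable] = ctrl_measurable[OF \<sigma>] occ_measurable[OF \<sigma>]
  have fm[measurable]: "f \<in> borel_measurable borel" unfolding f_def by measurable
  have f: "0 \<le> f s" "f s \<le> 1" for s unfolding f_def by (rule ctrl_nonneg[OF \<sigma>], rule ctrl_le1[OF \<sigma>])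
  have o: "0 \<le> occ \<sigma> r $ x" "occ \<sigma> r $ x \<le> 1" for r using prob_vectorsD[OF occ_prob[OF \<sigma>]] by auto
  interpret P: pair_sigma_finite expd lborel ..
  define F where "F s r = ennreal (f s) * indicator {0..} s * (ennreal (exp r) * (indicator {0..t} r * (if r \<le> s then 1 else 0)))" for s r :: real
  have Fm: "(\<lambda>(s, r). F s r) \<in> borel_measurable (expd \<Otimes>\<^sub>M lborel)"
    unfolding F_def by measurable
  have inner1: "(\<integral>\<^sup>+s. F s r \<partial>expd) = ennreal (occ \<sigma> r $ x) * indicator {0..t} r" for r
  proof (cases "r \<in> {0..t}")
    case True
    then have r: "0 \<le> r" by simp
    have "(\<integral>\<^sup>+s. F s r \<partial>expd) = (\<integral>\<^sup>+s. ennreal (exp r) * (ennreal (f s) * indicator {r..} s) \<partial>expd)"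
      unfolding F_def using True by (intro nn_integral_cong) (auto simp: indicator_def mult.commute)
    also have "\<dots> = ennreal (exp r) * (\<integral>\<^sup>+s. ennreal (f s) * indicator {r..} s \<partial>expd)"
      by (intro nn_integral_cmult) auto
    also have "(\<integral>\<^sup>+s. ennreal (f s) * indicator {r..} s \<partial>expd) = ennreal (exp (- r)) * (\<integral>\<^sup>+s. ennreal (f (s + r)) \<partial>expd)"
      by (rule nn_integral_expd_shift[OF _ r]) measurable
    also have "(\<integral>\<^sup>+s. ennreal (f (s + r)) \<partial>expd) = ennreal (\<integral>s. f (s + r) \<partial>expd)"
      by (intro nn_integral_eq_integral expd_bounded_integrable[where B=1]) (auto simp: f)
    also have "(\<integral>s. f (s + r) \<partial>expd) = occ \<sigma> r $ x" by (simp add: occ_def f_def add.commute)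
    also have "ennreal (exp r) * (ennreal (exp (- r)) * ennreal (occ \<sigma> r $ x)) = ennreal (occ \<sigma> r $ x)"
      by (simp add: mult.assoc[symmetric] ennreal_mult[symmetric] exp_minus_inverse)
    finally show ?thesis using True by simp
  next
    case False
    then show ?thesis by (simp add: F_def)
  qed
  have inner2: "(\<integral>\<^sup>+r. F s r \<partial>lborel) = ennreal (f s * (exp (min s t) - 1) * indicator {0..} s)" for s
  proof (cases "0 \<le> s")
    case True
    have "(\<integral>\<^sup>+r. F s r \<partial>lborel) = (\<integral>\<^sup>+r. ennreal (f s) * (ennreal (exp r) * indicator {0..min s t} r) \<partial>lborel)"
      unfolding F_def using True by (intro nn_integral_cong) (auto simp: indicator_def)
    also have "\<dots> = ennreal (f s) * (\<integral>\<^sup>+r. ennreal (exp r) * indicator {0..min s t} r \<partial>lborel)"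
      by (intro nn_integral_cmult) auto
    also have "(\<integral>\<^sup>+r. ennreal (exp r) * indicator {0..min s t} r \<partial>lborel) = ennreal (exp (min s t) - exp 0)"
      using True t by (intro nn_integral_FTC_Icc) (auto intro!: derivative_eq_intros)
    finally show ?thesis using True f by (simp add: ennreal_mult')
  next
    case False
    then show ?thesis by (simp add: F_def)
  qed
  have "ennreal (integral {0..t} (\<lambda>r. occ \<sigma> r $ x)) = (\<integral>\<^sup>+r. ennreal (occ \<sigma> r $ x) * indicator {0..t} r \<partial>lborel)"
    by (rule nn_integral_bounded_Icc(1)[symmetric]) (auto simp: o)
  also have "\<dots> = (\<integral>\<^sup>+r. (\<integral>\<^sup>+s. F s r \<partial>expd) \<partial>lborel)" unfolding inner1 ..
  also have "\<dots> = (\<integral>\<^sup>+s. (\<integral>\<^sup>+r. F s r \<partial>lborel) \<partial>expd)" by (rule P.Fubini'[OF Fm])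
  also have "\<dots> = (\<integral>\<^sup>+s. ennreal (f s * (exp (min s t) - 1) * indicator {0..} s) \<partial>expd)" unfolding inner2 ..
  also have "\<dots> = ennreal (\<integral>s. f s * (exp (min s t) - 1) * indicator {0..} s \<partial>expd)"
  proof (rule nn_integral_eq_integral)
    have b: "\<bar>f s * (exp (min s t) - 1) * indicator {0..} s\<bar> \<le> 1 * exp t" for s
    proof (cases "0 \<le> s")
      case True
      have "exp (min s t) \<le> exp t" "1 \<le> exp (min s t)" using True t by simp_all
      then have "0 \<le> exp (min s t) - 1" "exp (min s t) - 1 \<le> exp t" by linarith+
      then show ?thesis using f[of s] True by (simp add: abs_mult) (intro mult_mono[of "f s" 1, simplified]; simp)
    qed simp
    show "integrable expd (\<lambda>s. f s * (exp (min s t) - 1) * indicator {0..} s)"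
      using b by (intro expd_bounded_integrable[where B="1 * exp t"]) auto
    show "AE s in expd. 0 \<le> f s * (exp (min s t) - 1) * indicator {0..} s"
      using f t by (auto simp: indicator_def)
  qed
  finally have "ennreal (integral {0..t} (\<lambda>r. occ \<sigma> r $ x)) = ennreal (\<integral>s. f s * (exp (min s t) - 1) * indicator {0..} s \<partial>expd)" .
  moreover have "0 \<le> integral {0..t} (\<lambda>r. occ \<sigma> r $ x)"
    by (rule nn_integral_bounded_Icc(2)) (auto simp: o)
  moreover have "0 \<le> (\<integral>s. f s * (exp (min s t) - 1) * indicator {0..} s \<partial>expd)"
    using f t by (intro Bochner_Integration.integral_nonneg) (auto simp: indicator_def)
  ultimately show ?thesis by (simp add: f_def)
qed

text \<open>The factor \<open>exp s\<close> undoes the discount; the endpoint \<open>t\<close> is a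
  null set.\<close>

lemma integral_exp_expd:
  assumes \<sigma>: "\<sigma> \<in> ctrl"
  shows "(\<integral>s. \<sigma> s $ x * exp s * indicator {0..<t} s \<partial>expd) = integral {0..t} (\<lambda>s. \<sigma> s $ x)"
proof -
  note [measurable] = ctrl_measurable[OF \<sigma>]
  have "(\<integral>s. \<sigma> s $ x * exp s * indicator {0..<t} s \<partial>expd) = enn2real (\<integral>\<^sup>+s. ennreal (\<sigma> s $ x * exp s * indicator {0..<t} s) \<partial>expd)"
    by (intro integral_eq_nn_integral) (auto simp: ctrl_nonneg[OF \<sigma>])
  also have "(\<integral>\<^sup>+s. ennreal (\<sigma> s $ x * exp s * indicator {0..<t} s) \<partial>expd) =
      (\<integral>\<^sup>+s\<in>{0..}. ennreal (exp (- s)) * ennreal (\<sigma> s $ x * exp s * indicator {0..<t} s) \<partial>lborel)"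
    by (rule nn_integral_expd) measurable
  also have "\<dots> = (\<integral>\<^sup>+s. ennreal (\<sigma> s $ x) * indicator {0..t} s \<partial>lborel)"
  proof (rule nn_integral_cong_AE)
    have "AE s in lborel. s \<noteq> t" by (rule AE_lborel_singleton)
    then show "AE s in lborel. ennreal (exp (- s)) * ennreal (\<sigma> s $ x * exp s * indicator {0..<t} s) * indicator {0..} s =
        ennreal (\<sigma> s $ x) * indicator {0..t} s"
    proof eventually_elim
      case (elim s)
      have E: "exp (- s) * (\<sigma> s $ x * exp s) = \<sigma> s $ x" by (simp add: exp_minus)
      have "ennreal (exp (- s)) * ennreal (\<sigma> s $ x * exp s) = ennreal (\<sigma> s $ x)"
        unfolding ennreal_mult'[OF exp_ge_zero, symmetric] E ..
      then show ?case using elim by (auto simp: indicator_def)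
    qed
  qed
  also have "\<dots> = ennreal (integral {0..t} (\<lambda>s. \<sigma> s $ x))"
    by (rule nn_integral_bounded_Icc(1)) (auto simp: ctrl_nonneg[OF \<sigma>] ctrl_le1[OF \<sigma>])
  also have "enn2real \<dots> = integral {0..t} (\<lambda>s. \<sigma> s $ x)"
    by (intro enn2real_ennreal nn_integral_bounded_Icc(2)) (auto simp: ctrl_nonneg[OF \<sigma>] ctrl_le1[OF \<sigma>])
  finally show ?thesis .
qed

text \<open>The weight \<open>exp (min s t) - 1\<close> left by Fubini's theorem is
  \<open>exp s - 1\<close> before \<open>t\<close>, where \<open>exp s\<close> yields the integral
  of \<sigma>, and constant after \<open>t\<close>; the remaining terms recombine through
  \<open>occ_split\<close>.\<close>

lemma occ_ode:
  assumes \<sigma>: "\<sigma> \<in> ctrl" and t: "0 \<le> t"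
  shows "occ \<sigma> t = occ \<sigma> 0 - integral {0..t} \<sigma> + integral {0..t} (occ \<sigma>)"
proof -
  note [measurable] = ctrl_measurable[OF \<sigma>]
  have iS: "\<sigma> integrable_on {0..t}" by (rule set_borel_integral_eq_integral(1)[OF ctrl_set_integrable[OF \<sigma>]])
  have iO: "occ \<sigma> integrable_on {0..t}" by (intro integrable_continuous_interval occ_continuous \<sigma>)
  have "integral {0..t} (occ \<sigma>) $ x = integral {0..t} \<sigma> $ x - occ \<sigma> 0 $ x + occ \<sigma> t $ x" for x
  proof -
    define f where "f s = \<sigma> s $ x" for s
    have [measurable]: "f \<in> borel_measurable borel" unfolding f_def by measurable
    have f: "0 \<le> f s" "f s \<le> 1" for s unfolding f_def by (rule ctrl_nonneg[OF \<sigma>], rule ctrl_le1[OF \<sigma>])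
    have I1: "integrable expd (\<lambda>s. f s * exp s * indicator {0..<t} s)"
    proof (rule expd_bounded_integrable[where B="1 * exp t"])
      fix s
      have "f s * exp s \<le> 1 * exp t" if "s < t" using f[of s] that by (intro mult_mono) auto
      then show "norm (f s * exp s * indicator {0..<t} s) \<le> 1 * exp t" using f[of s] by (auto simp: indicator_def)
    qed measurable
    have I2: "integrable expd (\<lambda>s. f s * indicator A s)" if "A \<in> sets borel" for A
      using that f by (intro expd_bounded_integrable[where B=1]) (auto simp: indicator_def)
    have "integral {0..t} (occ \<sigma>) $ x = (\<integral>s. f s * (exp (min s t) - 1) * indicator {0..} s \<partial>expd)"
      using occ_integral_Fubini[OF \<sigma> t, of x] integral_component_eq_cart[OF iO, of x] by (simp add: f_def)
    also have "\<dots> = (\<integral>s. f s * exp s * indicator {0..<t} s - f s * indicator {..<t} s + (exp t - 1) * (f s * indicator {t..} s) \<partial>expd)"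
      using AE_expd_nonneg t by (intro integral_cong_AE) (measurable, auto elim!: eventually_mono simp: indicator_def algebra_simps)
    also have "\<dots> = (\<integral>s. f s * exp s * indicator {0..<t} s \<partial>expd) - (\<integral>s. f s * indicator {..<t} s \<partial>expd)
        + (exp t - 1) * (\<integral>s. f s * indicator {t..} s \<partial>expd)"
      using I1 I2 by simp
    also have "(\<integral>s. f s * exp s * indicator {0..<t} s \<partial>expd) = integral {0..t} \<sigma> $ x"
      unfolding f_def integral_exp_expd[OF \<sigma>] using iS by simp
    also have "(\<integral>s. f s * indicator {..<t} s \<partial>expd) = occ \<sigma> 0 $ x - exp (- t) * occ \<sigma> t $ x"
      using occ_split[OF \<sigma> t, of 0 x] by (simp add: f_def)
    also have "(\<integral>s. f s * indicator {t..} s \<partial>expd) = exp (- t) * occ \<sigma> t $ x"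
      by (subst integral_expd_shift[where B=1]) (auto simp: f t occ_def f_def[symmetric] add.commute)
    finally show ?thesis by (simp add: algebra_simps exp_minus)
  qed
  then show ?thesis by (simp add: vec_eq_iff)
qed

text \<open>The equation says \<open>D' = D\<close>, so \<open>exp (- t) *\<^sub>R D t\<close> is
  constant, and boundedness leaves only the constant 0. This determines the value at 0 as
  well.\<close>

lemma bounded_solution_zero:
  fixes D :: "real \<Rightarrow> 'a::euclidean_space"
  assumes cont: "continuous_on {0..} D" and eq: "\<And>t. 0 \<le> t \<Longrightarrow> D t = d + integral {0..t} D"
    and bd: "\<And>t. 0 \<le> t \<Longrightarrow> norm (D t) \<le> b" and t: "0 \<le> t"
  shows "D t = 0"
proof -
  have const: "exp (- T) *\<^sub>R D T = D 0" if T: "0 \<le> T" for T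
  proof -
    have cT: "continuous_on {0..T} D" using cont by (rule continuous_on_subset) auto
    have "((\<lambda>t. exp (- t) *\<^sub>R D t) has_vector_derivative 0) (at s within {0..T})" if s: "s \<in> {0..T}" for s
    proof -
      have "((\<lambda>u. d + integral {0..u} D) has_vector_derivative D s) (at s within {0..T})"
        using integral_has_vector_derivative[OF cT s] by (auto intro!: derivative_eq_intros)
      then have Ds: "(D has_vector_derivative D s) (at s within {0..T})"
        by (rule has_vector_derivative_transform[OF s, rotated]) (use eq in auto)
      have "((\<lambda>t. exp (- t)) has_field_derivative - exp (- s)) (at s within {0..T})"
        by (auto intro!: derivative_eq_intros)
      from has_vector_derivative_scaleR[OF this Ds] show ?thesis by simp
    qed
    from has_vector_derivative_zero_constant[OF convex_closed_interval this]
    obtain k where "\<And>s. s \<in> {0..T} \<Longrightarrow> exp (- s) *\<^sub>R D s = k" by blast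
    from this[of T] this[of 0] T show ?thesis by simp
  qed
  have "norm (D 0) \<le> 0"
  proof (rule tendsto_lowerbound[of "\<lambda>T. exp (- T) * b" 0 at_top "norm (D 0)"])
    show "((\<lambda>T. exp (- T) * b) \<longlongrightarrow> 0) at_top" by real_asymp
    show "\<forall>\<^sub>F T in at_top. norm (D 0) \<le> exp (- T) * b"
      using eventually_ge_at_top[of 0]
    proof eventually_elim
      case (elim T)
      have "norm (D 0) = exp (- T) * norm (D T)" using const[OF elim] by (metis abs_exp_cancel norm_scaleR)
      then show ?case using bd[OF elim] by simp
    qed
  qed simp
  then have "exp (- t) *\<^sub>R D t = 0" using const[OF t] by simp
  then show ?thesis by simp
qed

text \<open>Two paths in the simplex have a bounded difference, so they agree everywhere, 0
  included; the starting point \<open>m\<close> is thereby determined by \<sigma>.\<close>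

lemma solution_eq_occ:
  fixes M :: "real \<Rightarrow> real ^ 'd::finite"
  assumes \<sigma>: "\<sigma> \<in> ctrl" and cont: "continuous_on {0..} M"
    and eq: "\<And>t. 0 \<le> t \<Longrightarrow> M t = m - integral {0..t} \<sigma> + integral {0..t} M"
    and M: "\<And>t. 0 \<le> t \<Longrightarrow> M t \<in> prob_vectors" and t: "0 \<le> t"
  shows "M t = occ \<sigma> t"
proof -
  have "M t - occ \<sigma> t = 0"
  proof (rule bounded_solution_zero[where b=2 and d="m - occ \<sigma> 0", OF _ _ _ t])
    show "continuous_on {0..} (\<lambda>t. M t - occ \<sigma> t)" by (intro continuous_intros cont occ_continuous \<sigma>)
    fix t :: real assume t: "0 \<le> t"
    have i: "M integrable_on {0..t}" "occ \<sigma> integrable_on {0..t}"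
      by (auto intro!: integrable_continuous_interval occ_continuous \<sigma> continuous_on_subset[OF cont])
    show "M t - occ \<sigma> t = m - occ \<sigma> 0 + integral {0..t} (\<lambda>t. M t - occ \<sigma> t)"
      unfolding Henstock_Kurzweil_Integration.integral_diff[OF i]
      by (subst eq[OF t], subst occ_ode[OF \<sigma> t]) simp
    show "norm (M t - occ \<sigma> t) \<le> 2"
      using norm_triangle_ineq4[of "M t" "occ \<sigma> t"] norm_prob_le1[OF M[OF t]] norm_prob_le1[OF occ_prob[OF \<sigma>, of t]]
      by linarith
  qed
  then show ?thesis by simp
qed

subsection \<open>The rate function in terms of controls\<close>

lemma cond21_prob:
  assumes l: "l \<in> prob_vectors" and pos: "marginal1 l $ x \<noteq> 0"
  shows "cond21 l x \<in> prob_vectors"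
proof -
  have "0 \<le> marginal1 l $ x" unfolding marginal1_def using prob_vectorsD(1)[OF l] by (simp add: sum_nonneg)
  moreover have "(\<Sum>y\<in>UNIV. cond21 l x $ y) = marginal1 l $ x / marginal1 l $ x"
    unfolding cond21_def by (simp add: marginal1_def flip: sum_divide_distrib)
  ultimately show ?thesis using pos prob_vectorsD(1)[OF l] by (auto simp: prob_vectors_def cond21_def)
qed

lemma marginal1_prob:
  assumes l: "l \<in> prob_vectors"
  shows "marginal1 l \<in> prob_vectors"
proof -
  have "(\<Sum>x\<in>UNIV. marginal1 l $ x) = (\<Sum>z\<in>UNIV. l $ z)"
    by (simp add: marginal1_def sum.cartesian_product flip: UNIV_Times_UNIV)
  then show ?thesis using prob_vectorsD[OF l] by (auto simp: prob_vectors_def marginal1_def sum_nonneg)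
qed

text \<open>This is why only the marginals of the controls matter when \<open>G m\<close> has identical rows.\<close>

lemma rent_le_cond_sum:
  fixes l :: "real ^ ('d::finite \<times> 'd)"
  assumes l: "l \<in> prob_vectors" and eq: "marginal1 l = marginal2 l" and q: "q \<in> prob_vectors"
  shows "rent (marginal1 l) q \<le> e2ennreal (\<Sum>x\<in>UNIV. ereal (marginal1 l $ x) * rel_entropy (cond21 l x) q)"
proof (rule rent_leI[OF marginal1_prob[OF l] q])
  fix s
  let ?m = "marginal1 l"
  have mp: "?m \<in> prob_vectors" by (rule marginal1_prob[OF l])
  have mc: "?m $ x * cond21 l x $ y = l $ (x, y)" for x y
  proof (cases "?m $ x = 0")
    case True
    then have "l $ (x, y) = 0" using prob_vectorsD(1)[OF l]
      by (simp add: marginal1_def sum_nonneg_eq_0_iff)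
    then show ?thesis using True by simp
  qed (simp add: cond21_def)
  have "(\<Sum>x\<in>UNIV. ?m $ x * aff s (cond21 l x) q) =
      (\<Sum>x\<in>UNIV. \<Sum>y\<in>UNIV. l $ (x, y) * s $ y) - (\<Sum>x\<in>UNIV. ?m $ x * (\<Sum>y\<in>UNIV. q $ y * (exp (s $ y) - 1)))"
    unfolding aff_def sum_subtractf[of _ _ UNIV] right_diff_distrib sum_subtractf
    by (simp add: sum_distrib_left mc[symmetric] mult.assoc)
  also have "(\<Sum>x\<in>UNIV. ?m $ x * (\<Sum>y\<in>UNIV. q $ y * (exp (s $ y) - 1))) = (\<Sum>y\<in>UNIV. q $ y * (exp (s $ y) - 1))"
    using prob_vectorsD(3)[OF mp] by (simp flip: sum_distrib_right)
  also have "(\<Sum>x\<in>UNIV. \<Sum>y\<in>UNIV. l $ (x, y) * s $ y) = (\<Sum>y\<in>UNIV. \<Sum>x\<in>UNIV. l $ (x, y) * s $ y)"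
    by (rule sum.swap)
  also have "\<dots> = (\<Sum>y\<in>UNIV. ?m $ y * s $ y)"
    by (subst eq) (simp add: marginal2_def sum_distrib_right)
  finally have "aff s ?m q = (\<Sum>x\<in>UNIV. ?m $ x * aff s (cond21 l x) q)"
    by (simp add: aff_def sum_subtractf)
  then have "ereal (aff s ?m q) = (\<Sum>x\<in>UNIV. ereal (?m $ x) * ereal (aff s (cond21 l x) q))" by simp
  also have "\<dots> \<le> (\<Sum>x\<in>UNIV. ereal (?m $ x) * rel_entropy (cond21 l x) q)"
  proof (rule sum_mono)
    fix x
    show "ereal (?m $ x) * ereal (aff s (cond21 l x) q) \<le> ereal (?m $ x) * rel_entropy (cond21 l x) q"
    proof (cases "?m $ x = 0")
      case False
      then show ?thesis using prob_vectorsD(1)[OF mp, of x]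
        by (intro ereal_mult_left_mono aff_le_rel_entropy cond21_prob l q) auto
    qed (simp add: zero_ereal_def[symmetric])
  qed
  finally have "e2ennreal (ereal (aff s ?m q)) \<le> e2ennreal (\<Sum>x\<in>UNIV. ereal (?m $ x) * rel_entropy (cond21 l x) q)"
    by (rule e2ennreal_mono)
  then show "ennreal (aff s ?m q) \<le> e2ennreal (\<Sum>x\<in>UNIV. ereal (?m $ x) * rel_entropy (cond21 l x) q)" by simp
qed

lemma e2ennreal_mult_pos: "0 < a \<Longrightarrow> 0 \<le> y \<Longrightarrow> e2ennreal (ereal a * y) = ennreal a * e2ennreal y"
  by (cases y) (auto simp: ennreal_mult' ennreal_mult_top)

lemma cond_sum_nonneg:
  assumes l: "l \<in> prob_vectors" and q: "q \<in> prob_vectors"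
  shows "0 \<le> (\<Sum>x\<in>UNIV. ereal (marginal1 l $ x) * rel_entropy (cond21 l x) q)"
proof (rule sum_nonneg)
  fix x
  show "0 \<le> ereal (marginal1 l $ x) * rel_entropy (cond21 l x) q"
  proof (cases "marginal1 l $ x = 0")
    case False
    then show ?thesis using prob_vectorsD(1)[OF marginal1_prob[OF l], of x]
      by (intro ereal_0_le_mult rel_entropy_nonneg cond21_prob l q) auto
  qed (simp add: zero_ereal_def[symmetric])
qed

context
  fixes K A :: "real ^ 'd::finite ^ 'd" and G :: "real ^ 'd \<Rightarrow> real ^ 'd ^ 'd"
  assumes K: "K \<in> transition_kernels" and A: "\<And>x y. A $ x $ y = 1"
    and G: "\<And>m x. m \<in> prob_vectors \<Longrightarrow> G m $ x = m v* K"
begin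

lemma control_cost_eq:
  assumes "\<And>s. 0 \<le> s \<Longrightarrow> \<eta> s \<in> prob_vectors" and "\<And>s. 0 \<le> s \<Longrightarrow> M s \<in> prob_vectors"
  shows "control_cost G \<eta> M = (\<integral>\<^sup>+s\<in>{0..}. ennreal (exp (- s)) *
    e2ennreal (\<Sum>x\<in>UNIV. ereal (marginal1 (\<eta> s) $ x) * rel_entropy (cond21 (\<eta> s) x) (M s v* K)) \<partial>lborel)"
  unfolding control_cost_def
proof (rule nn_integral_cong)
  fix s :: real
  show "e2ennreal (ereal (exp (- s)) * (\<Sum>x\<in>UNIV. ereal (marginal1 (\<eta> s) $ x) * rel_entropy (cond21 (\<eta> s) x) (G (M s) $ x))) * indicator {0..} s =
    ennreal (exp (- s)) * e2ennreal (\<Sum>x\<in>UNIV. ereal (marginal1 (\<eta> s) $ x) * rel_entropy (cond21 (\<eta> s) x) (M s v* K)) * indicator {0..} s"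
  proof (cases "0 \<le> s")
    case True
    then have "0 \<le> (\<Sum>x\<in>UNIV. ereal (marginal1 (\<eta> s) $ x) * rel_entropy (cond21 (\<eta> s) x) (M s v* K))"
      using assms K by (intro cond_sum_nonneg vec_kernel_prob) auto
    then show ?thesis using True assms by (simp add: G e2ennreal_mult_pos)
  qed simp
qed

text \<open>Passing to the first marginal preserves the integral equation and, by
  \<open>rent_le_cond_sum\<close>, does not increase the cost.\<close>

lemma admissible_ach:
  assumes adm: "(\<eta>, M) \<in> admissible_pairs A m" and c: "0 \<le> c" "control_cost G \<eta> M \<le> ennreal c"
  shows "achievable K m c"
proof -
  have eta: "\<eta> \<in> borel_measurable (restrict_space borel {0..})" "\<And>s. 0 \<le> s \<Longrightarrow> \<eta> s \<in> prob_vectors"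
    and ode: "continuous_on {0..} M" "\<And>t. 0 \<le> t \<Longrightarrow> M t = m - integral {0..t} (\<lambda>s. marginal1 (\<eta> s)) + integral {0..t} M"
    and marg: "AE s in lborel. 0 \<le> s \<longrightarrow> marginal1 (\<eta> s) = marginal2 (\<eta> s)"
    and M: "\<And>t. 0 \<le> t \<Longrightarrow> M t \<in> prob_vectors"
    using adm by (auto simp: admissible_pairs_def controls_def solves_ode_def)
  \<comment> \<open>\<open>ctrl\<close> asks for values at negative times too; the value at 0 is
    repeated there.\<close>
  define \<sigma> where "\<sigma> s = marginal1 (\<eta> (max 0 s))" for s
  have "(\<lambda>s. \<eta> (max 0 s)) \<in> borel_measurable borel"
    by (rule measurable_compose[OF _ eta(1)]) (auto intro!: measurable_restrict_space2)
  moreover have "marginal1 \<in> borel_measurable borel"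
    unfolding marginal1_def by (intro borel_measurable_continuous_onI continuous_intros continuous_on_vec_lambda)
  ultimately have "\<sigma> \<in> borel_measurable borel" unfolding \<sigma>_def by (rule measurable_compose)
  then have \<sigma>: "\<sigma> \<in> ctrl" using eta(2) by (auto simp: ctrl_def \<sigma>_def intro!: marginal1_prob)
  have Mo: "M t = occ \<sigma> t" if "0 \<le> t" for t
  proof (rule solution_eq_occ[OF \<sigma> ode(1) _ M that])
    fix t :: real assume t: "0 \<le> t"
    have "integral {0..t} (\<lambda>s. marginal1 (\<eta> s)) = integral {0..t} \<sigma>"
      by (intro Henstock_Kurzweil_Integration.integral_cong) (auto simp: \<sigma>_def)
    then show "M t = m - integral {0..t} \<sigma> + integral {0..t} M" using ode(2)[OF t] by simp
  qed
  have "m = occ \<sigma> 0" using Mo[of 0] ode(2)[of 0] by simp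
  moreover have "cost K \<sigma> \<le> ennreal c"
  proof -
    have "cost K \<sigma> = (\<integral>\<^sup>+s\<in>{0..}. ennreal (exp (- s)) * rent (\<sigma> s) (occ \<sigma> s v* K) \<partial>lborel)"
      unfolding cost_def by (intro nn_integral_expd cost_integrand_measurable \<sigma> K)
    also have "\<dots> \<le> (\<integral>\<^sup>+s\<in>{0..}. ennreal (exp (- s)) *
        e2ennreal (\<Sum>x\<in>UNIV. ereal (marginal1 (\<eta> s) $ x) * rel_entropy (cond21 (\<eta> s) x) (M s v* K)) \<partial>lborel)"
    proof (rule nn_integral_mono_AE, use marg in eventually_elim)
      case (elim s)
      show ?case
      proof (cases "0 \<le> s")
        case True
        then show ?thesis
          using rent_le_cond_sum[OF eta(2)[OF True] elim[rule_format, OF True] vec_kernel_prob[OF M[OF True] K]]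
          by (simp add: \<sigma>_def Mo mult_left_mono)
      qed simp
    qed
    also have "\<dots> = control_cost G \<eta> M"
      by (rule control_cost_eq[symmetric]) (auto intro: eta M)
    finally show ?thesis using c(2) by simp
  qed
  ultimately show ?thesis using \<sigma> c(1) by (auto simp: achievable_def)
qed

text \<open>The product control \<open>\<sigma> s $ x * \<sigma> s $ y\<close> has the conditional
  laws \<sigma>, so no cost is added. The occupation placed on the diagonal serves as pair path:
  both marginals are right and the Lipschitz constant is inherited. As all pairs are adjacent, the
  support conditions hold.\<close>

lemma achievable_admissible:
  assumes "achievable K m c"
  obtains \<eta> M where "(\<eta>, M) \<in> admissible_pairs A m" "control_cost G \<eta> M \<le> ennreal c"
proof -
  obtain \<sigma> where \<sigma>: "\<sigma> \<in> ctrl" and m: "occ \<sigma> 0 = m" and c: "cost K \<sigma> \<le> ennreal c"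
    using assms by (auto simp: achievable_def)
  note [measurable] = ctrl_measurable[OF \<sigma>]
  define \<eta> where "\<eta> s = (\<chi> z. \<sigma> s $ fst z * \<sigma> s $ snd z)" for s
  define Mp where "Mp t = (\<chi> z. if fst z = snd z then occ \<sigma> t $ fst z else 0)" for t
  have m1: "marginal1 (\<eta> s) = \<sigma> s" for s
    by (simp add: marginal1_def \<eta>_def vec_eq_iff ctrl_sum[OF \<sigma>] flip: sum_distrib_left)
  have m2: "marginal2 (\<eta> s) = \<sigma> s" for s
    by (simp add: marginal2_def \<eta>_def vec_eq_iff ctrl_sum[OF \<sigma>] flip: sum_distrib_right)
  have sum_pairs: "(\<Sum>z\<in>UNIV. h z) = (\<Sum>x\<in>UNIV. \<Sum>y\<in>UNIV. h (x, y))" for h :: "'d \<times> 'd \<Rightarrow> real"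
    by (simp add: sum.cartesian_product flip: UNIV_Times_UNIV)
  have \<eta>p: "\<eta> s \<in> prob_vectors" for s
    using ctrl_nonneg[OF \<sigma>] by (auto simp: prob_vectors_def \<eta>_def sum_pairs ctrl_sum[OF \<sigma>] simp flip: sum_distrib_left)
  have \<eta>m: "\<eta> \<in> borel_measurable borel"
  proof -
    have "continuous_on UNIV (\<lambda>v::real ^ 'd. \<chi> z. v $ fst z * v $ snd z)"
      by (intro continuous_on_vec_lambda continuous_intros)
    from borel_measurable_continuous_onI[OF this] show ?thesis
      unfolding \<eta>_def by (rule measurable_compose[OF ctrl_measurable[OF \<sigma>]])
  qed
  have adj: "- adj_set A = {}" by (auto simp: adj_set_def A)
  have "pair_path A (occ \<sigma>) Mp"
    unfolding pair_path_def adj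
  proof (intro conjI allI impI ballI)
    show "continuous_on {0..} Mp" unfolding Mp_def
    proof (intro continuous_on_vec_lambda)
      show "continuous_on {0..} (\<lambda>t. if fst z = snd z then occ \<sigma> t $ fst z else 0)" for z
        by (cases "fst z = snd z") (auto intro!: continuous_intros occ_continuous \<sigma>)
    qed
    show "Mp t \<in> prob_vectors" for t
      using prob_vectorsD[OF occ_prob[OF \<sigma>, of t]] by (auto simp: prob_vectors_def Mp_def sum_pairs)
    show "marginal1 (Mp t) = occ \<sigma> t" "marginal2 (Mp t) = occ \<sigma> t" for t
      by (auto simp: marginal1_def marginal2_def Mp_def vec_eq_iff)
    show "l1_norm (Mp t - Mp s) \<le> 2 * \<bar>t - s\<bar>" for s t
    proof -
      have "l1_norm (Mp t - Mp s) = (\<Sum>x\<in>UNIV. \<Sum>y\<in>UNIV. if x = y then \<bar>occ \<sigma> t $ x - occ \<sigma> s $ x\<bar> else 0)"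
        unfolding l1_norm_def sum_pairs by (intro sum.cong) (auto simp: Mp_def)
      also have "\<dots> = l1_norm (occ \<sigma> t - occ \<sigma> s)" by (simp add: l1_norm_def)
      also have "\<dots> \<le> 2 * \<bar>t - s\<bar>" by (rule occ_Lipschitz[OF \<sigma>])
      finally show ?thesis .
    qed
  qed auto
  moreover have "solves_ode m \<eta> (occ \<sigma>)"
    unfolding solves_ode_def m1 using occ_ode[OF \<sigma>] m by (auto intro: occ_continuous \<sigma>)
  ultimately have "(\<eta>, occ \<sigma>) \<in> admissible_pairs A m"
    unfolding admissible_pairs_def adj using \<eta>m \<eta>p occ_prob[OF \<sigma>]
    by (auto simp: controls_def m1 m2 intro: measurable_restrict_space1)
  moreover have "control_cost G \<eta> (occ \<sigma>) \<le> ennreal c"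
  proof -
    have "control_cost G \<eta> (occ \<sigma>) = (\<integral>\<^sup>+s\<in>{0..}. ennreal (exp (- s)) * rent (\<sigma> s) (occ \<sigma> s v* K) \<partial>lborel)"
      unfolding control_cost_eq[OF \<eta>p occ_prob[OF \<sigma>]] m1
    proof (rule nn_integral_cong)
      fix s
      have "ereal (\<sigma> s $ x) * rel_entropy (cond21 (\<eta> s) x) (occ \<sigma> s v* K) = ereal (\<sigma> s $ x) * rel_entropy (\<sigma> s) (occ \<sigma> s v* K)" for x
      proof (cases "\<sigma> s $ x = 0")
        case False
        then have "cond21 (\<eta> s) x = \<sigma> s" by (simp add: cond21_def m1 vec_eq_iff) (simp add: \<eta>_def)
        then show ?thesis by simp
      qed (simp add: zero_ereal_def[symmetric])
      then have "(\<Sum>x\<in>UNIV. ereal (\<sigma> s $ x) * rel_entropy (cond21 (\<eta> s) x) (occ \<sigma> s v* K)) =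
          (\<Sum>x\<in>UNIV. ereal (\<sigma> s $ x)) * rel_entropy (\<sigma> s) (occ \<sigma> s v* K)"
        by (subst sum_ereal_left_distrib) (auto simp: ctrl_nonneg[OF \<sigma>])
      also have "(\<Sum>x\<in>UNIV. ereal (\<sigma> s $ x)) = 1" using ctrl_sum[OF \<sigma>, of s] by (simp add: one_ereal_def)
      finally show "ennreal (exp (- s)) * e2ennreal (\<Sum>x\<in>UNIV. ereal (\<sigma> s $ x) * rel_entropy (cond21 (\<eta> s) x) (occ \<sigma> s v* K)) * indicator {0..} s =
          ennreal (exp (- s)) * rent (\<sigma> s) (occ \<sigma> s v* K) * indicator {0..} s"
        by (simp add: rent_def)
    qed
    also have "\<dots> = cost K \<sigma>"
      unfolding cost_def by (intro nn_integral_expd[symmetric] cost_integrand_measurable \<sigma> K)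
    finally show ?thesis using c by simp
  qed
  ultimately show thesis by (rule that)
qed

lemma rate_I_nonneg: "0 \<le> rate_I G A m"
  unfolding rate_I_def by (intro INF_greatest) (auto simp: enn2ereal_nonneg)

text \<open>The infimum gives achievability at \<open>c + e\<close> for every positive
  \<open>e\<close>, and \<open>achievable_closed\<close> removes the \<open>e\<close>; thus the
  infimum is attained when finite, and closedness passes to the sublevel sets.\<close>

lemma rate_I_le_iff: "rate_I G A m \<le> ereal c \<longleftrightarrow> achievable K m c"
proof
  assume le: "rate_I G A m \<le> ereal c"
  then have c: "0 \<le> c" using rate_I_nonneg[of m] by (metis ereal_less_eq(5) order_trans)
  show "achievable K m c"
  proof (rule achievable_closed[OF K c])
    fix e :: real assume e: "0 < e"
    have "rate_I G A m < ereal (c + e)" using le e by (metis ereal_less(2) le_less_trans less_add_same_cancel1 less_ereal.simps(1))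
    then obtain \<eta> M where p: "(\<eta>, M) \<in> admissible_pairs A m" "enn2ereal (control_cost G \<eta> M) < ereal (c + e)"
      unfolding rate_I_def by (auto simp: INF_less_iff)
    have "control_cost G \<eta> M \<le> ennreal (c + e)"
      using e2ennreal_mono[OF less_imp_le[OF p(2)]] by simp
    then have "achievable K m (c + e)" using c e by (intro admissible_ach[OF p(1)]) auto
    then show "\<exists>m' c'. achievable K m' c' \<and> dist m' m \<le> e \<and> c' \<le> c + e"
      using e by (intro exI[of _ m] exI[of _ "c + e"]) auto
  qed
next
  assume a: "achievable K m c"
  then have c: "0 \<le> c" by (simp add: achievable_def)
  obtain \<eta> M where p: "(\<eta>, M) \<in> admissible_pairs A m" "control_cost G \<eta> M \<le> ennreal c"
    by (rule achievable_admissible[OF a])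
  have "rate_I G A m \<le> enn2ereal (control_cost G \<eta> M)"
    unfolding rate_I_def by (rule INF_lower2[OF p(1)]) simp
  also have "\<dots> \<le> enn2ereal (ennreal c)" using p(2) by (simp add: less_eq_ennreal.rep_eq)
  finally show "rate_I G A m \<le> ereal c" using c by simp
qed

end

theorem mainTheorem3:
  fixes K :: "real ^ 'd::finite ^ 'd" and A :: "real ^ 'd ^ 'd"
    and G :: "real ^ 'd \<Rightarrow> real ^ 'd ^ 'd"
    and P :: "'w measure" and X :: "nat \<Rightarrow> 'w \<Rightarrow> 'd" and x0 :: 'd
  assumes "K \<in> transition_kernels" and "irreducible_kernel K"
    and "\<And>m x y. m \<in> prob_vectors \<Longrightarrow> G m $ x $ y = (\<Sum>z\<in>UNIV. m $ z * K $ z $ y)"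
    and "self_interacting_chain P G x0 X"
    and "\<And>x y. A $ x $ y = 1"
  shows "satisfies_LDP P (\<lambda>n \<omega>. empirical_measure (\<lambda>i. X i \<omega>) (n + 1)) prob_vectors (rate_I G A)"
proof -
  note K = assms(1)
  have Gy: "G m $ x $ y = (m v* K) $ y" if "m \<in> prob_vectors" for m x y
    using assms(3)[OF that] by (simp add: vec_kernel_nth)
  have Gm: "G m $ x = m v* K" if "m \<in> prob_vectors" for m x
    using Gy[OF that] by (simp add: vec_eq_iff)
  note iff = rate_I_le_iff[OF K assms(5) Gm]
  have prob: "\<P>(\<omega> in P. empirical_measure (\<lambda>i. X i \<omega>) (n + 1) \<in> B) = emp_prob K x0 n B" for n B
    by (rule prob_empirical_measure[OF _ assms(4)]) (rule Gy)
  obtain \<rho> C where \<rho>: "\<rho> \<in> prob_vectors" "\<And>y. 0 < \<rho> $ y" and C: "0 \<le> C" "lower_rate K x0 \<rho> C"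
    using lower_rate_start[OF K assms(2)] by blast
  define \<kappa> where "\<kappa> = Min (range (\<lambda>y. (\<rho> v* K) $ y))"
  have \<rho>K: "0 < (\<rho> v* K) $ y" for y
  proof -
    \<comment> \<open>A path from another state ends with an edge into \<open>y\<close>. With a
      single state the reflexive closure provides no edge, and the row sum has to.\<close>
    obtain z where z: "0 < K $ z $ y"
    proof (cases "\<exists>x. x \<noteq> y")
      case True
      then obtain x where "x \<noteq> y" by blast
      with irreducible_rtranclp[OF K assms(2), of x y] that show thesis by (auto elim: rtranclp.cases)
    next
      case False
      then have U: "(UNIV :: 'd set) = {y}" by auto
      have "K $ y $ y = 1" using kernelD(3)[OF K, of y] unfolding U by simp
      then show thesis using that[of y] by simp
    qed
    show ?thesis unfolding vec_kernel_nth
      using \<rho>(2) z kernelD(1)[OF K] by (intro sum_pos2[of UNIV z]) (auto intro!: mult_nonneg_nonneg less_imp_le[OF \<rho>(2)])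
  qed
  have \<kappa>: "0 < \<kappa>" "\<And>y. \<kappa> \<le> (\<rho> v* K) $ y"
    unfolding \<kappa>_def using \<rho>K by (auto simp: Min_gr_iff)
  have c1: "compact {m \<in> prob_vectors. rate_I G A m \<le> ereal c}" for c
  proof -
    have "closed {m. achievable K m c}"
      unfolding closed_sequential_limits
    proof (intro allI impI, elim conjE)
      fix f l assume f: "\<forall>n. f n \<in> {m. achievable K m c}" and l: "f \<longlonglongrightarrow> l"
      then have c0: "0 \<le> c" by (auto simp: achievable_def)
      show "l \<in> {m. achievable K m c}"
      proof (simp, rule achievable_closed[OF K c0])
        fix e :: real assume "0 < e"
        then have "\<forall>\<^sub>F n in sequentially. dist (f n) l < e" by (rule tendstoD[OF l])
        then obtain n where "dist (f n) l < e" by (auto dest!: eventually_happens)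
        then show "\<exists>m' c'. achievable K m' c' \<and> dist m' l \<le> e \<and> c' \<le> c + e"
          using f \<open>0 < e\<close> by (intro exI[of _ "f n"] exI[of _ c]) auto
      qed
    qed
    then have "compact (prob_vectors \<inter> {m. achievable K m c})" by (rule compact_Int_closed[OF compact_prob_vectors])
    also have "prob_vectors \<inter> {m. achievable K m c} = {m \<in> prob_vectors. rate_I G A m \<le> ereal c}"
      by (auto simp: iff)
    finally show ?thesis .
  qed
  have c2: "limsup (\<lambda>n. ereal (1 / real n) * ext_ln (emp_prob K x0 n F)) \<le> - (INF m\<in>F. rate_I G A m)"
    if F: "closedin (top_of_set prob_vectors) F" for F
  proof (rule ccontr)
    assume "\<not> ?thesis"
    then have "- (INF m\<in>F. rate_I G A m) < limsup (\<lambda>n. ereal (1 / real n) * ext_ln (emp_prob K x0 n F))"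
      by (simp only: not_le)
    \<comment> \<open>A real number between the two sides, either of which may be infinite;
      \<open>- r\<close> is a cost level at which no point of \<open>F\<close> is
      achievable.\<close>
    from ereal_dense2[OF this] obtain r where r: "- (INF m\<in>F. rate_I G A m) < ereal r"
      "ereal r < limsup (\<lambda>n. ereal (1 / real n) * ext_ln (emp_prob K x0 n F))"
      by blast
    have clF: "closed F" "F \<subseteq> prob_vectors"
      using F closed_prob_vectors by (auto intro: closedin_closed_trans dest: closedin_imp_subset)
    have "\<not> achievable K m (- r)" if "m \<in> F" for m
    proof
      assume "achievable K m (- r)"
      then have "rate_I G A m \<le> ereal (- r)" by (simp only: iff)
      then have "(INF m\<in>F. rate_I G A m) \<le> - ereal r" using that by (auto intro: INF_lower2)
      then have "- (- ereal r) \<le> - (INF m\<in>F. rate_I G A m)" by (simp only: ereal_minus_le_minus)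
      then have "ereal r \<le> - (INF m\<in>F. rate_I G A m)" by (simp only: ereal_uminus_uminus)
      with r(1) show False by simp
    qed
    from upper_bound[OF K \<rho>(1) \<kappa> clF this]
    have "\<forall>\<^sub>F n in sequentially. emp_prob K x0 n F \<le> exp (r * real n)" by simp
    then have "\<forall>\<^sub>F n in sequentially. ereal (1 / real n) * ext_ln (emp_prob K x0 n F) \<le> ereal r"
      using eventually_gt_at_top[of 0]
    proof eventually_elim
      case (elim n)
      show ?case
      proof (cases "emp_prob K x0 n F = 0")
        case True
        then show ?thesis using elim by (simp add: ext_ln_def)
      next
        case False
        have "0 \<le> emp_prob K x0 n F" unfolding emp_prob_def by (intro sum_nonneg count_prob_nonneg[OF K])
        with False have pos: "0 < emp_prob K x0 n F" by simp
        then have "ln (emp_prob K x0 n F) \<le> ln (exp (r * real n))" using elim(1) by (subst ln_le_cancel_iff) auto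
        then have "1 / real n * ln (emp_prob K x0 n F) \<le> r" using elim(2) by (simp add: divide_le_eq)
        then show ?thesis using False by (simp add: ext_ln_def)
      qed
    qed
    from Limsup_bounded[OF this] r(2) show False by simp
  qed
  have c3: "- (INF m\<in>U. rate_I G A m) \<le> liminf (\<lambda>n. ereal (1 / real n) * ext_ln (emp_prob K x0 n U))"
    if U: "openin (top_of_set prob_vectors) U" for U
  proof (rule ccontr)
    assume "\<not> ?thesis"
    then have "liminf (\<lambda>n. ereal (1 / real n) * ext_ln (emp_prob K x0 n U)) < - (INF m\<in>U. rate_I G A m)"
      by (simp only: not_le)
    from ereal_dense2[OF this] obtain r where r: "liminf (\<lambda>n. ereal (1 / real n) * ext_ln (emp_prob K x0 n U)) < ereal r"
      "ereal r < - (INF m\<in>U. rate_I G A m)"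
      by blast
    from r(2) have "- (- (INF m\<in>U. rate_I G A m)) < - ereal r" by (simp only: ereal_minus_less_minus)
    then have "(INF m\<in>U. rate_I G A m) < ereal (- r)" by (simp only: ereal_uminus_uminus uminus_ereal.simps)
    then obtain m where m: "m \<in> U" "rate_I G A m < ereal (- r)" by (auto simp: INF_less_iff)
    then obtain c where c: "rate_I G A m < ereal c" "ereal c < ereal (- r)" using ereal_dense2 by blast
    obtain V where V: "open V" "U = prob_vectors \<inter> V" using U by (auto simp: openin_open)
    obtain e where e: "0 < e" "ball m e \<subseteq> V" using V m by (auto elim: openE)
    \<comment> \<open>The ball must stay inside \<open>V\<close>, and the loss in the exponent
      within the gap between \<open>c\<close> and \<open>- r\<close>.\<close>
    define d where "d = min e (- r - c)"
    have d: "0 < d" "d \<le> e" "c + d \<le> - r" using e c by (auto simp: d_def)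
    have "lower_rate K x0 m c" using c(1) by (intro achievable_lower_rate[OF K \<rho>(1) C \<kappa>]) (simp add: iff[symmetric])
    then have "\<forall>\<^sub>F n in sequentially. exp (- (c + d) * real n) \<le> emp_prob K x0 n (ball m d)"
      using d(1) unfolding lower_rate_def by blast
    then have "\<forall>\<^sub>F n in sequentially. ereal r \<le> ereal (1 / real n) * ext_ln (emp_prob K x0 n U)"
      using eventually_gt_at_top[of 0]
    proof eventually_elim
      case (elim n)
      have "emp_prob K x0 n (ball m d) \<le> emp_prob K x0 n U"
        using e(2) d(2) V(2) by (intro emp_prob_mono[OF K]) auto
      with elim have le: "exp (- (c + d) * real n) \<le> emp_prob K x0 n U" by simp
      then have pos: "0 < emp_prob K x0 n U" by (rule less_le_trans[rotated]) simp
      have "r * real n \<le> - (c + d) * real n" using d(3) by (intro mult_right_mono) auto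
      also have "\<dots> \<le> ln (emp_prob K x0 n U)" using le pos by (simp add: ln_ge_iff)
      finally have "r \<le> 1 / real n * ln (emp_prob K x0 n U)" using elim(2) by (simp add: le_divide_eq)
      then show ?case using pos by (simp add: ext_ln_def)
    qed
    from Liminf_bounded[OF this] r(1) show False by simp
  qed
  show ?thesis
    unfolding satisfies_LDP_def prob
    by (intro conjI ballI allI impI rate_I_nonneg[OF K assms(5) Gm] c1 c2 c3)
qed

end
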